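(* Let $F=F(a,b)$ be the free group with basis $\{a,b\}$ and let $p_1,p_2,p_3,\ldots=2,3,5,\ldots$ be the ascending sequence of prime numbers. For $n\geqslant 1$ let $$A_n=a^{p_{4n-3}}\,b^{p_{4n-2}}\,a^{p_{4n-1}}\,b^{p_{4n}}\in F,$$ so $A_1=a^2b^3a^5b^7$, $A_2=a^{11}b^{13}a^{17}b^{19}$, etc. For $j\geqslant 1$ let $h_j=A_{j+1}A_{j+2}A_j^5A_{j+2}A_{j+1}$. For $m\geqslant 1$ let $$H_m=\langle h_1,\ldots,h_{m-1},A_m^5,A_{m+1}\rangle\leqslant F.$$ Then, for every $m\geqslant 1$, $H_m$ is of dependence length $m$.
   Context: Let $G$ be a group and $H\leqslant G$. An element $g\in G$ depends on $H$ if there is a non-trivial element $w(x)$ of the free product $H*\langle x\rangle$ (with $\langle x\rangle\cong\mathbb{Z}$) such that $w(g)=1$ in $G$, where $w(g)$ is obtained by substituting $g$ for $x$. $\mathrm{Dep}(H)=\mathrm{Dep}_G(H)$ is the subgroup of $G$ generated by all elements of $G$ that depend on $H$ (it contains $H$). Put $H_{(0)}=H$ and $H_{(i)}=\mathrm{Dep}(H_{(i-1)})=\mathrm{Dep}^i(H)$ for $i\geqslant 1$; this is an ascending sequence, and the dependence closure of $H$ is $\widehat{\mathrm{Dep}}(H)=\bigcup_{i\geqslant 0}H_{(i)}$. The dependence length of $H$ is $\mathrm{depl}(H)=\min\{j\geqslant 0\mid H_{(j)}=\widehat{\mathrm{Dep}}(H)\}$ if the sequence stabilizes after finitely many steps,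 and $\mathrm{depl}(H)=\infty$ otherwise. Here $G=F$. *)

theory Defs
  imports
    "HOL-Algebra.Elementary_Groups"
    "HOL-Library.Extended_Nat"
    "HOL-Library.Infinite_Set"
    "HOL-Computational_Algebra.Primes"
begin

section \<open>Free groups\<close>

text \<open>
  The free group with basis \<open>S\<close> consists of the freely reduced words in the letters \<open>x\<close> and
  \<open>x\<inverse>\<close> for \<open>x \<in> S\<close>. The letter \<open>x\<close> is encoded as \<open>(False, x)\<close> and its inverse as \<open>(True, x)\<close>.
\<close>

type_synonym 'a letter = "bool \<times> 'a"

definition inv_letter :: "'a letter \<Rightarrow> 'a letter" where
  "inv_letter s = (\<not> fst s, snd s)"

definition freely_reduced :: "'a letter list \<Rightarrow> bool" where
  "freely_reduced w \<longleftrightarrow> successively (\<lambda>s t. t \<noteq> inv_letter s) w"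

fun cancel_cons :: "'a letter \<Rightarrow> 'a letter list \<Rightarrow> 'a letter list" where
  "cancel_cons s [] = [s]"
| "cancel_cons s (t # w) = (if t = inv_letter s then w else s # t # w)"

definition free_group :: "'a set \<Rightarrow> 'a letter list monoid" where
  "free_group S =
    \<lparr>carrier = {w. freely_reduced w \<and> snd ` set w \<subseteq> S},
     monoid.mult = (\<lambda>u v. foldr cancel_cons u v),
     one = []\<rparr>"

definition gen :: "'a \<Rightarrow> 'a letter list" where
  "gen x = [(False, x)]"

lemma inv_letter_inv_letter [simp]: "inv_letter (inv_letter s) = s"
  by (simp add: inv_letter_def)

lemma snd_inv_letter [simp]: "snd (inv_letter s) = snd s"
  by (simp add: inv_letter_def)

lemma inv_letter_neq [simp]: "inv_letter s \<noteq> s" "s \<noteq> inv_letter s"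
  by (auto simp: inv_letter_def prod_eq_iff)

lemma freely_reduced_Cons:
  "freely_reduced (s # w) \<longleftrightarrow> (w \<noteq> [] \<longrightarrow> hd w \<noteq> inv_letter s) \<and> freely_reduced w"
  by (cases w) (auto simp: freely_reduced_def)

lemma freely_reduced_Nil [simp]: "freely_reduced []"
  by (simp add: freely_reduced_def)

lemma freely_reduced_cancel_cons:
  "freely_reduced w \<Longrightarrow> freely_reduced (cancel_cons s w)"
  by (cases w) (auto simp: freely_reduced_Cons)

lemma cancel_cons_inverse:
  "freely_reduced w \<Longrightarrow> cancel_cons (inv_letter s) (cancel_cons s w) = w"
proof (induction s w rule: cancel_cons.induct)
  case (2 s t w)
  then show ?case by (cases w) (auto simp: freely_reduced_Cons)
qed simp

lemma set_cancel_cons: "snd ` set (cancel_cons s w) \<subseteq> insert (snd s) (snd ` set w)"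
  by (cases w) auto

lemma freely_reduced_foldr:
  "freely_reduced v \<Longrightarrow> freely_reduced (foldr cancel_cons u v)"
  by (induction u) (auto intro: freely_reduced_cancel_cons)

lemma set_foldr_cancel_cons:
  "snd ` set (foldr cancel_cons u v) \<subseteq> snd ` set u \<union> snd ` set v"
proof (induction u)
  case (Cons s u)
  have "snd ` set (foldr cancel_cons (s # u) v) \<subseteq>
      insert (snd s) (snd ` set (foldr cancel_cons u v))"
    using set_cancel_cons by simp
  also have "\<dots> \<subseteq> insert (snd s) (snd ` set u \<union> snd ` set v)"
    using Cons.IH by (rule insert_mono)
  finally show ?case by simp
qed simp

lemma foldr_cancel_cons_cancel_cons:
  assumes "freely_reduced w"
  shows "foldr cancel_cons (cancel_cons s u) w = cancel_cons s (foldr cancel_cons u w)"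
proof (cases u)
  case (Cons t u')
  then show ?thesis
    using cancel_cons_inverse[of "foldr cancel_cons u' w" "inv_letter s"]
      freely_reduced_foldr[OF assms] by auto
qed auto

lemma foldr_cancel_cons_assoc:
  assumes "freely_reduced w"
  shows "foldr cancel_cons (foldr cancel_cons u v) w = foldr cancel_cons u (foldr cancel_cons v w)"
  by (induction u) (auto simp: foldr_cancel_cons_cancel_cons[OF assms])

lemma foldr_cancel_cons_Nil: "freely_reduced u \<Longrightarrow> foldr cancel_cons u [] = u"
proof (induction u)
  case (Cons s u)
  then show ?case by (cases u) (auto simp: freely_reduced_Cons)
qed auto

lemma foldr_cancel_cons_inverse:
  assumes "freely_reduced w"
  shows "foldr cancel_cons (rev (map inv_letter u)) (foldr cancel_cons u w) = w"
  using assms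
  by (induction u) (auto simp: cancel_cons_inverse freely_reduced_foldr)

theorem group_free_group: "group (free_group S)"
proof (rule groupI)
  fix u v assume "u \<in> carrier (free_group S)" "v \<in> carrier (free_group S)"
  then show "u \<otimes>\<^bsub>free_group S\<^esub> v \<in> carrier (free_group S)"
    using subset_trans[OF set_foldr_cancel_cons, of u v S]
    by (simp add: free_group_def freely_reduced_foldr)
next
  fix u assume u: "u \<in> carrier (free_group S)"
  define v where "v = foldr cancel_cons (rev (map inv_letter u)) []"
  have "v \<in> carrier (free_group S)"
    using u set_foldr_cancel_cons[of "rev (map inv_letter u)" "[]"]
    by (auto simp: free_group_def v_def image_image intro: freely_reduced_foldr)
  moreover have "v \<otimes>\<^bsub>free_group S\<^esub> u = \<one>\<^bsub>free_group S\<^esub>"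
    using u foldr_cancel_cons_inverse[of "[]" u]
    by (auto simp: free_group_def v_def foldr_cancel_cons_assoc foldr_cancel_cons_Nil)
  ultimately show "\<exists>v\<in>carrier (free_group S). v \<otimes>\<^bsub>free_group S\<^esub> u = \<one>\<^bsub>free_group S\<^esub>"
    by blast
qed (auto simp: free_group_def foldr_cancel_cons_assoc)

lemma gen_in_free_group: "x \<in> S \<Longrightarrow> gen x \<in> carrier (free_group S)"
  by (simp add: gen_def free_group_def freely_reduced_Cons)


section \<open>Free products\<close>

text \<open>
  The free product of two groups consists of the normal forms, that is, of the words of
  non-trivial elements whose consecutive letters come from different factors.
\<close>

fun letter_in :: "('a, 'm) monoid_scheme \<Rightarrow> ('b, 'n) monoid_scheme \<Rightarrow> 'a + 'b \<Rightarrow> bool" where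
  "letter_in G K (Inl g) \<longleftrightarrow> g \<in> carrier G \<and> g \<noteq> \<one>\<^bsub>G\<^esub>"
| "letter_in G K (Inr k) \<longleftrightarrow> k \<in> carrier K \<and> k \<noteq> \<one>\<^bsub>K\<^esub>"

definition normal_form ::
  "('a, 'm) monoid_scheme \<Rightarrow> ('b, 'n) monoid_scheme \<Rightarrow> ('a + 'b) list \<Rightarrow> bool" where
  "normal_form G K w \<longleftrightarrow> list_all (letter_in G K) w \<and> successively (\<lambda>s t. isl s \<noteq> isl t) w"

text \<open>The normal form of the product of one letter with a normal form:\<close>

fun nf_cons ::
  "('a, 'm) monoid_scheme \<Rightarrow> ('b, 'n) monoid_scheme \<Rightarrow> 'a + 'b \<Rightarrow> ('a + 'b) list \<Rightarrow> ('a + 'b) list"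
where
  "nf_cons G K (Inl g) (Inl h # w) =
    (if g \<otimes>\<^bsub>G\<^esub> h = \<one>\<^bsub>G\<^esub> then w else Inl (g \<otimes>\<^bsub>G\<^esub> h) # w)"
| "nf_cons G K (Inr k) (Inr l # w) =
    (if k \<otimes>\<^bsub>K\<^esub> l = \<one>\<^bsub>K\<^esub> then w else Inr (k \<otimes>\<^bsub>K\<^esub> l) # w)"
| "nf_cons G K s w = s # w"

definition free_product ::
  "('a, 'm) monoid_scheme \<Rightarrow> ('b, 'n) monoid_scheme \<Rightarrow> ('a + 'b) list monoid" where
  "free_product G K =
    \<lparr>carrier = {w. normal_form G K w},
     monoid.mult = (\<lambda>u v. foldr (nf_cons G K) u v),
     one = []\<rparr>"

lemma normal_form_Nil [simp]: "normal_form G K []"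
  by (simp add: normal_form_def)

lemma normal_form_Cons:
  "normal_form G K (s # w) \<longleftrightarrow>
    letter_in G K s \<and> (w \<noteq> [] \<longrightarrow> isl s \<noteq> isl (hd w)) \<and> normal_form G K w"
  by (cases w) (auto simp: normal_form_def)

context
  fixes G :: "('a, 'm) monoid_scheme" and K :: "('b, 'n) monoid_scheme"
  assumes G: "group G" and K: "group K"
begin

interpretation G: group G by (rule G)
interpretation K: group K by (rule K)

lemma normal_form_nf_cons:
  "letter_in G K s \<Longrightarrow> normal_form G K w \<Longrightarrow> normal_form G K (nf_cons G K s w)"
  by (cases s; cases w; cases "hd w") (auto simp: normal_form_Cons)

lemma normal_form_foldr:
  "list_all (letter_in G K) u \<Longrightarrow> normal_form G K w \<Longrightarrow>
    normal_form G K (foldr (nf_cons G K) u w)"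
  by (induction u) (auto intro: normal_form_nf_cons)

lemma nf_cons_Inl_Inl:
  assumes "letter_in G K (Inl g)" "letter_in G K (Inl h)" "normal_form G K w"
  shows "nf_cons G K (Inl g) (nf_cons G K (Inl h) w) =
    (if g \<otimes>\<^bsub>G\<^esub> h = \<one>\<^bsub>G\<^esub> then w else nf_cons G K (Inl (g \<otimes>\<^bsub>G\<^esub> h)) w)"
proof (cases "\<exists>x v. w = Inl x # v")
  case True
  then obtain x v where w: "w = Inl x # v" by blast
  have x: "x \<in> carrier G" "x \<noteq> \<one>\<^bsub>G\<^esub>" and gh: "g \<in> carrier G" "h \<in> carrier G" "g \<noteq> \<one>\<^bsub>G\<^esub>"
    using assms by (auto simp: w normal_form_Cons)
  have v: "nf_cons G K (Inl y) v = Inl y # v" for y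
  proof (cases v)
    case (Cons t v')
    then show ?thesis using assms(3) by (cases t) (auto simp: w normal_form_Cons)
  qed auto
  have 1: "g \<otimes>\<^bsub>G\<^esub> h \<otimes>\<^bsub>G\<^esub> x = g" if "h \<otimes>\<^bsub>G\<^esub> x = \<one>\<^bsub>G\<^esub>"
    using that x gh by (simp add: G.m_assoc)
  have 2: "g \<otimes>\<^bsub>G\<^esub> (h \<otimes>\<^bsub>G\<^esub> x) = x" if "g \<otimes>\<^bsub>G\<^esub> h = \<one>\<^bsub>G\<^esub>"
    using that x gh by (simp flip: G.m_assoc)
  show ?thesis
    using x gh 1 2 by (auto simp: w v G.m_assoc)
next
  case False
  then have *: "nf_cons G K (Inl y) w = Inl y # w" for y
    by (cases w; cases "hd w") auto
  show ?thesis unfolding * by (simp add: *)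
qed

lemma nf_cons_Inr_Inr:
  assumes "letter_in G K (Inr g)" "letter_in G K (Inr h)" "normal_form G K w"
  shows "nf_cons G K (Inr g) (nf_cons G K (Inr h) w) =
    (if g \<otimes>\<^bsub>K\<^esub> h = \<one>\<^bsub>K\<^esub> then w else nf_cons G K (Inr (g \<otimes>\<^bsub>K\<^esub> h)) w)"
proof (cases "\<exists>x v. w = Inr x # v")
  case True
  then obtain x v where w: "w = Inr x # v" by blast
  have x: "x \<in> carrier K" "x \<noteq> \<one>\<^bsub>K\<^esub>" and gh: "g \<in> carrier K" "h \<in> carrier K" "g \<noteq> \<one>\<^bsub>K\<^esub>"
    using assms by (auto simp: w normal_form_Cons)
  have v: "nf_cons G K (Inr y) v = Inr y # v" for y
  proof (cases v)
    case (Cons t v')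
    then show ?thesis using assms(3) by (cases t) (auto simp: w normal_form_Cons)
  qed auto
  have 1: "g \<otimes>\<^bsub>K\<^esub> h \<otimes>\<^bsub>K\<^esub> x = g" if "h \<otimes>\<^bsub>K\<^esub> x = \<one>\<^bsub>K\<^esub>"
    using that x gh by (simp add: K.m_assoc)
  have 2: "g \<otimes>\<^bsub>K\<^esub> (h \<otimes>\<^bsub>K\<^esub> x) = x" if "g \<otimes>\<^bsub>K\<^esub> h = \<one>\<^bsub>K\<^esub>"
    using that x gh by (simp flip: K.m_assoc)
  show ?thesis
    using x gh 1 2 by (auto simp: w v K.m_assoc)
next
  case False
  then have *: "nf_cons G K (Inr y) w = Inr y # w" for y
    by (cases w; cases "hd w") auto
  show ?thesis unfolding * by (simp add: *)
qed

lemma foldr_nf_cons_nf_cons: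
  assumes s: "letter_in G K s" and u: "normal_form G K u" and w: "normal_form G K w"
  shows "foldr (nf_cons G K) (nf_cons G K s u) w = nf_cons G K s (foldr (nf_cons G K) u w)"
proof (cases u)
  case (Cons t v)
  have t: "letter_in G K t" and v: "normal_form G K v"
    using u by (auto simp: Cons normal_form_Cons)
  have nf: "normal_form G K (foldr (nf_cons G K) v w)"
    using v w by (intro normal_form_foldr) (auto simp: normal_form_def)
  show ?thesis
  proof (cases s; cases t)
    fix g h assume "s = Inl g" "t = Inl h"
    then show ?thesis using s t nf by (simp add: Cons nf_cons_Inl_Inl)
  next
    fix g h assume "s = Inr g" "t = Inr h"
    then show ?thesis using s t nf by (simp add: Cons nf_cons_Inr_Inr)
  qed (auto simp: Cons)
qed (cases s; auto)

lemma foldr_nf_cons_assoc: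
  assumes "normal_form G K u" "normal_form G K v" "normal_form G K w"
  shows "foldr (nf_cons G K) (foldr (nf_cons G K) u v) w =
    foldr (nf_cons G K) u (foldr (nf_cons G K) v w)"
  using assms(1)
proof (induction u)
  case (Cons s u)
  then have "normal_form G K (foldr (nf_cons G K) u v)"
    using assms by (intro normal_form_foldr) (auto simp: normal_form_def normal_form_Cons)
  with Cons assms show ?case
    by (simp add: foldr_nf_cons_nf_cons normal_form_Cons)
qed auto

abbreviation (input) inv_syllable :: "'a + 'b \<Rightarrow> 'a + 'b" where
  "inv_syllable \<equiv> map_sum (m_inv G) (m_inv K)"

lemma letter_in_inv_syllable: "letter_in G K s \<Longrightarrow> letter_in G K (inv_syllable s)"
  by (cases s) auto

lemma nf_cons_inverse:
  "letter_in G K s \<Longrightarrow> normal_form G K w \<Longrightarrow> nf_cons G K (inv_syllable s) (nf_cons G K s w) = w"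
  using letter_in_inv_syllable[of s]
  by (cases s) (auto simp: nf_cons_Inl_Inl nf_cons_Inr_Inr)

lemma foldr_nf_cons_inverse:
  "list_all (letter_in G K) u \<Longrightarrow> normal_form G K w \<Longrightarrow>
    foldr (nf_cons G K) (rev (map inv_syllable u)) (foldr (nf_cons G K) u w) = w"
  by (induction u) (auto simp: nf_cons_inverse normal_form_foldr)

theorem group_free_product: "group (free_product G K)"
proof (rule groupI)
  fix u v assume "u \<in> carrier (free_product G K)" "v \<in> carrier (free_product G K)"
  then show "u \<otimes>\<^bsub>free_product G K\<^esub> v \<in> carrier (free_product G K)"
    using normal_form_foldr[of u v] by (auto simp: free_product_def normal_form_def)
next
  fix u assume "u \<in> carrier (free_product G K)"
  then have u: "normal_form G K u" "list_all (letter_in G K) u"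
    by (auto simp: free_product_def normal_form_def)
  define v where "v = rev (map inv_syllable u)"
  have la: "list_all (letter_in G K) v"
    using u(2) unfolding v_def list_all_iff by (auto intro: letter_in_inv_syllable)
  have "successively (\<lambda>s t. isl s \<noteq> isl t) v"
  proof -
    have "isl (inv_syllable s) = isl s" for s by (cases s) auto
    then have "successively (\<lambda>s t. isl s \<noteq> isl t) v \<longleftrightarrow> successively (\<lambda>s t. isl t \<noteq> isl s) u"
      by (simp add: v_def successively_map)
    also have "\<dots> \<longleftrightarrow> successively (\<lambda>s t. isl s \<noteq> isl t) u"
      by (intro successively_cong) auto
    finally show ?thesis
      using u(1) by (simp add: normal_form_def)
  qed
  with la have v: "normal_form G K v" by (simp add: normal_form_def)
  have "foldr (nf_cons G K) w [] = w" if "normal_form G K w" for w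
    using that
  proof (induction w)
    case (Cons s w)
    then have "foldr (nf_cons G K) w [] = w" by (simp add: normal_form_Cons)
    with Cons.prems show ?case
      by (cases s; cases w; cases "hd w") (auto simp: normal_form_Cons)
  qed auto
  with u have "foldr (nf_cons G K) v u = []"
    using foldr_nf_cons_inverse[of u "[]"] by (simp add: v_def)
  with v show "\<exists>v\<in>carrier (free_product G K). v \<otimes>\<^bsub>free_product G K\<^esub> u = \<one>\<^bsub>free_product G K\<^esub>"
    by (intro bexI[of _ v]) (auto simp: free_product_def)
qed (auto simp: free_product_def foldr_nf_cons_assoc)

end


section \<open>Dependence\<close>

text \<open>
  The element \<open>x ^ k\<close> of the infinite cyclic free factor generated by \<open>x\<close> is the integer \<open>k\<close> of
  \<^const>\<open>integer_group\<close>; the word \<open>w(x)\<close> is evaluated at \<open>x = g\<close>.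
\<close>

definition adjoin_free ::
  "('a, 'm) monoid_scheme \<Rightarrow> 'a set \<Rightarrow> ('a + int) list monoid" where
  "adjoin_free G H = free_product (G\<lparr>carrier := H\<rparr>) integer_group"

definition subst_in :: "('a, 'm) monoid_scheme \<Rightarrow> 'a \<Rightarrow> ('a + int) list \<Rightarrow> 'a" where
  "subst_in G g w =
    foldr (\<lambda>s acc. (case s of Inl h \<Rightarrow> h | Inr k \<Rightarrow> g [^]\<^bsub>G\<^esub> k) \<otimes>\<^bsub>G\<^esub> acc) w \<one>\<^bsub>G\<^esub>"

definition depends_on :: "('a, 'm) monoid_scheme \<Rightarrow> 'a set \<Rightarrow> 'a \<Rightarrow> bool" where
  "depends_on G H g \<longleftrightarrow>
    (\<exists>w \<in> carrier (adjoin_free G H). w \<noteq> \<one>\<^bsub>adjoin_free G H\<^esub> \<and> subst_in G g w = \<one>\<^bsub>G\<^esub>)"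

definition Dep :: "('a, 'm) monoid_scheme \<Rightarrow> 'a set \<Rightarrow> 'a set" where
  "Dep G H = generate G {g \<in> carrier G. depends_on G H g}"

definition Dep_iter :: "('a, 'm) monoid_scheme \<Rightarrow> 'a set \<Rightarrow> nat \<Rightarrow> 'a set" where
  "Dep_iter G H i = (Dep G ^^ i) H"

definition Dep_closure :: "('a, 'm) monoid_scheme \<Rightarrow> 'a set \<Rightarrow> 'a set" where
  "Dep_closure G H = (\<Union>i. Dep_iter G H i)"

definition depl :: "('a, 'm) monoid_scheme \<Rightarrow> 'a set \<Rightarrow> enat" where
  "depl G H =
    (if \<exists>j. Dep_iter G H j = Dep_closure G H
     then enat (LEAST j. Dep_iter G H j = Dep_closure G H) else \<infinity>)"

lemma hom_subst_in:
  assumes "group G" "subgroup H G" "g \<in> carrier G"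
  shows "subst_in G g \<in> hom (adjoin_free G H) G"
proof -
  interpret group G by fact
  define val where "val = (\<lambda>s. case s of Inl h \<Rightarrow> h | Inr (k :: int) \<Rightarrow> g [^]\<^bsub>G\<^esub> k)"
  let ?H = "G\<lparr>carrier := H\<rparr>"
  have H: "group ?H" by (rule subgroup.subgroup_is_group) fact+
  have inG: "h \<in> carrier G" if "h \<in> H" for h
    using that assms(2) by (meson subgroup.mem_carrier)
  have Cons: "subst_in G g (s # w) = val s \<otimes>\<^bsub>G\<^esub> subst_in G g w"
    and Nil: "subst_in G g [] = \<one>\<^bsub>G\<^esub>" for s w
    by (auto simp: subst_in_def val_def)
  have val: "val s \<in> carrier G" if "letter_in ?H integer_group s" for s
    using that assms(3) inG by (cases s) (auto simp: val_def)
  have closed: "subst_in G g w \<in> carrier G" if "list_all (letter_in ?H integer_group) w" for w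
    using that by (induction w) (auto simp: Cons Nil val)
  have nf_cons: "subst_in G g (nf_cons ?H integer_group s w) = val s \<otimes>\<^bsub>G\<^esub> subst_in G g w"
    if "letter_in ?H integer_group s" "list_all (letter_in ?H integer_group) w" for s w
  proof -
    have gh: "g1 \<otimes>\<^bsub>G\<^esub> (h \<otimes>\<^bsub>G\<^esub> subst_in G g v) = subst_in G g v"
      if "g1 \<otimes>\<^bsub>G\<^esub> h = \<one>\<^bsub>G\<^esub>" "g1 \<in> H" "h \<in> H" "list_all (letter_in ?H integer_group) v" for g1 h v
      using that closed[of v] inG by (simp flip: m_assoc)
    have kl: "g [^]\<^bsub>G\<^esub> k \<otimes>\<^bsub>G\<^esub> (g [^]\<^bsub>G\<^esub> l \<otimes>\<^bsub>G\<^esub> subst_in G g v) = g [^]\<^bsub>G\<^esub> (k + l) \<otimes>\<^bsub>G\<^esub> subst_in G g v"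
      if "list_all (letter_in ?H integer_group) v" for k l :: int and v
      using that closed[of v] assms(3) by (simp add: int_pow_mult m_assoc)
    show ?thesis
    proof (cases w)
      case (Cons t v)
      then show ?thesis
        using that closed[of v] inG assms(3) kl[of v]
        by (cases s; cases t)
           (auto simp: \<open>\<And>s w. subst_in G g (s # w) = _\<close> val_def gh m_assoc)
    qed (cases s; auto simp: \<open>\<And>s w. subst_in G g (s # w) = _\<close>)
  qed
  have "subst_in G g (foldr (nf_cons ?H integer_group) u v) =
      subst_in G g u \<otimes>\<^bsub>G\<^esub> subst_in G g v"
    if "list_all (letter_in ?H integer_group) u" "normal_form ?H integer_group v" for u v
    using that(1)
  proof (induction u)
    case Nil
    then show ?case using that closed[of v] by (simp add: \<open>subst_in G g [] = _\<close> normal_form_def)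
  next
    case (Cons s u)
    have "list_all (letter_in ?H integer_group) (foldr (nf_cons ?H integer_group) u v)"
      using normal_form_foldr[OF H group_integer_group, of u v] Cons.prems that
      by (simp add: normal_form_def)
    with Cons show ?case
      using that closed[of u] closed[of v] val[of s]
      by (simp add: nf_cons \<open>\<And>s w. subst_in G g (s # w) = _\<close> m_assoc normal_form_def)
  qed
  then show ?thesis
    using closed
    by (auto simp: hom_def adjoin_free_def free_product_def normal_form_def)
qed


section \<open>The subgroups of the free group of rank two\<close>

text \<open>\<open>nth_prime k\<close> is the \<open>k\<close>-th prime for \<open>k \<ge> 1\<close>, so \<open>nth_prime 1 = 2\<close>.\<close>

definition nth_prime :: "nat \<Rightarrow> nat" where
  "nth_prime k = enumerate {p. prime p} (k - 1)"

definition A_elt :: "'a \<Rightarrow> 'a \<Rightarrow> nat \<Rightarrow> 'a letter list" where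
  "A_elt a b n =
    (let F = free_group {a, b} in
     gen a [^]\<^bsub>F\<^esub> nth_prime (4 * n - 3) \<otimes>\<^bsub>F\<^esub> gen b [^]\<^bsub>F\<^esub> nth_prime (4 * n - 2) \<otimes>\<^bsub>F\<^esub>
     gen a [^]\<^bsub>F\<^esub> nth_prime (4 * n - 1) \<otimes>\<^bsub>F\<^esub> gen b [^]\<^bsub>F\<^esub> nth_prime (4 * n))"

definition h_elt :: "'a \<Rightarrow> 'a \<Rightarrow> nat \<Rightarrow> 'a letter list" where
  "h_elt a b j =
    (let F = free_group {a, b} in
     A_elt a b (j + 1) \<otimes>\<^bsub>F\<^esub> A_elt a b (j + 2) \<otimes>\<^bsub>F\<^esub> A_elt a b j [^]\<^bsub>F\<^esub> (5 :: nat) \<otimes>\<^bsub>F\<^esub>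
     A_elt a b (j + 2) \<otimes>\<^bsub>F\<^esub> A_elt a b (j + 1))"

definition H_subgp :: "'a \<Rightarrow> 'a \<Rightarrow> nat \<Rightarrow> 'a letter list set" where
  "H_subgp a b m =
    (let F = free_group {a, b} in
     generate F (h_elt a b ` {1..<m} \<union> {A_elt a b m [^]\<^bsub>F\<^esub> (5 :: nat), A_elt a b (m + 1)}))"

end

theory Submission
  imports Defs
begin

text \<open>
  An element \<open>g\<close> is independent of \<open>L\<close> as soon as the free group acts on a set of points indexed by
  the normal forms \<open>u\<close> of \<open>F * \<langle>x\<rangle>\<close> in such a way that \<open>l \<in> L\<close> moves the point \<open>u\<close> to \<open>u l\<close> and \<open>g\<close>
  moves it to \<open>u x\<close>. Since \<open>F\<close> is free, such an action may be chosen generator by generator: it is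
  obtained from the cosets of \<open>L\<close>, weighted by elements of \<open>F * \<langle>x\<rangle>\<close>, by identifying the end points
  of the two halves of a shortest path from \<open>L\<close> to \<open>g L\<close>, where powers of a generator count as one
  step. This works unless the path is very short, which leaves finitely many shapes of \<open>g\<close>.

  For \<open>L = \<langle>A\<^sub>1, \<dots>, A\<^sub>n\<rangle>\<close> the choice of the exponents makes all the short \<open>g \<notin> L\<close> independent too,
  so \<open>L\<close> is dependence closed. Let \<open>K\<^sub>j = \<langle>h\<^sub>1, \<dots>, h\<^bsub>j-1\<^esub>, A\<^sub>j\<^sup>5, A\<^bsub>j+1\<^esub>, \<dots>, A\<^sub>n\<rangle>\<close> and \<open>K\<^sub>0 = L\<close>; then
  \<open>H\<^sub>m = K\<^sub>m\<close> for \<open>n = m + 1\<close>, and it suffices that \<open>Dep K\<^sub>j = K\<^bsub>j-1\<^esub>\<close>. An element that depends on \<open>K\<^sub>j\<close>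
  depends on \<open>K\<^bsub>j-1\<^esub>\<close>, so by induction it lies in \<open>K\<^bsub>j-2\<^esub>\<close>. This group has the basis \<open>h\<^sub>1, \<dots>, h\<^bsub>j-2\<^esub>\<close>,
  \<open>c = A\<^bsub>j-1\<^esub>\<close>, \<open>d = A\<^sub>j\<close>, \<open>e = A\<^bsub>j+1\<^esub>, \<dots>, A\<^sub>n\<close>, where \<open>K\<^sub>j\<close> arises from the basis by replacing \<open>c\<close> with
  \<open>d e c\<^sup>5 e d\<close> and \<open>d\<close> with \<open>d\<^sup>5\<close>, and \<open>K\<^bsub>j-1\<^esub>\<close> by replacing \<open>c\<close> with \<open>c\<^sup>5\<close>.
\<close>

section \<open>Actions of free groups\<close>

text \<open>Since the generators of a free group may be permuted independently of each other, an
  action is prescribed by lines and cycles for one generator at a time; the only obligation is that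
  all generators identify the same points. This is where the arithmetic enters. An identification
  along one generator superposes two lines of another one, and no further points may meet. For four
  syllables this amounts to inequalities such as \<open>p i + r j \<noteq> p k\<close>, which follow
  from parity and, where the prime 2 occurs, from the position of twin primes. For the fifth power
  the places 0, 1 and 4 on a cycle of length 5 must differ. The detour through
  \<open>K_{j-2}\<close> turns its basis into free generators: in them, \<open>K_j\<close> has a
  graph with five corners whatever \<open>j\<close> is. The inclusion of \<open>K_{j-1}\<close> in
  \<open>Dep K_j\<close> comes from taking a fifth root and then solving the definition of an
  \<open>h\<close> for its fifth power. That the length is not smaller than \<open>m\<close> rests
  on the strictness of a single inclusion, that of \<open>K_1\<close> in \<open>K_0\<close>.\<close>

definition letter_act :: "('s \<Rightarrow> 'x \<Rightarrow> 'x) \<Rightarrow> 's letter \<Rightarrow> 'x \<Rightarrow> 'x" where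
  "letter_act \<pi> l = (if fst l then inv_into UNIV (\<pi> (snd l)) else \<pi> (snd l))"

text \<open>Words act from the right: the first letter of the word is applied first.\<close>

definition act :: "('s \<Rightarrow> 'x \<Rightarrow> 'x) \<Rightarrow> 's letter list \<Rightarrow> 'x \<Rightarrow> 'x" where
  "act \<pi> w = fold (letter_act \<pi>) w"

lemma act_Nil [simp]: "act \<pi> [] z = z"
  and act_Cons: "act \<pi> (l # w) z = act \<pi> w (letter_act \<pi> l z)"
  by (simp_all add: act_def)

lemma act_gen [simp]: "act \<pi> (gen s) z = \<pi> s z"
  by (simp add: act_def gen_def letter_act_def)

lemma letter_act_inv_letter:
  assumes "bij (\<pi> (snd l))"
  shows "letter_act \<pi> (inv_letter l) (letter_act \<pi> l z) = z"
  using assms by (auto simp: letter_act_def inv_letter_def bij_is_inj bij_is_surj surj_f_inv_f)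

lemma act_mult:
  assumes "\<And>s. bij (\<pi> s)"
  shows "act \<pi> (u \<otimes>\<^bsub>free_group S\<^esub> v) z = act \<pi> v (act \<pi> u z)"
proof -
  have cc: "act \<pi> (cancel_cons l w) y = act \<pi> w (letter_act \<pi> l y)" for l w y
    by (cases w) (auto simp: act_Cons letter_act_inv_letter assms)
  have "act \<pi> (foldr cancel_cons u v) z = act \<pi> v (act \<pi> u z)"
    by (induction u arbitrary: z) (auto simp: cc act_Cons)
  then show ?thesis by (simp add: free_group_def)
qed

lemma free_group_one [simp]: "\<one>\<^bsub>free_group S\<^esub> = []"
  by (simp add: free_group_def)

lemma act_inj:
  assumes "\<And>s. bij (\<pi> s)" "w \<in> carrier (free_group S)" "act \<pi> w y = act \<pi> w z"
  shows "y = z"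
proof -
  interpret F: group "free_group S" by (rule group_free_group)
  have "act \<pi> (w \<otimes>\<^bsub>free_group S\<^esub> inv\<^bsub>free_group S\<^esub> w) v = v" for v
    using assms(2) by simp
  then show ?thesis
    using assms(3) unfolding act_mult[OF assms(1)] by metis
qed

lemma act_m_inv:
  assumes "\<And>s. bij (\<pi> s)" "w \<in> carrier (free_group S)" "act \<pi> w y = z"
  shows "act \<pi> (inv\<^bsub>free_group S\<^esub> w) z = y"
proof -
  interpret F: group "free_group S" by (rule group_free_group)
  have "act \<pi> (w \<otimes>\<^bsub>free_group S\<^esub> inv\<^bsub>free_group S\<^esub> w) v = v" for v
    using assms(2) by simp
  then show ?thesis
    using assms(3) unfolding act_mult[OF assms(1)] by metis
qed

lemma act_int_pow:
  assumes bij: "\<And>s. bij (\<pi> s)" and w: "w \<in> carrier (free_group S)"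
    and step: "\<And>i::int. act \<pi> w (orb i) = orb (i + 1)"
  shows "act \<pi> (w [^]\<^bsub>free_group S\<^esub> (k::int)) (orb i) = orb (i + k)"
proof -
  interpret F: group "free_group S" by (rule group_free_group)
  show ?thesis
  proof (induction k arbitrary: i rule: int_induct[where k = 0])
    case (step1 k)
    have "w [^]\<^bsub>free_group S\<^esub> (k + 1) = w [^]\<^bsub>free_group S\<^esub> k \<otimes>\<^bsub>free_group S\<^esub> w"
      using w F.int_pow_mult[of w k 1] by simp
    then show ?case by (simp add: act_mult[OF bij] step1.IH step add.assoc)
  next
    case (step2 k)
    have "w [^]\<^bsub>free_group S\<^esub> k = w [^]\<^bsub>free_group S\<^esub> (k - 1) \<otimes>\<^bsub>free_group S\<^esub> w"
      using w F.int_pow_mult[of w "k - 1" 1] by simp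
    then have "act \<pi> w (act \<pi> (w [^]\<^bsub>free_group S\<^esub> (k - 1)) (orb i)) = orb (i + k)"
      using step2.IH by (simp add: act_mult[OF bij])
    then have "act \<pi> w (act \<pi> (w [^]\<^bsub>free_group S\<^esub> (k - 1)) (orb i)) = act \<pi> w (orb (i + (k - 1)))"
      by (simp add: step)
    then show ?case by (rule act_inj[OF bij w])
  qed simp
qed

lemma act_gen_pow:
  assumes "\<And>s. bij (\<pi> s)" "s \<in> S" "\<And>i::int. \<pi> s (orb i) = orb (i + 1)"
  shows "act \<pi> (gen s [^]\<^bsub>free_group S\<^esub> (k::int)) (orb i) = orb (i + k)"
  using act_int_pow[of \<pi> "gen s" S orb k i] assms by (simp add: gen_in_free_group)

lemma act_gen_pow_comm:
  assumes \<pi>: "\<And>s. bij (\<pi> s)" and \<alpha>: "\<And>s. bij (\<alpha> s)" and s: "s \<in> S"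
    and comm: "\<And>y. \<pi> s (\<beta> y) = \<beta> (\<alpha> s y)"
  shows "act \<pi> (gen s [^]\<^bsub>free_group S\<^esub> (k::int)) (\<beta> y) =
    \<beta> (act \<alpha> (gen s [^]\<^bsub>free_group S\<^esub> k) y)"
proof -
  interpret F: group "free_group S" by (rule group_free_group)
  define orb where "orb i = \<beta> (act \<alpha> (gen s [^]\<^bsub>free_group S\<^esub> (i::int)) y)" for i
  have g: "gen s \<in> carrier (free_group S)" using s by (rule gen_in_free_group)
  have "\<pi> s (orb i) = orb (i + 1)" for i
  proof -
    have "gen s [^]\<^bsub>free_group S\<^esub> (i + 1) = gen s [^]\<^bsub>free_group S\<^esub> i \<otimes>\<^bsub>free_group S\<^esub> gen s"
      using g F.int_pow_mult[of "gen s" i 1] by simp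
    then show ?thesis by (simp add: orb_def comm act_mult[OF \<alpha>])
  qed
  then show ?thesis
    using act_gen_pow[where \<pi> = \<pi> and s = s and S = S and orb = orb and k = k and i = 0] \<pi> s
    by (simp add: orb_def)
qed

lemma free_group_Cons:
  assumes "l # w \<in> carrier (free_group S)"
  shows "l # w = [l] \<otimes>\<^bsub>free_group S\<^esub> w" "[l] \<in> carrier (free_group S)" "w \<in> carrier (free_group S)"
    "snd l \<in> S"
proof -
  show "l # w = [l] \<otimes>\<^bsub>free_group S\<^esub> w"
    using assms by (cases w) (auto simp: free_group_def freely_reduced_Cons)
qed (use assms in \<open>auto simp: free_group_def freely_reduced_Cons\<close>)

lemma free_group_letter:
  assumes "snd l \<in> S"
  shows "[l] = gen (snd l) [^]\<^bsub>free_group S\<^esub> (if fst l then -1 else 1 :: int)"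
proof -
  interpret F: group "free_group S" by (rule group_free_group)
  have g: "gen (snd l) \<in> carrier (free_group S)" using assms by (rule gen_in_free_group)
  have "[(True, s)] \<otimes>\<^bsub>free_group S\<^esub> gen s = \<one>\<^bsub>free_group S\<^esub>" for s
    by (simp add: free_group_def gen_def inv_letter_def)
  then have "inv\<^bsub>free_group S\<^esub> gen (snd l) = [(True, snd l)]"
    using g assms by (intro F.inv_equality) (auto simp: free_group_def freely_reduced_Cons)
  then show ?thesis
    using g by (cases l) (auto simp: gen_def F.int_pow_neg)
qed

text \<open>Words are peeled off by powers of generators instead of letters, so that inverse letters
  need no case of their own.\<close>

lemma free_group_induct [consumes 1, case_names one gen]:
  assumes w: "w \<in> carrier (free_group S)"
    and one: "P \<one>\<^bsub>free_group S\<^esub>"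
    and gen: "\<And>s k w. s \<in> S \<Longrightarrow> w \<in> carrier (free_group S) \<Longrightarrow> P w \<Longrightarrow>
      P (gen s [^]\<^bsub>free_group S\<^esub> (k::int) \<otimes>\<^bsub>free_group S\<^esub> w)"
  shows "P w"
  using w
proof (induction w)
  case Nil
  then show ?case using one by simp
next
  case (Cons l w)
  note * = free_group_Cons[OF Cons.prems]
  have "P ([l] \<otimes>\<^bsub>free_group S\<^esub> w)"
    unfolding free_group_letter[OF *(4)] using * Cons.IH by (intro gen)
  then show ?case using *(1) by simp
qed

text \<open>
  The engine of all independence proofs: permutations \<open>\<pi> s\<close> of one set are built from permutations
  \<open>\<alpha> s\<close> of different sets \<open>X\<^sub>s\<close>, in each of which the points of \<open>D\<close> are placed by \<open>f s\<close>. The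
  points are identified in the same way for all \<open>s\<close>, so the \<open>X\<^sub>s\<close> can be glued along \<open>D\<close>.
\<close>

lemma glue_permutations:
  fixes f :: "'s \<Rightarrow> 'd \<Rightarrow> 'y" and \<alpha> :: "'s \<Rightarrow> 'y \<Rightarrow> 'y"
  assumes \<alpha>: "\<And>s. bij (\<alpha> s)"
    and ker: "\<And>s t z z'. z \<in> D \<Longrightarrow> z' \<in> D \<Longrightarrow> f s z = f s z' \<Longrightarrow> f t z = f t z'"
  obtains \<pi> :: "'s \<Rightarrow> 'y + 's \<times> 'y \<Rightarrow> 'y + 's \<times> 'y" and \<iota> :: "'d \<Rightarrow> 'y + 's \<times> 'y"
  where "\<And>s. bij (\<pi> s)"
    and "\<And>s z z'. z \<in> D \<Longrightarrow> z' \<in> D \<Longrightarrow> \<iota> z = \<iota> z' \<longleftrightarrow> f s z = f s z'"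
    and "\<And>S s k z z'. s \<in> S \<Longrightarrow> z \<in> D \<Longrightarrow> z' \<in> D \<Longrightarrow>
      act \<alpha> (gen s [^]\<^bsub>free_group S\<^esub> (k::int)) (f s z) = f s z' \<Longrightarrow>
      act \<pi> (gen s [^]\<^bsub>free_group S\<^esub> k) (\<iota> z) = \<iota> z'"
proof -
  \<comment> \<open>The kernel of \<open>f s\<close> on \<open>D\<close> is the same for all
    \<open>s\<close>, so any fixed generator represents the glued points.\<close>
  define \<iota> :: "'d \<Rightarrow> 'y + 's \<times> 'y" where "\<iota> z = Inl (f undefined z)" for z
  have \<iota>: "\<iota> z = \<iota> z' \<longleftrightarrow> f s z = f s z'" if "z \<in> D" "z' \<in> D" for s z z'
    using that ker unfolding \<iota>_def by blast
  \<comment> \<open>\<open>\<beta> s\<close> embeds the set on which \<open>\<alpha> s\<close> acts: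
    the points of \<open>D\<close> are shared, all others become private copies tagged with
    \<open>s\<close>.\<close>
  define \<beta> where "\<beta> s y = (if y \<in> f s ` D then \<iota> (inv_into D (f s) y) else Inr (s, y))" for s y
  have \<beta>_f: "\<beta> s (f s z) = \<iota> z" if "z \<in> D" for s z
  proof -
    have "f s (inv_into D (f s) (f s z)) = f s z" "inv_into D (f s) (f s z) \<in> D"
      using that by (auto intro: f_inv_into_f inv_into_into)
    then show ?thesis using that \<iota> by (auto simp: \<beta>_def)
  qed
  have inj: "inj (\<beta> s)" for s
  proof (rule injI)
    fix y y' assume eq: "\<beta> s y = \<beta> s y'"
    show "y = y'"
    proof (cases "y \<in> f s ` D"; cases "y' \<in> f s ` D")
      assume "y \<in> f s ` D" "y' \<in> f s ` D"
      then obtain z z' where "z \<in> D" "z' \<in> D" "y = f s z" "y' = f s z'" by blast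
      then show ?thesis using eq \<beta>_f \<iota> by simp
    qed (use eq in \<open>auto simp: \<beta>_def \<iota>_def\<close>)
  qed
  \<comment> \<open>\<open>\<alpha> s\<close> is transported along the embedding; everything outside
    its image stays fixed.\<close>
  define \<pi> where "\<pi> s v = (if v \<in> range (\<beta> s) then \<beta> s (\<alpha> s (inv_into UNIV (\<beta> s) v)) else v)" for s v
  have \<pi>_\<beta>: "\<pi> s (\<beta> s y) = \<beta> s (\<alpha> s y)" for s y
    by (simp add: \<pi>_def inj)
  have bij: "bij (\<pi> s)" for s
  proof (rule bijI)
    show "inj (\<pi> s)"
    proof (rule injI)
      fix v v' assume eq: "\<pi> s v = \<pi> s v'"
      show "v = v'"
      proof (cases "v \<in> range (\<beta> s)"; cases "v' \<in> range (\<beta> s)")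
        assume "v \<in> range (\<beta> s)" "v' \<in> range (\<beta> s)"
        then obtain y y' where "v = \<beta> s y" "v' = \<beta> s y'" by blast
        then show ?thesis
          using eq \<pi>_\<beta> inj[of s] \<alpha>[of s] by (metis bij_is_inj injD)
      qed (use eq in \<open>auto simp: \<pi>_def\<close>)
    qed
    show "surj (\<pi> s)"
    proof (rule surjI)
      fix v
      show "\<pi> s (if v \<in> range (\<beta> s) then \<beta> s (inv_into UNIV (\<alpha> s) (inv_into UNIV (\<beta> s) v)) else v) = v"
        using \<alpha>[of s] inj[of s] by (auto simp: \<pi>_\<beta> bij_is_surj surj_f_inv_f) (auto simp: \<pi>_def)
    qed
  qed
  have "act \<pi> (gen s [^]\<^bsub>free_group S\<^esub> k) (\<iota> z) = \<iota> z'"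
    if "s \<in> S" "z \<in> D" "z' \<in> D" "act \<alpha> (gen s [^]\<^bsub>free_group S\<^esub> k) (f s z) = f s z'"
    for S s z z' and k :: int
    using act_gen_pow_comm[where \<pi> = \<pi> and \<alpha> = \<alpha> and s = s and S = S and \<beta> = "\<beta> s" and k = k and y = "f s z"]
      bij \<alpha> \<pi>_\<beta> that \<beta>_f by simp
  then show thesis using that[of \<pi> \<iota>] bij \<iota> by blast
qed

section \<open>Words in one variable over a group\<close>

locale adjoin = group G for G (structure) +
  fixes H :: "'a set"
  assumes subgroup: "subgroup H G"
begin

abbreviation Q :: "('a + int) list monoid" where
  "Q \<equiv> adjoin_free G H"

definition emb :: "'a \<Rightarrow> ('a + int) list" where
  "emb h = (if h = \<one> then [] else [Inl h])"

definition var :: "('a + int) list" where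
  "var = [Inr 1]"

lemma group_sub: "group (G\<lparr>carrier := H\<rparr>)"
  using subgroup is_group by (rule subgroup.subgroup_is_group)

lemma group_Q: "group Q"
  unfolding adjoin_free_def by (rule group_free_product[OF group_sub group_integer_group])

sublocale Q: group Q
  by (rule group_Q)

lemma H_carrier: "h \<in> H \<Longrightarrow> h \<in> carrier G"
  using subgroup by (rule subgroup.mem_carrier)

lemma one_Q [simp]: "\<one>\<^bsub>Q\<^esub> = []"
  by (simp add: adjoin_free_def free_product_def)

lemma mult_Q: "u \<otimes>\<^bsub>Q\<^esub> v = foldr (nf_cons (G\<lparr>carrier := H\<rparr>) integer_group) u v"
  by (simp add: adjoin_free_def free_product_def)

lemma carrier_Q: "carrier Q = {w. normal_form (G\<lparr>carrier := H\<rparr>) integer_group w}"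
  by (simp add: adjoin_free_def free_product_def)

lemma emb_closed [simp]: "h \<in> H \<Longrightarrow> emb h \<in> carrier Q"
  by (simp add: emb_def carrier_Q normal_form_Cons)

lemma var_closed [simp]: "var \<in> carrier Q"
  by (simp add: var_def carrier_Q normal_form_Cons)

lemma emb_mult:
  "g \<in> H \<Longrightarrow> h \<in> H \<Longrightarrow> emb (g \<otimes> h) = emb g \<otimes>\<^bsub>Q\<^esub> emb h"
  by (auto simp: emb_def mult_Q H_carrier)

lemma emb_hom: "emb \<in> hom (G\<lparr>carrier := H\<rparr>) Q"
  by (auto simp: hom_def emb_mult)

lemma emb_one [simp]: "emb \<one> = []"
  by (simp add: emb_def)

lemma var_pow: "var [^]\<^bsub>Q\<^esub> (k::int) = (if k = 0 then [] else [Inr k])"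
proof -
  define e where "e k = (if k = 0 then [] else [Inr k :: 'a + int])" for k :: int
  have e: "e k \<in> carrier Q" for k by (auto simp: e_def carrier_Q normal_form_Cons)
  have "e k \<otimes>\<^bsub>Q\<^esub> e l = e (k + l)" for k l
    by (auto simp: e_def mult_Q)
  then have hom: "group_hom integer_group Q e"
    using e group_Q by (auto simp: group_hom_def group_hom_axioms_def hom_def)
  have "e k = e (1 [^]\<^bsub>integer_group\<^esub> k)" by simp
  also have "\<dots> = e 1 [^]\<^bsub>Q\<^esub> k"
    using group_hom.hom_int_pow[OF hom, of 1 k] by simp
  finally show ?thesis by (simp add: e_def var_def)
qed

definition syl :: "'a + int \<Rightarrow> ('a + int) list" where
  "syl s = (case s of Inl h \<Rightarrow> emb h | Inr k \<Rightarrow> var [^]\<^bsub>Q\<^esub> k)"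

lemma Cons_Q:
  assumes "s # w \<in> carrier Q"
  shows "s # w = syl s \<otimes>\<^bsub>Q\<^esub> w" "syl s \<in> carrier Q" "w \<in> carrier Q"
    "letter_in (G\<lparr>carrier := H\<rparr>) integer_group s"
proof -
  show "s # w = syl s \<otimes>\<^bsub>Q\<^esub> w"
    using assms
    by (cases s; cases w; cases "hd w")
       (auto simp: syl_def emb_def var_pow mult_Q carrier_Q normal_form_Cons)
  show w: "w \<in> carrier Q" and s: "letter_in (G\<lparr>carrier := H\<rparr>) integer_group s"
    using assms by (auto simp: carrier_Q normal_form_Cons)
  show "syl s \<in> carrier Q"
    using s by (cases s) (auto simp: syl_def)
qed

lemma Q_induct [consumes 1, case_names one Inl Inr]:
  assumes w: "w \<in> carrier Q"
    and one: "P \<one>\<^bsub>Q\<^esub>"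
    and Inl: "\<And>h w. h \<in> H \<Longrightarrow> w \<in> carrier Q \<Longrightarrow> P w \<Longrightarrow> P (emb h \<otimes>\<^bsub>Q\<^esub> w)"
    and Inr: "\<And>k w. w \<in> carrier Q \<Longrightarrow> P w \<Longrightarrow> P (var [^]\<^bsub>Q\<^esub> (k::int) \<otimes>\<^bsub>Q\<^esub> w)"
  shows "P w"
  using w
proof (induction w)
  case (Cons s w)
  note * = Cons_Q[OF Cons.prems]
  have "P (syl s \<otimes>\<^bsub>Q\<^esub> w)"
    using * Cons.IH by (cases s) (auto simp: syl_def intro: Inl Inr)
  then show ?case using *(1) by simp
qed (use one in simp)

text \<open>The universal property of the free product. The target is arbitrary because, besides
  evaluation in \<open>G\<close>, endomorphisms of \<open>Q\<close> are needed for substituting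
  words into words.\<close>

definition ext :: "('c, 'n) monoid_scheme \<Rightarrow> ('a \<Rightarrow> 'c) \<Rightarrow> 'c \<Rightarrow> ('a + int) list \<Rightarrow> 'c" where
  "ext M \<phi> y w = foldr (\<lambda>s acc. (case s of Inl h \<Rightarrow> \<phi> h | Inr k \<Rightarrow> y [^]\<^bsub>M\<^esub> k) \<otimes>\<^bsub>M\<^esub> acc) w \<one>\<^bsub>M\<^esub>"

lemma ext_hom:
  assumes M: "group M" and \<phi>: "\<phi> \<in> hom (G\<lparr>carrier := H\<rparr>) M" and y: "y \<in> carrier M"
  shows "ext M \<phi> y \<in> hom Q M"
proof -
  interpret M: group M by (rule M)
  let ?L = "letter_in (G\<lparr>carrier := H\<rparr>) integer_group"
  interpret \<phi>: group_hom "G\<lparr>carrier := H\<rparr>" M \<phi>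
    using M \<phi> group_sub by (simp add: group_hom_def group_hom_axioms_def)
  have \<phi>_one: "\<phi> \<one> = \<one>\<^bsub>M\<^esub>" using \<phi>.hom_one by simp
  have \<phi>_mult: "\<phi> (g \<otimes> h) = \<phi> g \<otimes>\<^bsub>M\<^esub> \<phi> h" if "g \<in> H" "h \<in> H" for g h
    using \<phi>.hom_mult that by simp
  have \<phi>_closed: "\<phi> h \<in> carrier M" if "h \<in> H" for h using \<phi>.hom_closed that by simp
  define val where "val s = (case s of Inl h \<Rightarrow> \<phi> h | Inr (k :: int) \<Rightarrow> y [^]\<^bsub>M\<^esub> k)" for s
  have Cons: "ext M \<phi> y (s # w) = val s \<otimes>\<^bsub>M\<^esub> ext M \<phi> y w" and Nil: "ext M \<phi> y [] = \<one>\<^bsub>M\<^esub>" for s w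
    by (auto simp: ext_def val_def)
  have val: "val s \<in> carrier M" if "?L s" for s
    using that y \<phi>_closed by (cases s) (auto simp: val_def)
  have closed: "ext M \<phi> y w \<in> carrier M" if "list_all ?L w" for w
    using that by (induction w) (auto simp: Cons Nil val)
  have nf_cons: "ext M \<phi> y (nf_cons (G\<lparr>carrier := H\<rparr>) integer_group s w) = val s \<otimes>\<^bsub>M\<^esub> ext M \<phi> y w"
    if s: "?L s" and w: "list_all ?L w" for s w
  proof (cases w)
    case (Cons t v)
    then have t: "?L t" and v: "ext M \<phi> y v \<in> carrier M" using w closed by auto
    show ?thesis
    proof (cases s; cases t)
      fix g h assume st: "s = Inl g" "t = Inl h"
      then have gh: "g \<in> H" "h \<in> H" using s t by auto
      have "val s \<otimes>\<^bsub>M\<^esub> ext M \<phi> y w = \<phi> (g \<otimes> h) \<otimes>\<^bsub>M\<^esub> ext M \<phi> y v"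
        using gh v by (simp add: \<open>w = t # v\<close> \<open>\<And>s w. ext M \<phi> y (s # w) = _\<close> st val_def \<phi>_mult \<phi>_closed M.m_assoc)
      then show ?thesis
        using st v \<open>w = t # v\<close> by (auto simp: \<open>\<And>s w. ext M \<phi> y (s # w) = _\<close> val_def \<phi>_one)
    next
      fix k l assume st: "s = Inr k" "t = Inr l"
      have "val s \<otimes>\<^bsub>M\<^esub> ext M \<phi> y w = y [^]\<^bsub>M\<^esub> (k + l) \<otimes>\<^bsub>M\<^esub> ext M \<phi> y v"
        using v y by (simp add: \<open>w = t # v\<close> \<open>\<And>s w. ext M \<phi> y (s # w) = _\<close> st val_def M.int_pow_mult M.m_assoc)
      then show ?thesis
        using st v \<open>w = t # v\<close> by (auto simp: \<open>\<And>s w. ext M \<phi> y (s # w) = _\<close> val_def)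
    qed (auto simp: \<open>w = t # v\<close> \<open>\<And>s w. ext M \<phi> y (s # w) = _\<close>)
  qed (cases s; auto simp: \<open>\<And>s w. ext M \<phi> y (s # w) = _\<close>)
  have "ext M \<phi> y (u \<otimes>\<^bsub>Q\<^esub> v) = ext M \<phi> y u \<otimes>\<^bsub>M\<^esub> ext M \<phi> y v"
    if "list_all ?L u" "v \<in> carrier Q" for u v
    using that(1)
  proof (induction u)
    case Nil
    then show ?case using that closed[of v] by (simp add: mult_Q \<open>ext M \<phi> y [] = _\<close> carrier_Q normal_form_def)
  next
    case (Cons s u)
    have "list_all ?L (u \<otimes>\<^bsub>Q\<^esub> v)"
      using normal_form_foldr[OF group_sub group_integer_group, of u v] Cons.prems that
      by (simp add: normal_form_def carrier_Q mult_Q)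
    with Cons that show ?case
      using nf_cons[of s "u \<otimes>\<^bsub>Q\<^esub> v"] closed[of u] closed[of v] val[of s]
      by (simp add: \<open>\<And>s w. ext M \<phi> y (s # w) = _\<close> M.m_assoc mult_Q carrier_Q normal_form_def)
  qed
  then show ?thesis
    using closed by (auto simp: hom_def carrier_Q normal_form_def)
qed

lemma ext_emb:
  assumes "group M" "\<phi> \<in> hom (G\<lparr>carrier := H\<rparr>) M" "h \<in> H"
  shows "ext M \<phi> y (emb h) = \<phi> h"
proof -
  interpret \<phi>: group_hom "G\<lparr>carrier := H\<rparr>" M \<phi>
    using assms group_sub by (simp add: group_hom_def group_hom_axioms_def)
  show ?thesis
    using \<phi>.hom_one \<phi>.hom_closed[of h] assms(3)
    by (auto simp: emb_def ext_def monoid.r_one[OF group.is_monoid[OF assms(1)]])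
qed

lemma ext_var:
  assumes "group M" "y \<in> carrier M"
  shows "ext M \<phi> y var = y"
  using assms by (simp add: ext_def var_def group.int_pow_1 monoid.r_one group.is_monoid)

lemma subst_in_eq_ext: "subst_in G g = ext G id g"
  by (simp add: subst_in_def ext_def fun_eq_iff cong: sum.case_cong)

lemma id_hom: "id \<in> hom (G\<lparr>carrier := H\<rparr>) G"
  by (auto simp: hom_def H_carrier)

lemma depends_on_iff:
  "depends_on G H g \<longleftrightarrow> (\<exists>w\<in>carrier Q. w \<noteq> [] \<and> ext G id g w = \<one>)"
  by (simp add: depends_on_def subst_in_eq_ext)

lemma Q_hom_eqI:
  assumes M: "group M" and p: "p \<in> hom Q M" and q: "q \<in> hom Q M"
    and emb: "\<And>h. h \<in> H \<Longrightarrow> p (emb h) = q (emb h)" and var: "p var = q var" and w: "w \<in> carrier Q"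
  shows "p w = q w"
proof -
  interpret p: group_hom Q M p using M p group_Q by (simp add: group_hom_def group_hom_axioms_def)
  interpret q: group_hom Q M q using M q group_Q by (simp add: group_hom_def group_hom_axioms_def)
  show ?thesis
    using w by (induction w rule: Q_induct)
      (auto simp: emb p.hom_int_pow q.hom_int_pow var simp del: one_Q)
qed

text \<open>The substitution \<open>x \<mapsto> y\<close> of \<open>H * \<langle>x\<rangle>\<close> is injective if it has a left inverse \<open>x \<mapsto> z\<close>.\<close>

lemma depends_on_subst:
  assumes g: "g \<in> carrier G" and g': "g' \<in> carrier G"
    and y: "y \<in> carrier Q" and z: "z \<in> carrier Q"
    and zy: "ext Q emb z y = var" and gy: "ext G id g' y = g"
    and dep: "depends_on G H g"
  shows "depends_on G H g'"
proof -
  obtain w where w: "w \<in> carrier Q" "w \<noteq> []" "ext G id g w = \<one>"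
    using dep depends_on_iff by blast
  have ey: "ext Q emb y \<in> hom Q Q" and ez: "ext Q emb z \<in> hom Q Q"
    using ext_hom[OF group_Q emb_hom] y z by auto
  have e1: "ext G id g' \<in> hom Q G" and e2: "ext G id g \<in> hom Q G"
    using ext_hom[OF is_group id_hom] g g' by auto
  define w' where "w' = ext Q emb y w"
  have w': "w' \<in> carrier Q" using ey w by (auto simp: w'_def hom_def)
  have "(ext Q emb z \<circ> ext Q emb y) w = id w"
  proof (rule Q_hom_eqI[OF group_Q Group.hom_compose[OF ey ez] _ _ _ w(1)])
    show "id \<in> hom Q Q" by (simp add: hom_def)
  qed (use y zy in \<open>simp_all add: ext_emb[OF group_Q emb_hom] ext_var[OF group_Q]\<close>)
  then have "ext Q emb z w' = w" by (simp add: w'_def)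
  then have "w' \<noteq> []" using w(2) group_hom.hom_one[of Q Q "ext Q emb z"] ez group_Q
    by (auto simp: group_hom_def group_hom_axioms_def)
  moreover have "(ext G id g' \<circ> ext Q emb y) w = ext G id g w"
    by (rule Q_hom_eqI[OF is_group Group.hom_compose[OF ey e1] e2 _ _ w(1)])
       (use y gy g in \<open>simp_all add: ext_emb[OF group_Q emb_hom] ext_emb[OF is_group id_hom]
          ext_var[OF group_Q] ext_var[OF is_group]\<close>)
  then have "ext G id g' w' = \<one>" by (simp add: w'_def w)
  ultimately show ?thesis using w' depends_on_iff by blast
qed

text \<open>The substitution of \<open>x l\<close> for \<open>x\<close> is undone by that of
  \<open>x l^(-1)\<close>.\<close>

lemma depends_on_mult_right:
  assumes g: "g \<in> carrier G" and l: "l \<in> H" and dep: "depends_on G H (g \<otimes> l)"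
  shows "depends_on G H g"
proof -
  have l': "inv l \<in> H" using subgroup l by (rule subgroup.m_inv_closed)
  have hom': "ext Q emb y (u \<otimes>\<^bsub>Q\<^esub> v) = ext Q emb y u \<otimes>\<^bsub>Q\<^esub> ext Q emb y v"
    if "y \<in> carrier Q" "u \<in> carrier Q" "v \<in> carrier Q" for y u v
    using ext_hom[OF group_Q emb_hom that(1)] that by (simp add: hom_def)
  have homG: "ext G id y (u \<otimes>\<^bsub>Q\<^esub> v) = ext G id y u \<otimes> ext G id y v"
    if "y \<in> carrier G" "u \<in> carrier Q" "v \<in> carrier Q" for y u v
    using ext_hom[OF is_group id_hom that(1)] that by (simp add: hom_def)
  show ?thesis
  proof (rule depends_on_subst[OF _ g _ _ _ _ dep])
    show "ext Q emb (var \<otimes>\<^bsub>Q\<^esub> emb (inv l)) (var \<otimes>\<^bsub>Q\<^esub> emb l) = var"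
      using l l' by (simp add: hom' ext_emb[OF group_Q emb_hom] ext_var[OF group_Q] Q.m_assoc
          H_carrier flip: emb_mult) (metis Q.r_one one_Q var_closed)
    show "ext G id g (var \<otimes>\<^bsub>Q\<^esub> emb l) = g \<otimes> l"
      using g l by (simp add: homG ext_emb[OF is_group id_hom] ext_var[OF is_group])
  qed (use g l l' H_carrier in auto)
qed

text \<open>Multiplying all exponents of \<open>x\<close> by \<open>k\<close> keeps normal forms
  normal, since no exponent becomes 0; hence the new word is visibly non-trivial.\<close>

lemma depends_on_root:
  assumes g: "g \<in> carrier G" and k: "k \<noteq> (0::int)" and dep: "depends_on G H (g [^] k)"
  shows "depends_on G H g"
proof -
  define \<rho> where "\<rho> = map (map_sum (id :: 'a \<Rightarrow> 'a) (\<lambda>n::int. k * n))"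
  obtain w where w: "w \<in> carrier Q" "w \<noteq> []" "ext G id (g [^] k) w = \<one>"
    using dep depends_on_iff by blast
  have "isl (map_sum id (\<lambda>n::int. k * n) s) = isl s" for s :: "'a + int" by (cases s) auto
  moreover have "letter_in (G\<lparr>carrier := H\<rparr>) integer_group (map_sum id (\<lambda>n. k * n) s)"
    if "letter_in (G\<lparr>carrier := H\<rparr>) integer_group s" for s
    using that k by (cases s) auto
  ultimately have "\<rho> w \<in> carrier Q"
    using w by (auto simp: \<rho>_def carrier_Q normal_form_def successively_map list_all_iff)
  moreover have "ext G id g (\<rho> w) = ext G id (g [^] k) w"
  proof -
    have "(case map_sum id (\<lambda>n. k * n) s of Inl h \<Rightarrow> id h | Inr n \<Rightarrow> g [^] n) =
        (case s of Inl h \<Rightarrow> id h | Inr n \<Rightarrow> (g [^] k) [^] n)" for s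
      using g by (cases s) (auto simp: int_pow_pow)
    then show ?thesis by (simp add: ext_def \<rho>_def foldr_map o_def)
  qed
  moreover have "\<rho> w \<noteq> []" using w(2) by (simp add: \<rho>_def)
  ultimately show ?thesis unfolding depends_on_iff using w(3) by metis
qed

text \<open>Passing to inverses, which is the case -1 of taking roots, exchanges left and right
  multiplication.\<close>

lemma depends_on_mult_left:
  assumes g: "g \<in> carrier G" and l: "l \<in> H" and dep: "depends_on G H (l \<otimes> g)"
  shows "depends_on G H g"
proof -
  note lG = H_carrier[OF l]
  have l': "inv l \<in> H" using subgroup l by (rule subgroup.m_inv_closed)
  have m1: "y [^] (-1::int) = inv y" if "y \<in> carrier G" for y
    using that int_pow_neg[of y 1] by simp
  have "(inv g \<otimes> inv l) [^] (-1::int) = l \<otimes> g"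
    using g lG m1[of "inv g \<otimes> inv l"] by (simp add: inv_mult_group)
  then have "depends_on G H (inv g \<otimes> inv l)"
    using g lG dep depends_on_root[of "inv g \<otimes> inv l" "-1"] by simp
  then have "depends_on G H (inv g)"
    using g depends_on_mult_right[OF _ l'] by simp
  moreover have "g [^] (-1::int) = inv g" using g by (rule m1)
  moreover have "(inv g) [^] (-1::int) = g" using g m1[of "inv g"] by simp
  ultimately show ?thesis
    using g depends_on_root[of g "-1"] by simp
qed

lemma depends_on_mem:
  assumes h: "h \<in> H"
  shows "depends_on G H h"
proof -
  have "var \<otimes>\<^bsub>Q\<^esub> emb (inv h) \<noteq> []"
    by (auto simp: mult_Q var_def emb_def)
  moreover have "ext G id h (var \<otimes>\<^bsub>Q\<^esub> emb (inv h)) = \<one>"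
    using ext_hom[OF is_group id_hom, of h] h H_carrier subgroup.m_inv_closed[OF subgroup]
    by (simp add: hom_def ext_emb[OF is_group id_hom] ext_var[OF is_group])
  ultimately show ?thesis
    using h subgroup.m_inv_closed[OF subgroup] depends_on_iff Q.m_closed by (meson emb_closed var_closed)
qed

end

lemma depends_on_mono:
  assumes "H \<subseteq> H'" "depends_on G H g"
  shows "depends_on G H' g"
proof -
  have "letter_in (G\<lparr>carrier := H'\<rparr>) integer_group s" if "letter_in (G\<lparr>carrier := H\<rparr>) integer_group s" for s
    using that assms(1) by (cases s) auto
  then have "carrier (adjoin_free G H) \<subseteq> carrier (adjoin_free G H')"
    by (auto simp: adjoin_free_def free_product_def normal_form_def list_all_iff)
  then show ?thesis
    using assms(2) by (auto simp: depends_on_def adjoin_free_def free_product_def)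
qed

section \<open>Independence over subgroups of free groups\<close>

declare free_group_one [simp del]

type_synonym 's xword = "('s letter list + int) list"

text \<open>With the whole group as subgroup, \<open>Q\<close> is the free product
  \<open>F * <x>\<close>: weights have to absorb elements outside the subgroup over which
  independence is tested.\<close>

locale free_words = adjoin G "carrier G" for G :: "'a letter list monoid" (structure) +
  fixes S :: "'a set"
  assumes G_eq: "G = free_group S"
begin

abbreviation mult_words :: "'a xword \<Rightarrow> 'a xword \<Rightarrow> 'a xword" (infixl "\<odot>" 70) where
  "u \<odot> v \<equiv> u \<otimes>\<^bsub>Q\<^esub> v"

declare one_Q [simp del] emb_one [simp del]

lemma emb_one_Q [simp]: "emb \<one> = \<one>\<^bsub>Q\<^esub>"
  by (simp add: one_Q emb_one)

lemmas one_G = free_group_one[of S, folded G_eq]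
lemma act_one [simp]: "act \<pi> \<one> z = z"
  by (simp add: one_G)

lemmas act_mult = act_mult[where S = S, folded G_eq]
lemmas act_m_inv = act_m_inv[where S = S, folded G_eq]
lemmas act_int_pow = act_int_pow[where S = S, folded G_eq]
lemmas act_gen_pow = act_gen_pow[where S = S, folded G_eq]
lemmas gen_closed [simp] = gen_in_free_group[where S = S, folded G_eq]
lemmas G_induct = free_group_induct[where S = S, folded G_eq, consumes 1, case_names one gen]

lemma emb_cancel [simp]:
  assumes "g \<in> carrier G"
  shows "emb g \<odot> emb (inv g) = \<one>\<^bsub>Q\<^esub>" "emb (inv g) \<odot> emb g = \<one>\<^bsub>Q\<^esub>"
  using assms emb_mult[of g "inv g"] emb_mult[of "inv g" g] by auto

lemma act_generate:
  assumes bij: "\<And>s. bij (\<pi> s)" and A: "A \<subseteq> carrier G"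
    and gens: "\<And>l u. l \<in> A \<Longrightarrow> u \<in> carrier Q \<Longrightarrow> act \<pi> l (\<iota> u) = \<iota> (u \<odot> emb l)"
    and l: "l \<in> generate G A" and u: "u \<in> carrier Q"
  shows "act \<pi> l (\<iota> u) = \<iota> (u \<odot> emb l)"
  using l u
proof (induction l arbitrary: u rule: generate.induct)
  case one
  then show ?case by simp
next
  case (inv l)
  then have l: "l \<in> carrier G" using A by blast
  have "act \<pi> l (\<iota> (u \<odot> emb (inv l))) = \<iota> u"
    using inv l by (simp add: gens Q.m_assoc)
  then show ?case by (rule act_m_inv[OF bij l])
next
  case (eng h1 h2)
  then have "h1 \<in> carrier G" "h2 \<in> carrier G"
    using generate_in_carrier[OF A] by auto
  with eng show ?case by (simp add: act_mult[OF bij] emb_mult Q.m_assoc)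
qed (use gens in simp)

text \<open>Reading \<open>x\<close> as \<open>g\<close>, a word \<open>w\<close> over
  \<open>L\<close> moves \<open>\<iota> 1\<close> to \<open>\<iota> w\<close>. If \<open>w\<close>
  vanishes at \<open>g\<close>, the two points agree, and separation from the base point alone gives
  \<open>w = 1\<close>.\<close>

lemma independentI:
  assumes bij: "\<And>s. bij (\<pi> s)" and L: "subgroup L G" and g: "g \<in> carrier G"
    and inj: "\<And>u. u \<in> carrier Q \<Longrightarrow> \<iota> u = \<iota> \<one>\<^bsub>Q\<^esub> \<Longrightarrow> u = \<one>\<^bsub>Q\<^esub>"
    and actL: "\<And>l u. l \<in> L \<Longrightarrow> u \<in> carrier Q \<Longrightarrow> act \<pi> l (\<iota> u) = \<iota> (u \<odot> emb l)"
    and actg: "\<And>u. u \<in> carrier Q \<Longrightarrow> act \<pi> g (\<iota> u) = \<iota> (u \<odot> var)"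
  shows "\<not> depends_on G L g"
proof
  assume "depends_on G L g"
  interpret L: adjoin G L
    by (intro adjoin.intro adjoin_axioms.intro is_group L)
  obtain w where w: "w \<in> carrier (adjoin_free G L)" "w \<noteq> []" "ext G id g w = \<one>"
    using \<open>depends_on G L g\<close> unfolding L.depends_on_iff L.ext_def ext_def by blast
  have LG: "L \<subseteq> carrier G" using L by (rule subgroup.subset)
  have pow: "act \<pi> (g [^] k) (\<iota> u) = \<iota> (u \<odot> var [^]\<^bsub>Q\<^esub> k)" if "u \<in> carrier Q" for k :: int and u
  proof -
    define orb where "orb k = \<iota> (u \<odot> var [^]\<^bsub>Q\<^esub> (k::int))" for k
    have "act \<pi> g (orb i) = orb (i + 1)" for i
      using that Q.int_pow_mult[of var i 1] by (simp add: orb_def actg Q.m_assoc)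
    then show ?thesis
      using that act_int_pow[where \<pi> = \<pi> and orb = orb and k = k and i = 0, OF bij g] by (simp add: orb_def)
  qed
  have *: "act \<pi> (ext G id g w) (\<iota> u) = \<iota> (u \<odot> w)"
    if "w \<in> carrier (adjoin_free G L)" "w \<in> carrier Q" "u \<in> carrier Q" for w u
    using that
  proof (induction w arbitrary: u)
    case (Cons s w)
    note * = Cons_Q[OF Cons.prems(2)] L.Cons_Q[OF Cons.prems(1)]
    have "act \<pi> (case s of Inl h \<Rightarrow> id h | Inr k \<Rightarrow> g [^] k) (\<iota> u) = \<iota> (u \<odot> syl s)"
      using *(8) Cons.prems(3) by (cases s) (auto simp: actL pow syl_def)
    moreover have "ext G id g (s # w) = (case s of Inl h \<Rightarrow> id h | Inr k \<Rightarrow> g [^] k) \<otimes> ext G id g w"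
      by (simp add: ext_def)
    ultimately have "act \<pi> (ext G id g (s # w)) (\<iota> u) = act \<pi> (ext G id g w) (\<iota> (u \<odot> syl s))"
      by (simp add: act_mult[OF bij])
    also have "\<dots> = \<iota> (u \<odot> (syl s \<odot> w))"
      using Cons.IH[OF *(7) *(3) Q.m_closed[OF Cons.prems(3) *(2)]]
      unfolding Q.m_assoc[OF Cons.prems(3) *(2,3)] .
    finally show ?case by (simp add: id_def flip: *(1))
  qed (simp add: ext_def Q.r_one[unfolded one_Q])
  have wQ: "w \<in> carrier Q"
  proof -
    have "letter_in (G\<lparr>carrier := carrier G\<rparr>) integer_group s"
      if "letter_in (G\<lparr>carrier := L\<rparr>) integer_group s" for s
      using that LG by (cases s) auto
    then show ?thesis
      using w(1) by (auto simp: carrier_Q L.carrier_Q normal_form_def list_all_iff)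
  qed
  have "\<iota> w = \<iota> \<one>\<^bsub>Q\<^esub>"
    using *[OF w(1) wQ, of "\<one>\<^bsub>Q\<^esub>"] w(3) wQ by (simp add: one_G)
  then show False using inj[OF wQ] w(2) by (simp add: one_Q)
qed

end

section \<open>Weighted cosets\<close>

locale coset_words = free_words +
  fixes L :: "'a letter list set"
  assumes L: "subgroup L G"
begin

sublocale L: adjoin G L
  by (intro adjoin.intro adjoin_axioms.intro is_group L)

lemma L_carrier [simp]: "l \<in> L \<Longrightarrow> l \<in> carrier G"
  using L by (rule subgroup.mem_carrier)

lemma L_one [simp]: "\<one> \<in> L"
  using L by (rule subgroup.one_closed)

text \<open>Right multiplication on weight and coset at once: the action before anything is
  identified. Pairs outside the carriers are fixed, to obtain permutations of the full type.\<close>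

definition shift :: "'a \<Rightarrow> 'a xword \<times> 'a letter list set \<Rightarrow>
    'a xword \<times> 'a letter list set" where
  "shift s z = (if s \<in> S \<and> z \<in> carrier Q \<times> rcosets L
    then (fst z \<odot> emb (gen s), snd z #> gen s) else z)"

lemma rcosetI [intro, simp]: "k \<in> carrier G \<Longrightarrow> L #> k \<in> rcosets L"
  by (auto simp: RCOSETS_def)

lemma rcosetE:
  assumes "M \<in> rcosets L" obtains k where "k \<in> carrier G" "M = L #> k"
  using assms by (auto simp: RCOSETS_def)

lemma rcoset_assoc [simp]:
  "k \<in> carrier G \<Longrightarrow> h \<in> carrier G \<Longrightarrow> (L #> k) #> h = L #> (k \<otimes> h)"
  using coset_mult_assoc subgroup.subset[OF L] by blast

lemma rcoset_eq_iff:
  assumes "k \<in> carrier G" "h \<in> carrier G"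
  shows "L #> k = L #> h \<longleftrightarrow> (\<exists>l\<in>L. k = l \<otimes> h)"
proof
  assume "L #> k = L #> h"
  then have "k \<in> L #> h" using assms(1) L rcos_self by blast
  then show "\<exists>l\<in>L. k = l \<otimes> h" by (auto simp: r_coset_def)
next
  assume "\<exists>l\<in>L. k = l \<otimes> h"
  then have "k \<in> L #> h" by (auto simp: r_coset_def)
  then show "L #> k = L #> h" using assms L repr_independence by metis
qed

lemma rcoset_eqI: "l \<in> L \<Longrightarrow> k \<in> carrier G \<Longrightarrow> L #> (l \<otimes> k) = L #> k"
  by (subst rcoset_eq_iff) auto

lemma bij_shift: "bij (shift s)"
proof (cases "s \<in> S")
  case True
  note s = True
  define unshift where "unshift z = (if z \<in> carrier Q \<times> rcosets L
    then (fst z \<odot> emb (inv (gen s)), snd z #> inv (gen s)) else z)" for z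
  note g = gen_closed[OF True]
  have 1: "unshift (shift s z) = z" for z
  proof (cases "z \<in> carrier Q \<times> rcosets L")
    case True
    then obtain q k where z: "z = (q, L #> k)" "q \<in> carrier Q" "k \<in> carrier G"
      by (auto elim!: rcosetE)
    then show ?thesis using s g by (simp add: shift_def unshift_def Q.m_assoc m_assoc)
  qed (auto simp: shift_def unshift_def)
  have 2: "shift s (unshift z) = z" for z
  proof (cases "z \<in> carrier Q \<times> rcosets L")
    case True
    then obtain q k where z: "z = (q, L #> k)" "q \<in> carrier Q" "k \<in> carrier G"
      by (auto elim!: rcosetE)
    then show ?thesis using s g by (simp add: shift_def unshift_def Q.m_assoc m_assoc)
  qed (auto simp: shift_def unshift_def)
  show ?thesis using 1 2 by (intro o_bij[of unshift]) auto
next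
  case False
  then have "shift s = id" by (auto simp: shift_def fun_eq_iff)
  then show ?thesis by simp
qed

lemma act_shift_pow:
  assumes "s \<in> S" "q \<in> carrier Q" "k \<in> carrier G"
  shows "act shift (gen s [^] (i::int)) (q, L #> k) = (q \<odot> emb (gen s [^] i), L #> (k \<otimes> gen s [^] i))"
proof -
  note g = gen_closed[OF assms(1)]
  define orb where "orb i = (q \<odot> emb (gen s [^] (i::int)), L #> (k \<otimes> gen s [^] i))" for i
  have "shift s (orb i) = orb (i + 1)" for i
    using assms g int_pow_mult[of "gen s" i 1]
    by (simp add: shift_def orb_def emb_mult Q.m_assoc m_assoc)
  then show ?thesis
    using assms g act_gen_pow[where \<pi> = shift and orb = orb and k = i and i = 0, OF bij_shift assms(1)]
    by (simp add: orb_def)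
qed

text \<open>One step is an arbitrary power of a generator, and only its end points have to lie in
  \<open>U\<close>. If an identification leaves all moves between points of \<open>U\<close> as they
  were, then the elements reached still act on the base point as before.\<close>

inductive_set reach :: "'a letter list set \<Rightarrow> 'a letter list set" for U where
  one: "\<one> \<in> reach U"
| step: "k \<in> reach U \<Longrightarrow> s \<in> S \<Longrightarrow> k \<otimes> gen s [^] (i::int) \<in> U \<Longrightarrow> k \<otimes> gen s [^] i \<in> reach U"

lemma reach_subset: "\<one> \<in> U \<Longrightarrow> reach U \<subseteq> U"
proof
  fix k assume "\<one> \<in> U" "k \<in> reach U"
  from this(2,1) show "k \<in> U" by (induction) auto
qed

lemma reach_mono: "U \<subseteq> V \<Longrightarrow> reach U \<subseteq> reach V"
proof
  fix k assume "U \<subseteq> V" "k \<in> reach U"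
  from this(2,1) show "k \<in> reach V" by (induction) (auto intro: reach.intros)
qed

end

type_synonym ('s, 'y) glue = "'y + 's \<times> 'y"

type_synonym 's coset_point = "'s xword \<times> 's letter list set"

lemma bij_map_sum:
  assumes "bij f" "bij g"
  shows "bij (map_sum f g)"
proof (rule o_bij[of "map_sum (inv_into UNIV f) (inv_into UNIV g)"])
  show "map_sum (inv_into UNIV f) (inv_into UNIV g) \<circ> map_sum f g = id"
    using assms by (auto simp: fun_eq_iff map_sum_def bij_is_inj split: sum.split)
  show "map_sum f g \<circ> map_sum (inv_into UNIV f) (inv_into UNIV g) = id"
    using assms by (auto simp: fun_eq_iff map_sum_def bij_is_surj surj_f_inv_f split: sum.split)
qed

context free_words
begin

definition glued :: "('a \<Rightarrow> ('a, 'y) glue \<Rightarrow> ('a, 'y) glue) \<Rightarrow> ('d \<Rightarrow> ('a, 'y) glue) \<Rightarrow>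
    'd set \<Rightarrow> ('a \<Rightarrow> 'd \<Rightarrow> 'y) \<Rightarrow> ('a \<Rightarrow> 'y \<Rightarrow> 'y) \<Rightarrow> bool" where
  "glued \<pi> \<iota> D f \<alpha> \<longleftrightarrow> (\<forall>s. bij (\<pi> s)) \<and>
    (\<forall>s. \<forall>z\<in>D. \<forall>z'\<in>D. \<iota> z = \<iota> z' \<longleftrightarrow> f s z = f s z') \<and>
    (\<forall>s\<in>S. \<forall>(k::int). \<forall>z\<in>D. \<forall>z'\<in>D. act \<alpha> (gen s [^] k) (f s z) = f s z' \<longrightarrow>
      act \<pi> (gen s [^] k) (\<iota> z) = \<iota> z')"

lemma
  assumes "glued \<pi> \<iota> D f \<alpha>"
  shows glued_bij: "bij (\<pi> s)"
    and glued_eq: "z \<in> D \<Longrightarrow> z' \<in> D \<Longrightarrow> \<iota> z = \<iota> z' \<longleftrightarrow> f s z = f s z'"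
    and glued_move: "s \<in> S \<Longrightarrow> z \<in> D \<Longrightarrow> z' \<in> D \<Longrightarrow>
      act \<alpha> (gen s [^] (k::int)) (f s z) = f s z' \<Longrightarrow> act \<pi> (gen s [^] k) (\<iota> z) = \<iota> z'"
  using assms unfolding glued_def by (simp_all only: simp_thms)

lemma ex_glued:
  fixes f :: "'a \<Rightarrow> 'd \<Rightarrow> 'y" and \<alpha> :: "'a \<Rightarrow> 'y \<Rightarrow> 'y"
  assumes "\<And>s. bij (\<alpha> s)"
    and ker: "\<forall>s t. \<forall>z\<in>D. \<forall>z'\<in>D. f s z = f s z' \<longrightarrow> f t z = f t z'"
  shows "\<exists>\<pi> \<iota>. glued \<pi> \<iota> D f \<alpha>"
proof (rule glue_permutations[of \<alpha> D f])
  fix \<pi> :: "'a \<Rightarrow> ('a, 'y) glue \<Rightarrow> ('a, 'y) glue" and \<iota> :: "'d \<Rightarrow> ('a, 'y) glue"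
  assume *: "\<And>s. bij (\<pi> s)"
    "\<And>s z z'. z \<in> D \<Longrightarrow> z' \<in> D \<Longrightarrow> \<iota> z = \<iota> z' \<longleftrightarrow> f s z = f s z'"
    "\<And>S s k z z'. s \<in> S \<Longrightarrow> z \<in> D \<Longrightarrow> z' \<in> D \<Longrightarrow>
      act \<alpha> (gen s [^]\<^bsub>free_group S\<^esub> (k::int)) (f s z) = f s z' \<Longrightarrow>
      act \<pi> (gen s [^]\<^bsub>free_group S\<^esub> k) (\<iota> z) = \<iota> z'"
  show ?thesis
    unfolding glued_def by (intro exI[of _ \<pi>] exI[of _ \<iota>] conjI allI ballI impI) (simp add: *(1), simp add: *(2), rule *(3)[of _ S, folded G_eq])
qed (use assms in blast)+

end

section \<open>Three ways to alter the weighted coset action\<close>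

context coset_words
begin

lemma reach_carrier: "U \<subseteq> carrier G \<Longrightarrow> k \<in> reach U \<Longrightarrow> k \<in> carrier G"
  using reach_mono[of U "carrier G"] reach_subset[of "carrier G"] by auto

lemma act_reach:
  assumes bij: "\<And>s. bij (\<pi> s)" and U: "U \<subseteq> carrier G" "\<one> \<in> U"
    and step: "\<And>s k i q. s \<in> S \<Longrightarrow> k \<in> U \<Longrightarrow> k \<otimes> gen s [^] (i::int) \<in> U \<Longrightarrow> q \<in> carrier Q \<Longrightarrow>
      act \<pi> (gen s [^] i) (\<iota> (q, L #> k)) = \<iota> (q \<odot> emb (gen s [^] i), L #> (k \<otimes> gen s [^] i))"
    and k: "k \<in> reach U" and u: "u \<in> carrier Q"
  shows "act \<pi> k (\<iota> (u, L #> \<one>)) = \<iota> (u \<odot> emb k, L #> k)"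
  using k
proof induction
  case one
  then show ?case using u by simp
next
  case (step k s i)
  have "k \<in> U" using reach_subset[OF U(2)] step by blast
  with step u U assms(4) show ?case
    by (simp add: act_mult[OF bij] emb_mult Q.m_assoc subsetD)
qed

text \<open>The points of \<open>f\<close> and \<open>f'\<close> become one, with weights such that
  \<open>f\<close> followed by the inverse of \<open>f'\<close> multiplies by \<open>x\<close>. The
  last steps towards them use different generators, and each must still be possible: therefore
  \<open>f'\<close> is displaced for every generator except \<open>s'\<close>, and \<open>f\<close>
  for \<open>s'\<close> only.\<close>

lemma merge_points:
  assumes U: "U \<subseteq> carrier G" "\<one> \<in> U" and LU: "L \<subseteq> reach U"
    and k: "k \<in> reach U" "k' \<in> reach U" and s: "s \<in> S" "s' \<in> S" "s \<noteq> s'"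
    and f: "f = k \<otimes> gen s [^] (i::int)" and f': "f' = k' \<otimes> gen s' [^] (i'::int)"
    and ne: "L #> f \<noteq> L #> f'"
    and safe: "\<And>u. u \<in> U \<Longrightarrow> L #> u \<noteq> L #> f \<and> L #> u \<noteq> L #> f'"
  shows "\<not> depends_on G L (f \<otimes> inv f')"
proof -
  have kG [simp]: "k \<in> carrier G" "k' \<in> carrier G" using k U reach_carrier by auto
  have fG [simp]: "f \<in> carrier G" "f' \<in> carrier G" using f f' s by auto
  \<comment> \<open>Forced by the requirement that weight \<open>u f\<close> at \<open>f\<close> be
    the same point as weight \<open>u x f'\<close> at \<open>f'\<close>.\<close>
  define X where "X = emb (inv f') \<odot> (inv\<^bsub>Q\<^esub> var \<odot> emb f)"
  have X [simp]: "X \<in> carrier Q" by (simp add: X_def)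
  define pl where "pl r z = (if r \<noteq> s' \<and> snd z = L #> f' then (fst z \<odot> X, L #> f)
    else if r = s' \<and> snd z = L #> f then (fst z \<odot> inv\<^bsub>Q\<^esub> X, L #> f') else z)" for r z
  let ?D = "carrier Q \<times> rcosets L"
  have ker: "\<forall>r t. \<forall>z\<in>?D. \<forall>z'\<in>?D. pl r z = pl r z' \<longrightarrow> pl t z = pl t z'"
    using ne by (auto simp: pl_def Q.m_assoc split: if_splits)
  obtain \<pi> \<iota> where gl: "glued \<pi> \<iota> ?D pl shift"
    using ex_glued[of shift ?D pl, OF bij_shift ker] by blast
  note bij = glued_bij[OF gl] and \<iota> = glued_eq[OF gl] and move = glued_move[OF gl]
  have mv: "act \<pi> (gen r [^] (j::int)) (\<iota> (q, L #> h)) =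
      \<iota> (q \<odot> emb (gen r [^] j), L #> (h \<otimes> gen r [^] j))"
    if "r \<in> S" "q \<in> carrier Q" "h \<in> carrier G"
      "\<forall>q'. pl r (q', L #> h) = (q', L #> h)"
      "\<forall>q'. pl r (q', L #> (h \<otimes> gen r [^] j)) = (q', L #> (h \<otimes> gen r [^] j))" for r q h j
    using that by (intro move) (auto simp: act_shift_pow)
  have plU: "pl r (q, L #> u) = (q, L #> u)" if "u \<in> U" for r q u
    using safe[OF that] by (auto simp: pl_def)
  have reach: "act \<pi> h (\<iota> (u, L #> \<one>)) = \<iota> (u \<odot> emb h, L #> h)"
    if "h \<in> reach U" "u \<in> carrier Q" for h u
    using that U plU by (intro act_reach[OF bij U] mv) auto
  have rU: "h \<in> U" if "h \<in> reach U" for h using that reach_subset[OF U(2)] by blast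
  have actf: "act \<pi> f (\<iota> (u, L #> \<one>)) = \<iota> (u \<odot> emb f, L #> f)" if "u \<in> carrier Q" for u
  proof -
    have "act \<pi> f (\<iota> (u, L #> \<one>)) = act \<pi> (gen s [^] i) (\<iota> (u \<odot> emb k, L #> k))"
      using that k by (simp add: f act_mult[OF bij] reach)
    also have "\<dots> = \<iota> (u \<odot> emb k \<odot> emb (gen s [^] i), L #> (k \<otimes> gen s [^] i))"
      using that k s safe[OF rU[OF k(1)]] ne by (intro mv) (auto simp: pl_def simp flip: f)
    finally show ?thesis using that s by (simp add: Q.m_assoc f emb_mult)
  qed
  have actf': "act \<pi> f' (\<iota> (u, L #> \<one>)) = \<iota> (u \<odot> emb f', L #> f')" if "u \<in> carrier Q" for u
  proof -
    have "act \<pi> f' (\<iota> (u, L #> \<one>)) = act \<pi> (gen s' [^] i') (\<iota> (u \<odot> emb k', L #> k'))"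
      using that k by (simp add: f' act_mult[OF bij] reach)
    also have "\<dots> = \<iota> (u \<odot> emb k' \<odot> emb (gen s' [^] i'), L #> (k' \<otimes> gen s' [^] i'))"
      using that k s safe[OF rU[OF k(2)]] ne by (intro mv) (auto simp: pl_def simp flip: f')
    finally show ?thesis using that s by (simp add: Q.m_assoc f' emb_mult)
  qed
  show ?thesis
  proof (rule independentI[where \<pi> = \<pi> and \<iota> = "\<lambda>u. \<iota> (u, L #> \<one>)", OF bij L])
    fix u assume u: "u \<in> carrier Q"
    have "\<iota> (u \<odot> emb f, L #> f) = \<iota> (u \<odot> var \<odot> emb f', L #> f')"
    proof (rule \<iota>[THEN iffD2])
      have "emb f \<odot> inv\<^bsub>Q\<^esub> X = var \<odot> emb f'"
      proof -
        have "emb f = var \<odot> emb f' \<odot> X"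
          by (simp add: X_def Q.m_assoc flip: Q.m_assoc[of "emb f'"]) (simp flip: Q.m_assoc)
        then show ?thesis by (simp add: Q.m_assoc)
      qed
      then show "pl s' (u \<odot> emb f, L #> f) = pl s' (u \<odot> var \<odot> emb f', L #> f')"
        using u ne by (simp add: pl_def Q.m_assoc)
    qed (use u in auto)
    then show "act \<pi> (f \<otimes> inv f') (\<iota> (u, L #> \<one>)) = \<iota> (u \<odot> var, L #> \<one>)"
      using u actf act_m_inv[OF bij fG(2) actf'[of "u \<odot> var"]] by (simp add: act_mult[OF bij])
    show "u = \<one>\<^bsub>Q\<^esub>" if "\<iota> (u, L #> \<one>) = \<iota> (\<one>\<^bsub>Q\<^esub>, L #> \<one>)"
      using that u \<iota>[of "(u, L #> \<one>)" "(\<one>\<^bsub>Q\<^esub>, L #> \<one>)" s] plU[OF U(2)] by auto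
    show "act \<pi> l (\<iota> (u, L #> \<one>)) = \<iota> (u \<odot> emb l, L #> \<one>)" if "l \<in> L" for l
      using reach[of l u] that u LU rcoset_eqI[of l \<one>] by auto
  qed auto
qed

text \<open>The path comes back to its own coset, so there are no two points to identify. Instead
  \<open>s\<close> leaves its old line at \<open>f\<close> and fixes the coset of \<open>f\<close>,
  with factor \<open>x\<close>. This disturbs nothing, because \<open>f\<close> is reached by
  another generator and its coset is not met by \<open>U\<close>.\<close>

lemma elliptic_point:
  assumes U: "U \<subseteq> carrier G" "\<one> \<in> U" and LU: "L \<subseteq> reach U"
    and k: "k \<in> reach U" and s: "s \<in> S" "s' \<in> S" "s \<noteq> s'"
    and f: "f = k \<otimes> gen s' [^] (i::int)"
    and safe: "\<And>u. u \<in> U \<Longrightarrow> L #> u \<noteq> L #> f"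
  shows "\<not> depends_on G L (f \<otimes> gen s \<otimes> inv f)"
proof -
  have kG [simp]: "k \<in> carrier G" using k U reach_carrier by auto
  have fG [simp]: "f \<in> carrier G" using f s by auto
  \<comment> \<open>For \<open>s\<close>, the points over the coset of \<open>f\<close> form a
    separate copy of \<open>Q\<close> on which \<open>s\<close> multiplies by \<open>x\<close>; the
    factor \<open>emb (inv f)\<close> makes \<open>x\<close> appear to the left of
    \<open>f\<close>.\<close>
  define pl :: "'a \<Rightarrow> 'a coset_point \<Rightarrow>
      'a coset_point + 'a xword"
    where "pl r z = (if r = s \<and> snd z = L #> f then Inr (fst z \<odot> emb (inv f)) else Inl z)" for r z
  define \<alpha> :: "'a \<Rightarrow> 'a coset_point + 'a xword \<Rightarrow>
      'a coset_point + 'a xword"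
    where "\<alpha> r = map_sum (shift r) (\<lambda>q. if q \<in> carrier Q then q \<odot> var else q)" for r
  have bij\<alpha>: "bij (\<alpha> r)" for r
  proof -
    have "bij (\<lambda>q. if q \<in> carrier Q then q \<odot> var else q)"
      by (intro o_bij[of "\<lambda>q. if q \<in> carrier Q then q \<odot> inv\<^bsub>Q\<^esub> var else q"])
         (auto simp: fun_eq_iff Q.m_assoc)
    then show ?thesis unfolding \<alpha>_def by (rule bij_map_sum[OF bij_shift])
  qed
  let ?D = "carrier Q \<times> rcosets L"
  have ker: "\<forall>r t. \<forall>z\<in>?D. \<forall>z'\<in>?D. pl r z = pl r z' \<longrightarrow> pl t z = pl t z'"
    by (auto simp: pl_def split: if_splits)
  obtain \<pi> \<iota> where gl: "glued \<pi> \<iota> ?D pl \<alpha>"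
    using ex_glued[of \<alpha> ?D pl, OF bij\<alpha> ker] by blast
  note bij = glued_bij[OF gl] and \<iota> = glued_eq[OF gl] and move = glued_move[OF gl]
  have act\<alpha>: "act \<alpha> (gen r [^] (j::int)) (Inl z) = Inl (act shift (gen r [^] j) z)" if "r \<in> S" for r j z
    by (rule act_gen_pow_comm[where S = S, folded G_eq, where \<pi> = \<alpha> and \<alpha> = shift and \<beta> = Inl])
       (use bij\<alpha> bij_shift that in \<open>auto simp: \<alpha>_def\<close>)
  have mv: "act \<pi> (gen r [^] (j::int)) (\<iota> (q, L #> h)) =
      \<iota> (q \<odot> emb (gen r [^] j), L #> (h \<otimes> gen r [^] j))"
    if "r \<in> S" "q \<in> carrier Q" "h \<in> carrier G"
      "\<forall>q'. pl r (q', L #> h) = Inl (q', L #> h)"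
      "\<forall>q'. pl r (q', L #> (h \<otimes> gen r [^] j)) = Inl (q', L #> (h \<otimes> gen r [^] j))" for r q h j
    using that by (intro move) (auto simp: act_shift_pow act\<alpha>)
  have plU: "pl r (q, L #> u) = Inl (q, L #> u)" if "u \<in> U" for r q u
    using safe[OF that] by (auto simp: pl_def)
  have reach: "act \<pi> h (\<iota> (u, L #> \<one>)) = \<iota> (u \<odot> emb h, L #> h)"
    if "h \<in> reach U" "u \<in> carrier Q" for h u
    using that U plU by (intro act_reach[OF bij U] mv) auto
  have rU: "h \<in> U" if "h \<in> reach U" for h using that reach_subset[OF U(2)] by blast
  have actf: "act \<pi> f (\<iota> (u, L #> \<one>)) = \<iota> (u \<odot> emb f, L #> f)" if "u \<in> carrier Q" for u
  proof -
    have "act \<pi> f (\<iota> (u, L #> \<one>)) = act \<pi> (gen s' [^] i) (\<iota> (u \<odot> emb k, L #> k))"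
      using that k by (simp add: f act_mult[OF bij] reach)
    also have "\<dots> = \<iota> (u \<odot> emb k \<odot> emb (gen s' [^] i), L #> (k \<otimes> gen s' [^] i))"
      using that k s rU plU by (intro mv) (auto simp: pl_def simp flip: f)
    finally show ?thesis using that s by (simp add: Q.m_assoc f emb_mult)
  qed
  have acts: "act \<pi> (gen s) (\<iota> (u \<odot> emb f, L #> f)) = \<iota> (u \<odot> var \<odot> emb f, L #> f)"
    if "u \<in> carrier Q" for u
    using move[of s "(u \<odot> emb f, L #> f)" "(u \<odot> var \<odot> emb f, L #> f)" 1] that s
    by (simp add: pl_def \<alpha>_def Q.m_assoc)
  show ?thesis
  proof (rule independentI[where \<pi> = \<pi> and \<iota> = "\<lambda>u. \<iota> (u, L #> \<one>)", OF bij L])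
    fix u assume u: "u \<in> carrier Q"
    show "act \<pi> (f \<otimes> gen s \<otimes> inv f) (\<iota> (u, L #> \<one>)) = \<iota> (u \<odot> var, L #> \<one>)"
      using u actf[of u] acts[of u] act_m_inv[OF bij fG actf[of "u \<odot> var"]]
      unfolding act_mult[OF bij] by simp
    show "u = \<one>\<^bsub>Q\<^esub>" if "\<iota> (u, L #> \<one>) = \<iota> (\<one>\<^bsub>Q\<^esub>, L #> \<one>)"
      using that u \<iota>[of "(u, L #> \<one>)" "(\<one>\<^bsub>Q\<^esub>, L #> \<one>)" s] plU[OF U(2)] by auto
    show "act \<pi> l (\<iota> (u, L #> \<one>)) = \<iota> (u \<odot> emb l, L #> \<one>)" if "l \<in> L" for l
      using reach[of l u] that u LU rcoset_eqI[of l \<one>] by auto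
  qed (use s in auto)
qed

end

context group
begin

lemma mult_inv_cancel [simp]:
  assumes "x \<in> carrier G" "y \<in> carrier G"
  shows "x \<otimes> (inv x \<otimes> y) = y" "inv x \<otimes> (x \<otimes> y) = y"
  using assms by (simp_all flip: m_assoc)

end

context coset_words
begin

text \<open>The stabilizer condition says that the line of \<open>s\<close> through \<open>t\<close>
  is infinite in the coset space.\<close>

lemma line_coset_unique:
  assumes t: "t \<in> carrier G" and s: "s \<in> S"
    and stab: "\<And>k. k \<noteq> 0 \<Longrightarrow> t \<otimes> gen s [^] (k::int) \<otimes> inv t \<notin> L"
    and eq: "L #> (t \<otimes> gen s [^] (j::int)) = L #> (t \<otimes> gen s [^] (j'::int))"
  shows "j = j'"
proof (rule ccontr)
  assume ne: "j \<noteq> j'"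
  note g = gen_closed[OF s]
  obtain l where l: "l \<in> L" "t \<otimes> gen s [^] j = l \<otimes> (t \<otimes> gen s [^] j')"
    using eq t g by (subst (asm) rcoset_eq_iff) auto
  have "t \<otimes> gen s [^] (j - j') \<otimes> inv t = (t \<otimes> gen s [^] j) \<otimes> inv (t \<otimes> gen s [^] j')"
    using t g by (simp add: int_pow_diff inv_mult_group m_assoc)
  also have "\<dots> = l"
    using l t g by (simp add: m_assoc)
  finally show False using stab[of "j - j'"] ne l by simp
qed

text \<open>A path with a single step leaves no choice of generators: \<open>s\<close> itself must
  carry \<open>t1\<close> to \<open>t2\<close>. So the whole \<open>s\<close>-line of
  \<open>t2\<close> is laid over that of \<open>t1\<close>, displaced by \<open>i\<close>, for
  \<open>s\<close> only. Both lines are infinite and distinct, and by \<open>disj\<close> no two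
  points of \<open>T\<close> are laid upon each other.\<close>

lemma merge_lines:
  assumes T: "T \<subseteq> carrier G" "\<one> \<in> T" and LT: "\<And>l t. l \<in> L \<Longrightarrow> t \<in> T \<Longrightarrow> l \<otimes> t \<in> T"
    and TR: "T \<subseteq> reach T" and t: "t1 \<in> T" "t2 \<in> T" and s: "s \<in> S"
    and stab1: "\<And>k. k \<noteq> 0 \<Longrightarrow> t1 \<otimes> gen s [^] (k::int) \<otimes> inv t1 \<notin> L"
    and stab2: "\<And>k. k \<noteq> 0 \<Longrightarrow> t2 \<otimes> gen s [^] (k::int) \<otimes> inv t2 \<notin> L"
    and ne: "\<And>j. L #> t1 \<noteq> L #> (t2 \<otimes> gen s [^] (j::int))"
    and disj: "\<And>j. t2 \<otimes> gen s [^] (j::int) \<in> T \<Longrightarrow> t1 \<otimes> gen s [^] (i + j) \<notin> T"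
  shows "\<not> depends_on G L (t1 \<otimes> gen s [^] i \<otimes> inv t2)"
proof -
  have tG [simp]: "t1 \<in> carrier G" "t2 \<in> carrier G" and g [simp]: "gen s \<in> carrier G"
    using t T s by auto
  \<comment> \<open>Chosen so that weight \<open>x t2 s^j\<close> on the line of \<open>t2\<close>
    becomes weight \<open>t1 s^(i + j)\<close> on the line of \<open>t1\<close>.\<close>
  define X where "X j = inv\<^bsub>Q\<^esub> emb (t2 \<otimes> gen s [^] j) \<odot> (inv\<^bsub>Q\<^esub> var \<odot> emb (t1 \<otimes> gen s [^] (i + j)))" for j
  have X [simp]: "X j \<in> carrier Q" for j by (simp add: X_def)
  define on where "on M j \<longleftrightarrow> M = L #> (t2 \<otimes> gen s [^] (j::int))" for M j
  have on: "on (L #> (t2 \<otimes> gen s [^] j)) j' \<longleftrightarrow> j' = j" for j j'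
    using line_coset_unique[OF tG(2) s stab2] by (auto simp: on_def)
  define pl where "pl r z = (if r = s \<and> (\<exists>j. on (snd z) j)
    then let j = THE j. on (snd z) j in (fst z \<odot> X j, L #> (t1 \<otimes> gen s [^] (i + j))) else z)" for r z
  have pl_on: "pl s (q, L #> (t2 \<otimes> gen s [^] j)) = (q \<odot> X j, L #> (t1 \<otimes> gen s [^] (i + j)))" for q j
  proof -
    have "The (on (L #> (t2 \<otimes> gen s [^] j))) = j" by (rule the_equality) (simp_all add: on)
    then show ?thesis by (simp add: pl_def on)
  qed
  have pl_off: "pl r (q, M) = (q, M)" if "r \<noteq> s \<or> (\<forall>j::int. M \<noteq> L #> (t2 \<otimes> gen s [^] j))" for r q M
  proof -
    have "\<not> (r = s \<and> (\<exists>j. on M j))" using that unfolding on_def by blast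
    then show ?thesis unfolding pl_def by (subst if_not_P) auto
  qed
  \<comment> \<open>Only cosets inside \<open>T\<close> are kept: the other generators identify
    nothing, so \<open>s\<close> must not either, and this is known on \<open>T\<close>
    only.\<close>
  let ?D = "carrier Q \<times> (\<lambda>t. L #> t) ` T"
  have coset_T: "h \<in> T" if "h \<in> carrier G" "L #> h = L #> t" "t \<in> T" for h t
    using that LT T by (subst (asm) rcoset_eq_iff) auto
  have inj: "inj_on (pl r) ?D" for r
  proof (rule inj_onI, clarsimp)
    fix q t q' t'
    assume q: "q \<in> carrier Q" "q' \<in> carrier Q" and t: "t \<in> T" "t' \<in> T" and eq: "pl r (q, L #> t) = pl r (q', L #> t')"
    consider "r \<noteq> s \<or> (\<forall>j. \<not> on (L #> t) j) \<and> (\<forall>j. \<not> on (L #> t') j)"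
      | j where "r = s" "on (L #> t) j" "\<forall>j. \<not> on (L #> t') j"
      | j where "r = s" "on (L #> t') j" "\<forall>j. \<not> on (L #> t) j"
      | j j' where "r = s" "on (L #> t) j" "on (L #> t') j'" by metis
    then show "q = q' \<and> L #> t = L #> t'"
    proof cases
      case 1
      then show ?thesis using eq by (auto simp: pl_off on_def)
    next
      case 2
      then have "L #> (t1 \<otimes> gen s [^] (i + j)) = L #> t'" "t2 \<otimes> gen s [^] j \<in> T"
        using eq pl_on[of q j] pl_off[of r L q'] coset_T[of "t2 \<otimes> gen s [^] j" t] t
        by (auto simp: on_def pl_off)
      then show ?thesis using disj coset_T[of "t1 \<otimes> gen s [^] (i + j)" t'] t by auto
    next
      case 3
      then have "L #> (t1 \<otimes> gen s [^] (i + j)) = L #> t" "t2 \<otimes> gen s [^] j \<in> T"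
        using eq pl_on[of q' j] coset_T[of "t2 \<otimes> gen s [^] j" t'] t
        by (auto simp: on_def pl_off)
      then show ?thesis using disj coset_T[of "t1 \<otimes> gen s [^] (i + j)" t] t by auto
    next
      case 4
      then have M: "L #> t = L #> (t2 \<otimes> gen s [^] j)" "L #> t' = L #> (t2 \<otimes> gen s [^] j')"
        by (auto simp: on_def)
      then have *: "q \<odot> X j = q' \<odot> X j'"
        "L #> (t1 \<otimes> gen s [^] (i + j)) = L #> (t1 \<otimes> gen s [^] (i + j'))"
        using eq \<open>r = s\<close> by (auto simp: pl_on)
      then have "j = j'" using line_coset_unique[OF tG(1) s stab1 *(2)] by simp
      then show ?thesis using * M q by simp
    qed
  qed
  have ker: "\<forall>r t. \<forall>z\<in>?D. \<forall>z'\<in>?D. pl r z = pl r z' \<longrightarrow> pl t z = pl t z'"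
  proof (intro allI ballI impI)
    fix r t z z' assume z: "z \<in> ?D" "z' \<in> ?D" "pl r z = pl r z'"
    then have "z = z'" by (intro inj_onD[OF inj z(3)])
    then show "pl t z = pl t z'" by simp
  qed
  obtain \<pi> \<iota> where gl: "glued \<pi> \<iota> ?D pl shift"
    using ex_glued[of shift ?D pl, OF bij_shift ker] by blast
  note bij = glued_bij[OF gl] and \<iota> = glued_eq[OF gl] and move = glued_move[OF gl]
  have inj\<iota>: "inj_on \<iota> ?D"
    using \<iota> inj_onD[OF inj] by (intro inj_onI) metis
  have X_shift: "X j \<odot> emb (gen s [^] n) = emb (gen s [^] n) \<odot> X (j + n)" for j n
  proof -
    define e where "e = emb (gen s [^] n)"
    have e: "e \<in> carrier Q" by (simp add: e_def)
    have "t2 \<otimes> gen s [^] (j + n) = (t2 \<otimes> gen s [^] j) \<otimes> gen s [^] n"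
      "t1 \<otimes> gen s [^] (i + (j + n)) = (t1 \<otimes> gen s [^] (i + j)) \<otimes> gen s [^] n"
      by (simp_all add: int_pow_mult m_assoc)
    then have "emb (t2 \<otimes> gen s [^] (j + n)) = emb (t2 \<otimes> gen s [^] j) \<odot> e"
      "emb (t1 \<otimes> gen s [^] (i + (j + n))) = emb (t1 \<otimes> gen s [^] (i + j)) \<odot> e"
      by (simp_all only: e_def) (rule emb_mult; simp)+
    then show ?thesis
      unfolding X_def e_def[symmetric] using e by (simp add: Q.inv_mult_group Q.m_assoc)
  qed
  have mv: "act \<pi> (gen r [^] (n::int)) (\<iota> (q, L #> k)) = \<iota> (q \<odot> emb (gen r [^] n), L #> (k \<otimes> gen r [^] n))"
    if r: "r \<in> S" "k \<in> T" "k \<otimes> gen r [^] n \<in> T" and q: "q \<in> carrier Q" for r k n q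
  proof (rule move)
    have k: "k \<in> carrier G" using r T by auto
    have gr [simp]: "gen r \<in> carrier G" using r by simp
    show "act shift (gen r [^] n) (pl r (q, L #> k)) = pl r (q \<odot> emb (gen r [^] n), L #> (k \<otimes> gen r [^] n))"
    proof (cases "r = s \<and> (\<exists>j::int. L #> k = L #> (t2 \<otimes> gen s [^] j))")
      case True
      then obtain j :: int where j: "L #> k = L #> (t2 \<otimes> gen s [^] j)" by blast
      have "L #> (k \<otimes> gen s [^] n) = (L #> k) #> gen s [^] n" using k by simp
      also have "\<dots> = L #> (t2 \<otimes> gen s [^] (j + n))"
        by (simp add: j int_pow_mult m_assoc)
      finally have "L #> (k \<otimes> gen s [^] n) = L #> (t2 \<otimes> gen s [^] (j + n))" .
      moreover have "t1 \<otimes> gen s [^] (i + j) \<otimes> gen s [^] n = t1 \<otimes> gen s [^] (i + (j + n))"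
        by (simp add: int_pow_mult m_assoc)
      ultimately show ?thesis
        using True j q s by (simp add: pl_on act_shift_pow Q.m_assoc X_shift)
    next
      case False
      have "r = s \<and> (\<exists>j::int. L #> k = L #> (t2 \<otimes> gen s [^] j))"
        if "r = s" "L #> (k \<otimes> gen r [^] n) = L #> (t2 \<otimes> gen s [^] j)" for j :: int
      proof -
        have "L #> k = (L #> (k \<otimes> gen s [^] n)) #> gen s [^] (- n)"
          using k by (simp add: m_assoc int_pow_neg)
        also have "\<dots> = L #> (t2 \<otimes> gen s [^] (j - n))"
          using that by (simp add: m_assoc int_pow_diff int_pow_neg)
        finally show ?thesis using that by blast
      qed
      then show ?thesis
        using False q r k by (subst (1 2) pl_off) (auto simp: act_shift_pow)
    qed
  qed (use that T in auto)
  have reach: "act \<pi> h (\<iota> (u, L #> \<one>)) = \<iota> (u \<odot> emb h, L #> h)"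
    if "h \<in> T" "u \<in> carrier Q" for h u
    using that TR by (intro act_reach[OF bij T] mv) auto
  show ?thesis
  proof (rule independentI[where \<pi> = \<pi> and \<iota> = "\<lambda>u. \<iota> (u, L #> \<one>)", OF bij L])
    fix u assume u: "u \<in> carrier Q"
    have "act \<pi> (gen s [^] i) (\<iota> (u \<odot> emb t1, L #> t1)) = \<iota> (u \<odot> var \<odot> emb t2, L #> t2)"
    proof (rule move)
      have "pl s (u \<odot> var \<odot> emb t2, L #> t2) = (u \<odot> var \<odot> emb t2 \<odot> X 0, L #> (t1 \<otimes> gen s [^] i))"
        using pl_on[of _ 0] by simp
      also have "u \<odot> var \<odot> emb t2 \<odot> X 0 = u \<odot> emb t1 \<odot> emb (gen s [^] i)"
        using u by (simp add: X_def Q.m_assoc emb_mult)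
      finally show "act shift (gen s [^] i) (pl s (u \<odot> emb t1, L #> t1)) =
          pl s (u \<odot> var \<odot> emb t2, L #> t2)"
        using u s ne by (subst pl_off) (auto simp: act_shift_pow)
    qed (use u s t in auto)
    then show "act \<pi> (t1 \<otimes> gen s [^] i \<otimes> inv t2) (\<iota> (u, L #> \<one>)) = \<iota> (u \<odot> var, L #> \<one>)"
      using u t reach[of t1 u] act_m_inv[OF bij tG(2) reach[of t2 "u \<odot> var"]]
      unfolding act_mult[OF bij] by simp
    show "u = \<one>\<^bsub>Q\<^esub>" if "\<iota> (u, L #> \<one>) = \<iota> (\<one>\<^bsub>Q\<^esub>, L #> \<one>)"
      using inj_onD[OF inj\<iota> that] u T by auto
    show "act \<pi> l (\<iota> (u, L #> \<one>)) = \<iota> (u \<odot> emb l, L #> \<one>)" if "l \<in> L" for l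
      using reach[of l u] that u LT[of l \<one>] T rcoset_eqI[of l \<one>] by auto
  qed auto
qed

section \<open>Shortest paths from a core of the coset space\<close>

fun ball :: "'a letter list set \<Rightarrow> nat \<Rightarrow> 'a letter list set" where
  "ball T 0 = T"
| "ball T (Suc n) = {k \<otimes> gen s [^] (i::int) | k s i. k \<in> ball T n \<and> s \<in> S}"

lemma ball_carrier: "T \<subseteq> carrier G \<Longrightarrow> ball T n \<subseteq> carrier G"
  by (induction n) auto

lemma ball_carrierD: "T \<subseteq> carrier G \<Longrightarrow> k \<in> ball T n \<Longrightarrow> k \<in> carrier G"
  using ball_carrier by blast

lemma ball_Suc:
  assumes "T \<subseteq> carrier G" "S \<noteq> {}"
  shows "ball T n \<subseteq> ball T (Suc n)"
proof
  fix k assume k: "k \<in> ball T n"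
  obtain s where "s \<in> S" using assms by blast
  moreover have "k = k \<otimes> gen s [^] (0::int)" using ball_carrierD[OF assms(1) k] by simp
  ultimately show "k \<in> ball T (Suc n)" using k by (simp only: ball.simps) blast
qed

lemma ball_mono:
  assumes "T \<subseteq> carrier G" "S \<noteq> {}" "m \<le> n"
  shows "ball T m \<subseteq> ball T n"
  using assms(3) by (induction rule: dec_induct) (use ball_Suc[OF assms(1,2)] in blast)+

lemma ball_mult_left:
  assumes "T \<subseteq> carrier G" "\<And>l t. l \<in> L \<Longrightarrow> t \<in> T \<Longrightarrow> l \<otimes> t \<in> T" "l \<in> L" "k \<in> ball T n"
  shows "l \<otimes> k \<in> ball T n"
  using assms(4)
proof (induction n arbitrary: k)
  case (Suc n)
  then obtain k' s and i :: int where k: "k = k' \<otimes> gen s [^] i" "k' \<in> ball T n" "s \<in> S" by auto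
  then have "l \<otimes> k = (l \<otimes> k') \<otimes> gen s [^] i"
    using ball_carrierD[OF assms(1), of k' n] assms(3) by (auto simp: m_assoc)
  then show ?case using k Suc.IH[of k'] by (simp only: ball.simps) blast
qed (use assms in simp)

lemma ball_reach:
  assumes "T \<subseteq> carrier G" "S \<noteq> {}" "T \<subseteq> reach T"
  shows "ball T n \<subseteq> reach (ball T n)"
proof (induction n)
  case (Suc n)
  show ?case
  proof
    fix k assume "k \<in> ball T (Suc n)"
    then obtain k' s and i :: int where k: "k = k' \<otimes> gen s [^] i" "k' \<in> ball T n" "s \<in> S" by auto
    then have "k' \<in> reach (ball T (Suc n))"
      using Suc reach_mono[OF ball_Suc[OF assms(1,2), of n]] by blast
    moreover have "k' \<otimes> gen s [^] i \<in> ball T (Suc n)" using k by (simp only: ball.simps) blast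
    ultimately show "k \<in> reach (ball T (Suc n))" using k reach.step by blast
  qed
qed (use assms in simp)

lemma ex_ball:
  assumes "T \<subseteq> carrier G" "\<one> \<in> T" "g \<in> carrier G"
  shows "\<exists>n. g \<in> ball T n"
proof -
  have "\<exists>m. k \<otimes> g \<in> ball T m" if "k \<in> ball T n" for k n
    using assms(3) that
  proof (induction g arbitrary: k n rule: G_induct)
    case one
    then show ?case using ball_carrierD[OF assms(1), of k n] by (auto intro!: exI[of _ n])
  next
    case (gen s i w)
    have "k \<otimes> gen s [^] i \<in> ball T (Suc n)" using gen by (simp only: ball.simps) blast
    from gen(3)[OF this] show ?case
      using gen ball_carrier[OF assms(1), of n] by (auto simp: m_assoc subset_iff)
  qed
  from this[of \<one> 0] show ?thesis using assms by simp
qed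

end

lemma (in group) int_pow_conjugate:
  assumes f: "f \<in> carrier G" and x: "x \<in> carrier G"
  shows "f \<otimes> x [^] (j::int) \<otimes> inv f = (f \<otimes> x \<otimes> inv f) [^] j"
proof -
  interpret c: group_hom G G "\<lambda>x. f \<otimes> x \<otimes> inv f"
    using f by unfold_locales (auto simp: hom_def m_assoc)
  show ?thesis using c.hom_int_pow[OF x] .
qed

context coset_words
begin

text \<open>\<open>T\<close> is the core, a connected union of cosets of \<open>L\<close>, and paths
  lead from \<open>T\<close> to \<open>g T\<close>. With at least two steps, the middle of a
  shortest path can be altered away from the core whatever \<open>L\<close> is. The hypotheses
  \<open>points\<close> and \<open>lines\<close> take care of zero and one step. The larger group
  \<open>N\<close> makes room for elements near the core that do depend on \<open>L\<close>.\<close>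

theorem dependent_mem:
  assumes N: "subgroup N G" "L \<subseteq> N"
    and T: "T \<subseteq> carrier G" "\<one> \<in> T" and LT: "\<And>l t. l \<in> L \<Longrightarrow> t \<in> T \<Longrightarrow> l \<otimes> t \<in> T"
    and TR: "T \<subseteq> reach T"
    and points: "\<And>t1 t2. t1 \<in> T \<Longrightarrow> t2 \<in> T \<Longrightarrow> depends_on G L (t1 \<otimes> inv t2) \<Longrightarrow> t1 \<otimes> inv t2 \<in> N"
    and lines: "\<And>s. s \<in> S \<Longrightarrow>
      (\<forall>t1\<in>T. \<forall>t2\<in>T. \<forall>i::int. t1 \<otimes> gen s [^] i \<otimes> inv t2 \<in> N) \<or>
      (\<forall>t\<in>T. \<not> depends_on G L (t \<otimes> gen s \<otimes> inv t))"
    and g: "g \<in> carrier G" and dep: "depends_on G L g"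
  shows "g \<in> N"
proof (cases "S = {}")
  case True
  then have "carrier G = {[]}" by (auto simp: G_eq free_group_def)
  then show ?thesis using g subgroup.one_closed[OF N(1)] by (simp add: one_G)
next
  case False
  note mono = ball_mono[OF T(1) False]
  note ballG = ball_carrierD[OF T(1)]
  have Suc_I: "k \<otimes> gen s [^] (i::int) \<in> ball T (Suc n)" if "k \<in> ball T n" "s \<in> S" for k n s i
    using that by (simp only: ball.simps) blast
  \<comment> \<open>\<open>g\<close> carries a point within distance \<open>k\<close> of
    \<open>T\<close> to one within distance \<open>i\<close>. Where the path is cut is immaterial:
    only \<open>i + k\<close> counts.\<close>
  define W where "W i k \<longleftrightarrow> (\<exists>f f'. f \<in> ball T i \<and> f' \<in> ball T k \<and> g = f \<otimes> inv f')" for i k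
  have shift_right: "W (Suc i) k" if "W i (Suc k)" for i k
  proof -
    obtain f f' s and j :: int where f: "f \<in> ball T i" "f' \<in> ball T k" "s \<in> S" "g = f \<otimes> inv (f' \<otimes> gen s [^] j)"
      using \<open>W i (Suc k)\<close> by (auto simp: W_def)
    then have "g = (f \<otimes> gen s [^] (- j)) \<otimes> inv f'"
      using ballG[of f i] ballG[of f' k] by (simp add: inv_mult_group int_pow_neg m_assoc)
    then show ?thesis
      unfolding W_def using Suc_I[OF f(1,3), of "- j"] f(2) by (intro exI conjI)
  qed
  have shift_left: "W i (Suc k)" if "W (Suc i) k" for i k
  proof -
    obtain f f' s and j :: int where f: "f \<in> ball T i" "f' \<in> ball T k" "s \<in> S" "g = (f \<otimes> gen s [^] j) \<otimes> inv f'"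
      using \<open>W (Suc i) k\<close> by (auto simp: W_def)
    then have "g = f \<otimes> inv (f' \<otimes> gen s [^] (- j))"
      using ballG[of f i] ballG[of f' k] by (simp add: inv_mult_group int_pow_neg m_assoc)
    then show ?thesis
      unfolding W_def using Suc_I[OF f(2,3), of "- j"] f(1) by (intro exI conjI)
  qed
  have balance: "W i k \<longleftrightarrow> W (i + k) 0" for i k
  proof (induction k arbitrary: i)
    case (Suc k)
    then show ?case using shift_right shift_left by (metis add_Suc add_Suc_right)
  qed simp
  obtain n where "g \<in> ball T n" using ex_ball[OF T g] by blast
  then have "W n 0" unfolding W_def using T g by (intro exI[of _ g] exI[of _ \<one>]) simp
  define m where "m = (LEAST m. W m 0)"
  have m: "W i k" if "i + k = m" for i k
    unfolding balance[of i k] that m_def by (rule LeastI[of _ n]) fact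
  have minimal: "\<not> W i k" if "i + k < m" for i k
    unfolding balance[of i k] using that not_less_Least unfolding m_def by blast
  have not_both: False if "f \<in> ball T i" "f' \<in> ball T k" "g = f \<otimes> inv f'" "i + k < m" for f f' i k
    using minimal[of i k] that by (auto simp: W_def)
  have LN: "l \<in> N" if "l \<in> L" for l using that N by blast
  have same_coset: "g \<in> L" if "f \<in> carrier G" "f' \<in> carrier G" "g = f \<otimes> inv f'" "L #> f = L #> f'" for f f'
    using that by (auto simp: rcoset_eq_iff m_assoc)
  \<comment> \<open>When both ends share a coset, \<open>g\<close> is a power of a conjugate of
    \<open>gen s\<close> up to a factor in \<open>L\<close>, and dependence passes to the conjugate
    itself.\<close>
  have conj: "g \<in> L \<or> depends_on G L (f \<otimes> gen s \<otimes> inv f)"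
    if f: "f \<in> carrier G" "f' \<in> carrier G" "g = f \<otimes> gen s [^] (j::int) \<otimes> inv f'" "L #> f = L #> f'" "s \<in> S" for f f' s j
  proof (cases "j = 0")
    case True
    then show ?thesis using same_coset[of f f'] f by simp
  next
    case False
    have gs [simp]: "gen s \<in> carrier G" using f by simp
    obtain l where l: "l \<in> L" "f' = l \<otimes> f" using f rcoset_eq_iff[of f' f] by auto
    have g_eq: "g = f \<otimes> gen s [^] j \<otimes> inv f \<otimes> inv l"
      using f l by (simp add: inv_mult_group m_assoc)
    have "inv l \<in> L" using l L by (simp add: subgroup.m_inv_closed)
    then have "depends_on G L (f \<otimes> gen s [^] j \<otimes> inv f)"
      using dep L.depends_on_mult_right[of "f \<otimes> gen s [^] j \<otimes> inv f" "inv l"] f by (simp add: g_eq)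
    moreover have "f \<otimes> gen s [^] j \<otimes> inv f = (f \<otimes> gen s \<otimes> inv f) [^] j"
      using int_pow_conjugate[of f "gen s" j] f by simp
    ultimately show ?thesis
      using L.depends_on_root[of "f \<otimes> gen s \<otimes> inv f" j] f False by auto
  qed
  note UG = ball_carrier[OF T(1)]
  have U1: "\<one> \<in> ball T n" for n using mono[of 0 n] T by auto
  have UL: "L \<subseteq> reach (ball T n)" for n
  proof
    fix l assume "l \<in> L"
    then have "l \<in> T" using LT[of l \<one>] T by simp
    then show "l \<in> reach (ball T n)" using ball_reach[OF T(1) False TR, of 0] reach_mono[OF mono[of 0 n]] by auto
  qed
  \<comment> \<open>By minimality of \<open>m\<close>, the end of a half path is not in the coset of
    any point closer to the core.\<close>
  have far: "L #> u \<noteq> L #> f" if "u \<in> ball T i" "f \<in> ball T j" "f' \<in> ball T k" "g = f \<otimes> inv f' \<or> g = f' \<otimes> inv f" "i + k < m" for u f f' i j k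
  proof
    assume eq: "L #> u = L #> f"
    have G: "u \<in> carrier G" "f \<in> carrier G" "f' \<in> carrier G" using that ballG by blast+
    then obtain l where l: "l \<in> L" "f = l \<otimes> u" using rcoset_eq_iff[of f u] eq by auto
    then have "f \<in> ball T i" using ball_mult_left[OF T(1) LT] that by simp
    then show False using that not_both[of f i f' k] not_both[of f' k f i] by auto
  qed
  consider "m = 0" | "m = 1" | d where "m = 2 * Suc d" | d where "m = 2 * Suc d + 1"
  proof (cases "even m")
    case True
    then show ?thesis using that(1,3) by (metis dvdE mult_0_right not0_implies_Suc)
  next
    case False
    then show ?thesis using that(2,4) by (metis oddE mult_0_right add_0 not0_implies_Suc)
  qed
  then show ?thesis
  proof cases
    case 1
    then obtain t1 t2 where "t1 \<in> T" "t2 \<in> T" "g = t1 \<otimes> inv t2" using m[of 0 0] by (auto simp: W_def)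
    then show ?thesis using points dep by blast
  next
    case 2
    then obtain t1 t2 s and i :: int where t: "t1 \<in> T" "t2 \<in> T" "s \<in> S" "g = t1 \<otimes> gen s [^] i \<otimes> inv t2"
      using m[of 1 0] by (auto simp: W_def)
    show ?thesis
    proof (cases "\<forall>t\<in>T. \<not> depends_on G L (t \<otimes> gen s \<otimes> inv t)")
      case False
      then show ?thesis using lines[OF t(3)] t by blast
    next
      case ell: True
      have G: "t1 \<in> carrier G" "t2 \<in> carrier G" and gs [simp]: "gen s \<in> carrier G" using t T by auto
      have stab: "t \<otimes> gen s [^] k \<otimes> inv t \<notin> L" if "t \<in> T" "k \<noteq> 0" for t and k :: int
      proof
        have tG: "t \<in> carrier G" using that T by blast
        assume "t \<otimes> gen s [^] k \<otimes> inv t \<in> L"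
        then have "depends_on G L ((t \<otimes> gen s \<otimes> inv t) [^] k)"
          using int_pow_conjugate[of t "gen s" k] tG L.depends_on_mem by simp
        then show False
          using L.depends_on_root[of "t \<otimes> gen s \<otimes> inv t" k] that tG ell by simp
      qed
      show ?thesis
      proof (cases "\<exists>j::int. L #> t1 = L #> (t2 \<otimes> gen s [^] j)")
        case True
        then obtain j :: int where "L #> t1 = L #> (t2 \<otimes> gen s [^] j)" ..
        then obtain l where l: "l \<in> L" "t1 = l \<otimes> (t2 \<otimes> gen s [^] j)" using G by (subst (asm) rcoset_eq_iff) auto
        have "L #> (l \<otimes> t2) = L #> t2" using l G rcoset_eqI by simp
        moreover have "g = (l \<otimes> t2) \<otimes> gen s [^] (j + i) \<otimes> inv t2"
          using l G by (simp add: t int_pow_mult m_assoc)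
        ultimately have "g \<in> L \<or> depends_on G L ((l \<otimes> t2) \<otimes> gen s \<otimes> inv (l \<otimes> t2))"
          using conj[of "l \<otimes> t2" t2 s "j + i"] G l t by simp
        then show ?thesis using ell LT l t LN by blast
      next
        case False
        \<comment> \<open>Two points of \<open>T\<close> meeting on the superposed lines would give
          a path with no step at all, against \<open>m = 1\<close>.\<close>
        have "\<not> depends_on G L g"
          unfolding t(4)
        proof (rule merge_lines[OF T LT TR t(1-3)])
          fix j :: int assume j: "t2 \<otimes> gen s [^] j \<in> T"
          show "t1 \<otimes> gen s [^] (i + j) \<notin> T"
          proof
            assume "t1 \<otimes> gen s [^] (i + j) \<in> T"
            moreover have "g = (t1 \<otimes> gen s [^] (i + j)) \<otimes> inv (t2 \<otimes> gen s [^] j)"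
              using G by (simp add: t int_pow_mult inv_mult_group m_assoc)
            ultimately show False using not_both[of _ 0 _ 0] j 2 by auto
          qed
        qed (use False stab t in auto)
        then show ?thesis using dep by simp
      qed
    qed
  next
    case (3 d)
    then obtain f f' where f: "f \<in> ball T (Suc d)" "f' \<in> ball T (Suc d)" "g = f \<otimes> inv f'"
      using m[of "Suc d" "Suc d"] by (auto simp: W_def simp del: ball.simps)
    obtain k s and i :: int where k: "k \<in> ball T d" "s \<in> S" "f = k \<otimes> gen s [^] i" using f(1) by auto
    obtain k' s' and i' :: int where k': "k' \<in> ball T d" "s' \<in> S" "f' = k' \<otimes> gen s' [^] i'" using f(2) by auto
    have G: "k \<in> carrier G" "k' \<in> carrier G" "f \<in> carrier G" "f' \<in> carrier G" using f k k' ballG by blast+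
    \<comment> \<open>Equal last syllables would combine into one and shorten the path.\<close>
    have "s \<noteq> s'"
    proof
      assume "s = s'"
      then have "g = (k \<otimes> gen s [^] (i - i')) \<otimes> inv k'"
        using G k k' f(3) by (simp add: inv_mult_group int_pow_diff m_assoc)
      from not_both[OF Suc_I[OF k(1,2)] k'(1) this] 3 show False by simp
    qed
    show ?thesis
    proof (cases "L #> f = L #> f'")
      case True
      then show ?thesis using same_coset[OF G(3,4) f(3)] LN by blast
    next
      case False
      have "\<not> depends_on G L g"
        unfolding f(3)
      proof (rule merge_points[where U = "ball T d" and k = k and k' = k' and s = s and s' = s' and i = i and i' = i'])
        show "L #> u \<noteq> L #> f \<and> L #> u \<noteq> L #> f'" if "u \<in> ball T d" for u
          using far[OF that f(1,2)] far[OF that f(2,1)] f(3) 3 by simp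
      qed (use k k' \<open>s \<noteq> s'\<close> False UG U1 UL ball_reach[OF T(1) \<open>S \<noteq> {}\<close> TR] in blast)+
      then show ?thesis using dep by simp
    qed
  next
    case (4 d)
    then obtain f f' where f: "f \<in> ball T (Suc (Suc d))" "f' \<in> ball T (Suc d)" "g = f \<otimes> inv f'"
      using m[of "Suc (Suc d)" "Suc d"] by (auto simp: W_def simp del: ball.simps)
    obtain k s and i :: int where k: "k \<in> ball T (Suc d)" "s \<in> S" "f = k \<otimes> gen s [^] i"
      using f(1)[unfolded ball.simps(2)[of T "Suc d"]] by blast
    obtain h s'' and j :: int where h: "h \<in> ball T d" "s'' \<in> S" "k = h \<otimes> gen s'' [^] j" using k(1) by auto
    obtain k' s' and i' :: int where k': "k' \<in> ball T d" "s' \<in> S" "f' = k' \<otimes> gen s' [^] i'" using f(2) by auto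
    have G: "k \<in> carrier G" "k' \<in> carrier G" "f \<in> carrier G" "f' \<in> carrier G" "h \<in> carrier G"
      using f k k' h ballG by blast+
    have "s \<noteq> s'"
    proof
      assume "s = s'"
      then have "g = (k \<otimes> gen s [^] (i - i')) \<otimes> inv k'"
        using G k k' f(3) by (simp add: inv_mult_group int_pow_diff m_assoc)
      from not_both[OF Suc_I[OF k(1,2)] k'(1) this] 4 show False by simp
    qed
    have "s \<noteq> s''"
    proof
      assume "s = s''"
      then have "g = (h \<otimes> gen s [^] (j + i)) \<otimes> inv f'"
        using G k h f(3) by (simp add: int_pow_mult m_assoc)
      from not_both[OF Suc_I[OF h(1) k(2)] f(2) this] 4 show False by simp
    qed
    have gk: "g = k \<otimes> inv (f' \<otimes> gen s [^] (- i))"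
      using G k f(3) by (simp add: inv_mult_group int_pow_neg m_assoc)
    have far_k: "L #> u \<noteq> L #> k" if "u \<in> ball T d" for u
      using far[OF that k(1) Suc_I[OF f(2) k(2)] disjI1[OF gk]] 4 by simp
    show ?thesis
    \<comment> \<open>The middle step leads from \<open>k\<close> to \<open>f\<close>. If
      \<open>k\<close> and \<open>f'\<close> share a coset, it amounts to a conjugate of a power of
      \<open>gen s\<close>; otherwise \<open>k\<close> joins the safe set and \<open>f\<close>,
      \<open>f'\<close> are merged as for even \<open>m\<close>, unless they already share a
      coset.\<close>
    proof (cases "L #> k = L #> f'")
      case True
      have "\<not> depends_on G L (k \<otimes> gen s \<otimes> inv k)"
        by (rule elliptic_point[where U = "ball T d" and k = h and s' = s'' and i = j])
           (use far_k h k \<open>s \<noteq> s''\<close> UG U1 UL ball_reach[OF T(1) \<open>S \<noteq> {}\<close> TR] in blast)+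
      moreover have "g = k \<otimes> gen s [^] i \<otimes> inv f'" using f k by simp
      ultimately show ?thesis using conj[OF G(1,4) _ True k(2)] LN by blast
    next
      case k_f': False
      show ?thesis
      proof (cases "L #> f = L #> f'")
        case True
        then show ?thesis using same_coset[OF G(3,4) f(3)] LN by blast
      next
        case False
        let ?U = "ball T d \<union> {k}"
        have kU: "k \<in> reach ?U" and k'U: "k' \<in> reach ?U"
          using h k' ball_reach[OF T(1) \<open>S \<noteq> {}\<close> TR, of d] reach_mono[of "ball T d" ?U]
          by (auto intro!: reach.step)
        have "\<not> depends_on G L g"
          unfolding f(3)
        proof (rule merge_points[where U = ?U and k = k and k' = k' and s = s and s' = s' and i = i and i' = i'])
          show "L #> u \<noteq> L #> f \<and> L #> u \<noteq> L #> f'" if "u \<in> ?U" for u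
          proof (cases "u = k")
            case True
            then show ?thesis using far[OF k(1) f(1,2)] f(3) k_f' 4 by simp
          next
            case False
            then have u: "u \<in> ball T d" using that by simp
            then show ?thesis using far[OF u f(1,2)] far[OF u f(2,1)] f(3) 4 by simp
          qed
          show "L \<subseteq> reach ?U" using UL[of d] reach_mono[of "ball T d" ?U] by blast
        qed (use k k' \<open>s \<noteq> s'\<close> False UG[of d] U1 kU k'U G in blast)+
        then show ?thesis using dep by simp
      qed
    qed
  qed
qed

end

section \<open>Permutations made of weighted lines and cycles\<close>

lemma div_mod_step:
  fixes k N d :: int
  shows "k div N + (k mod N + d) div N = (k + d) div N" "(k mod N + d) mod N = (k + d) mod N"
proof -
  show "k div N + (k mod N + d) div N = (k + d) div N"
  proof (cases "N = 0")
    case False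
    then have "(k mod N + d + k div N * N) div N = k div N + (k mod N + d) div N"
      by (rule div_mult_self1)
    moreover have "k mod N + d + k div N * N = k + d"
      using mod_div_mult_eq[of k N] by linarith
    ultimately show ?thesis by simp
  qed simp
qed (simp add: mod_add_left_eq)

lemma div_eq_0_if_mod_eq: "(t::int) mod N = t \<Longrightarrow> t div N = 0"
  by (metis div_by_0 mod_div_trivial)

context free_words
begin

text \<open>
  Points are pairs of a weight \<open>u\<close> and a label \<open>z\<close>. The generator \<open>r\<close> moves \<open>(u, z)\<close> along a line
  of integers (\<open>N = 0\<close>, using \<open>k mod 0 = k\<close> and \<open>k div 0 = 0\<close>) or along a cycle of length \<open>N\<close>, and
  multiplies the weight by \<open>y\<close> on each round trip. The label \<open>z\<close> with weight \<open>u\<close> is identified with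
  the label \<open>rep z\<close> with weight \<open>u \<otimes> \<kappa> z\<close>.
\<close>

definition runs :: "('a \<Rightarrow> ('a, 'q \<times> 'l \<times> int) glue \<Rightarrow> ('a, 'q \<times> 'l \<times> int) glue) \<Rightarrow>
    ('q \<times> 'c \<Rightarrow> ('a, 'q \<times> 'l \<times> int) glue) \<Rightarrow> ('q, 'm) monoid_scheme \<Rightarrow> ('a \<Rightarrow> 'c \<Rightarrow> 'q) \<Rightarrow>
    ('a \<Rightarrow> 'c \<Rightarrow> 'l) \<Rightarrow> ('a \<Rightarrow> 'c \<Rightarrow> int) \<Rightarrow> ('a \<Rightarrow> 'l \<Rightarrow> int) \<Rightarrow> ('a \<Rightarrow> 'l \<Rightarrow> 'q) \<Rightarrow>
    ('c \<Rightarrow> 'c) \<Rightarrow> ('c \<Rightarrow> 'q) \<Rightarrow> bool" where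
  "runs \<pi> \<iota> M w lin th N y rep \<kappa> \<longleftrightarrow> (\<forall>r. bij (\<pi> r)) \<and>
    (\<forall>u\<in>carrier M. \<forall>u'\<in>carrier M. \<forall>z z'.
      \<iota> (u, z) = \<iota> (u', z') \<longleftrightarrow> rep z = rep z' \<and> u \<otimes>\<^bsub>M\<^esub> \<kappa> z = u' \<otimes>\<^bsub>M\<^esub> \<kappa> z') \<and>
    (\<forall>r\<in>S. \<forall>(k::int). \<forall>u\<in>carrier M. \<forall>u'\<in>carrier M. \<forall>z z'. lin r z = lin r z' \<longrightarrow>
      (th r z + k) mod N r (lin r z) = th r z' \<longrightarrow>
      u \<otimes>\<^bsub>M\<^esub> w r z \<otimes>\<^bsub>M\<^esub> y r (lin r z) [^]\<^bsub>M\<^esub> ((th r z + k) div N r (lin r z)) = u' \<otimes>\<^bsub>M\<^esub> w r z' \<longrightarrow>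
      act \<pi> (gen r [^] k) (\<iota> (u, z)) = \<iota> (u', z'))"

lemma
  assumes "runs \<pi> \<iota> M w lin th N y rep \<kappa>"
  shows runs_bij: "bij (\<pi> r)"
    and runs_eq: "u \<in> carrier M \<Longrightarrow> u' \<in> carrier M \<Longrightarrow>
      \<iota> (u, z) = \<iota> (u', z') \<longleftrightarrow> rep z = rep z' \<and> u \<otimes>\<^bsub>M\<^esub> \<kappa> z = u' \<otimes>\<^bsub>M\<^esub> \<kappa> z'"
    and runs_move: "r \<in> S \<Longrightarrow> u \<in> carrier M \<Longrightarrow> u' \<in> carrier M \<Longrightarrow> lin r z = lin r z' \<Longrightarrow>
      (th r z + k) mod N r (lin r z) = th r z' \<Longrightarrow>
      u \<otimes>\<^bsub>M\<^esub> w r z \<otimes>\<^bsub>M\<^esub> y r (lin r z) [^]\<^bsub>M\<^esub> ((th r z + k) div N r (lin r z)) = u' \<otimes>\<^bsub>M\<^esub> w r z' \<Longrightarrow>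
      act \<pi> (gen r [^] (k::int)) (\<iota> (u, z)) = \<iota> (u', z')"
  using assms unfolding runs_def by (simp_all only: simp_thms)

text \<open>Lines and cycles are free to choose for each generator; what ties the generators
  together is that they identify the same labels with the same factors, as recorded by
  \<open>rep\<close> and \<open>\<kappa>\<close>.\<close>

lemma automaton:
  fixes M :: "('q, 'm) monoid_scheme" and w :: "'a \<Rightarrow> 'c \<Rightarrow> 'q" and ln :: "'a \<Rightarrow> 'c \<Rightarrow> 'l"
    and th :: "'a \<Rightarrow> 'c \<Rightarrow> int" and N :: "'a \<Rightarrow> 'l \<Rightarrow> int" and y :: "'a \<Rightarrow> 'l \<Rightarrow> 'q"
    and rep :: "'c \<Rightarrow> 'c" and \<kappa> :: "'c \<Rightarrow> 'q"
  assumes M: "group M" and w: "\<And>r z. w r z \<in> carrier M" and y: "\<And>r l. y r l \<in> carrier M"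
    and \<kappa>: "\<And>z. \<kappa> z \<in> carrier M"
    and th: "\<And>r z. th r z mod N r (ln r z) = th r z"
    and rep: "\<And>r z. ln r (rep z) = ln r z" "\<And>r z. th r (rep z) = th r z"
      "\<And>r z. w r z = \<kappa> z \<otimes>\<^bsub>M\<^esub> w r (rep z)"
    and inj: "\<And>r. inj_on (\<lambda>z. (ln r z, th r z)) (range rep)"
  shows "\<exists>\<pi> \<iota>. runs \<pi> \<iota> M w ln th N y rep \<kappa>"
proof -
  interpret M: group M by (rule M)
  \<comment> \<open>The cycle is unrolled to the integers: place \<open>k\<close> is
    \<open>k mod N\<close> after \<open>k div N\<close> rounds, each with factor
    \<open>y\<close>.\<close>
  define orb where "orb r q l k =
    (q \<otimes>\<^bsub>M\<^esub> y r l [^]\<^bsub>M\<^esub> (k div N r l), l, k mod N r l)" for r q l and k :: int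
  define sh where "sh d r = (\<lambda>(q, l, t). if q \<in> carrier M \<and> t mod N r l = t
    then (q \<otimes>\<^bsub>M\<^esub> y r l [^]\<^bsub>M\<^esub> ((t + d) div N r l), l, (t + d) mod N r l) else (q, l, t))" for d r
  have sh_orb: "sh d r (orb r q l k) = orb r q l (k + d)" if "q \<in> carrier M" for d r q l k
    using that y[of r l] div_mod_step[of k "N r l" d]
    by (simp add: sh_def orb_def M.m_assoc flip: M.int_pow_mult)
  have orb_th: "orb r q l t = (q, l, t)" if "t mod N r l = t" "q \<in> carrier M" for r q l t
    using that by (simp add: orb_def div_eq_0_if_mod_eq)
  have sh_inv: "sh (- d) r (sh d r v) = v" for d r v
  proof -
    obtain q l t where v: "v = (q, l, t)" by (cases v) auto
    show ?thesis
    proof (cases "q \<in> carrier M \<and> t mod N r l = t")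
      case True
      then have "v = orb r q l t" using orb_th v by simp
      then show ?thesis using True by (simp add: sh_orb)
    qed (auto simp: v sh_def)
  qed
  have bij: "bij (sh 1 r)" for r
    using sh_inv[of 1 r] sh_inv[of "-1" r] by (intro o_bij[of "sh (- 1) r"]) auto
  let ?D = "carrier M \<times> (UNIV :: 'c set)"
  define pl where "pl r = (\<lambda>(u, z). (u \<otimes>\<^bsub>M\<^esub> w r z, ln r z, th r z))" for r
  have pl_eq: "pl r (u, z) = pl r (u', z') \<longleftrightarrow> rep z = rep z' \<and> u \<otimes>\<^bsub>M\<^esub> \<kappa> z = u' \<otimes>\<^bsub>M\<^esub> \<kappa> z'"
    if "u \<in> carrier M" "u' \<in> carrier M" for r u u' z z'
  proof -
    have "ln r z = ln r z' \<and> th r z = th r z' \<longleftrightarrow> rep z = rep z'"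
      using inj_onD[OF inj[of r], of "rep z" "rep z'"] rep(1,2) by (metis (mono_tags, lifting) rangeI)
    moreover have "u \<otimes>\<^bsub>M\<^esub> w r z = (u \<otimes>\<^bsub>M\<^esub> \<kappa> z) \<otimes>\<^bsub>M\<^esub> w r (rep z)"
      "u' \<otimes>\<^bsub>M\<^esub> w r z' = (u' \<otimes>\<^bsub>M\<^esub> \<kappa> z') \<otimes>\<^bsub>M\<^esub> w r (rep z')"
      using that \<kappa> w by (simp_all only: rep(3)[of r z] rep(3)[of r z'] M.m_assoc)
    ultimately show ?thesis
      using that \<kappa> w by (auto simp: pl_def simp del: M.right_cancel) (metis M.m_closed M.right_cancel)+
  qed
  have ker: "\<forall>r t. \<forall>z\<in>?D. \<forall>z'\<in>?D. pl r z = pl r z' \<longrightarrow> pl t z = pl t z'"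
    by (auto simp: pl_eq simp del: M.right_cancel)
  obtain \<pi> \<iota> where gl: "glued \<pi> \<iota> ?D pl (sh 1)"
    using ex_glued[of "sh 1" ?D pl, OF bij ker] by blast
  have "\<iota> (u, z) = \<iota> (u', z') \<longleftrightarrow> rep z = rep z' \<and> u \<otimes>\<^bsub>M\<^esub> \<kappa> z = u' \<otimes>\<^bsub>M\<^esub> \<kappa> z'"
    if "u \<in> carrier M" "u' \<in> carrier M" for u u' z z'
    using glued_eq[OF gl, of "(u, z)" "(u', z')"] pl_eq[OF that] that by auto
  moreover have "act \<pi> (gen r [^] k) (\<iota> (u, z)) = \<iota> (u', z')"
    if r: "r \<in> S" and u: "u \<in> carrier M" "u' \<in> carrier M" and ln: "ln r z = ln r z'"
      and t: "(th r z + k) mod N r (ln r z) = th r z'"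
      and eq: "u \<otimes>\<^bsub>M\<^esub> w r z \<otimes>\<^bsub>M\<^esub> y r (ln r z) [^]\<^bsub>M\<^esub> ((th r z + k) div N r (ln r z)) = u' \<otimes>\<^bsub>M\<^esub> w r z'"
    for r u u' z z' and k :: int
  proof (rule glued_move[OF gl r])
    let ?q = "u \<otimes>\<^bsub>M\<^esub> w r z"
    have q: "?q \<in> carrier M" using u w by simp
    have "pl r (u, z) = orb r ?q (ln r z) (th r z)"
      using orb_th[OF th q] by (simp add: pl_def)
    then have "act (sh 1) (gen r [^] k) (pl r (u, z)) = orb r ?q (ln r z) (th r z + k)"
      using act_gen_pow[of "sh 1" r "orb r ?q (ln r z)" k "th r z"] bij r sh_orb[OF q] by simp
    also have "\<dots> = pl r (u', z')"
      using t eq ln by (simp add: orb_def pl_def)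
    finally show "act (sh 1) (gen r [^] k) (pl r (u, z)) = pl r (u', z')" .
  qed (use u in auto)
  ultimately show ?thesis
    unfolding runs_def using glued_bij[OF gl]
    by (intro exI[of _ \<pi>] exI[of _ \<iota>] conjI ballI allI impI) simp_all
qed

end

section \<open>Words with four syllables\<close>

text \<open>
  The label \<open>W i\<close> stands for the prefix \<open>a\<^bsup>p i\<^esup> b\<^bsup>q i\<^esup>\<close> of the \<open>i\<close>-th word
  \<open>a\<^bsup>p i\<^esup> b\<^bsup>q i\<^esup> a\<^bsup>r i\<^esup> b\<^bsup>s i\<^esup>\<close>, and similarly \<open>B\<close>, \<open>X i\<close>, \<open>Z i\<close> for the prefixes with
  0, 1 and 3 syllables.
\<close>

datatype label = B | X nat | W nat | Z nat

text \<open>This is all that is used of the primes. The \<open>a\<close>-line through the base point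
  has the points 0 and \<open>p i\<close>, every other \<open>a\<close>-line has two points at
  distance \<open>r i\<close>; for \<open>b\<close> the roles are played by \<open>s\<close> and
  \<open>q\<close>. The relations \<open>pr\<close> and \<open>qs\<close> keep distances on these
  two kinds of lines apart.\<close>

locale syllable_words = free_words G "{a, b}" for G :: "'a letter list monoid" (structure) and a b :: 'a +
  fixes p q r s :: "nat \<Rightarrow> int"
  assumes ab: "a \<noteq> b"
    and pos: "0 < p i" "0 < q i" "0 < r i" "0 < s i"
    and inj: "p i = p j \<longleftrightarrow> i = j" "q i = q j \<longleftrightarrow> i = j" "r i = r j \<longleftrightarrow> i = j" "s i = s j \<longleftrightarrow> i = j"
    and pr: "r i \<noteq> p j" "p i + r j \<noteq> p k"
    and qs: "q i \<noteq> s j" "s i + q j \<noteq> s k"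
begin

abbreviation xa :: "int \<Rightarrow> 'a letter list" where "xa k \<equiv> gen a [^] k"
abbreviation xb :: "int \<Rightarrow> 'a letter list" where "xb k \<equiv> gen b [^] k"
abbreviation vp :: "int \<Rightarrow> 'a xword" where "vp k \<equiv> var [^]\<^bsub>Q\<^esub> k"

definition A :: "nat \<Rightarrow> 'a letter list" where
  "A i = xa (p i) \<otimes> xb (q i) \<otimes> xa (r i) \<otimes> xb (s i)"

lemma ab_S [simp]: "a \<in> {a, b}" "b \<in> {a, b}" by auto

lemma ab_closed [simp]: "gen a \<in> carrier G" "gen b \<in> carrier G" by auto

lemma A_closed [simp]: "A i \<in> carrier G" by (simp add: A_def)

fun elt :: "label \<Rightarrow> 'a letter list" where
  "elt B = \<one>" | "elt (X i) = xa (p i)" | "elt (W i) = xa (p i) \<otimes> xb (q i)"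
| "elt (Z i) = xa (p i) \<otimes> xb (q i) \<otimes> xa (r i)"

lemma elt_closed [simp]: "elt z \<in> carrier G" by (cases z) auto

text \<open>The labels form circles through \<open>B\<close>, one for each \<open>A i\<close>. The
  weight \<open>emb (A i)\<close> is collected on the last edge, so that \<open>elt z\<close> leads
  from \<open>B\<close> to \<open>z\<close> without any factor.\<close>

lemma path_independent:
  assumes bij: "\<And>t. bij (\<pi> t)"
    and inj: "\<And>u. u \<in> carrier Q \<Longrightarrow> \<iota> (u, B) = \<iota> (\<one>\<^bsub>Q\<^esub>, B) \<Longrightarrow> u = \<one>\<^bsub>Q\<^esub>"
    and path: "\<And>i u. u \<in> carrier Q \<Longrightarrow> act \<pi> (xa (p i)) (\<iota> (u, B)) = \<iota> (u, X i)"
      "\<And>i u. u \<in> carrier Q \<Longrightarrow> act \<pi> (xb (q i)) (\<iota> (u, X i)) = \<iota> (u, W i)"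
      "\<And>i u. u \<in> carrier Q \<Longrightarrow> act \<pi> (xa (r i)) (\<iota> (u, W i)) = \<iota> (u, Z i)"
      "\<And>i u. u \<in> carrier Q \<Longrightarrow> act \<pi> (xb (s i)) (\<iota> (u, Z i)) = \<iota> (u \<odot> emb (A i), B)"
    and h: "h \<in> carrier G" and z: "\<And>u. u \<in> carrier Q \<Longrightarrow> act \<pi> h (\<iota> (u, z)) = \<iota> (u \<odot> var, z')"
  shows "\<not> depends_on G (generate G (A ` I)) (elt z \<otimes> h \<otimes> inv (elt z'))"
proof (rule independentI[where \<pi> = \<pi> and \<iota> = "\<lambda>u. \<iota> (u, B)", OF bij])
  note mult = act_mult[where \<pi> = \<pi>, OF bij]
  show "subgroup (generate G (A ` I)) G" by (rule generate_is_subgroup) auto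
  fix u assume u: "u \<in> carrier Q"
  have elt: "act \<pi> (elt z) (\<iota> (u, B)) = \<iota> (u, z)" if "u \<in> carrier Q" for z u
    using that by (cases z) (simp_all add: mult path)
  show "act \<pi> l (\<iota> (u, B)) = \<iota> (u \<odot> emb l, B)" if "l \<in> generate G (A ` I)" for l
  proof (rule act_generate[where \<iota> = "\<lambda>u. \<iota> (u, B)", OF bij _ _ that u])
    fix l u assume "l \<in> A ` I" and u: "u \<in> carrier Q"
    then obtain i where "l = A i" by blast
    then show "act \<pi> l (\<iota> (u, B)) = \<iota> (u \<odot> emb l, B)"
      using u by (simp add: mult path A_def)
  qed auto
  show "act \<pi> (elt z \<otimes> h \<otimes> inv (elt z')) (\<iota> (u, B)) = \<iota> (u \<odot> var, B)"
    using u elt[of u z] z[OF u] act_m_inv[OF bij elt_closed elt[of "u \<odot> var" z']] by (simp add: mult)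
qed (use inj h in auto)

text \<open>The two cases of \<open>goal\<close> are the two sources of the factor \<open>x\<close>:
  a generator fixes a label and multiplies by \<open>x\<close>, or two labels are one point with
  weights that differ by \<open>x\<close>.\<close>

lemma automaton_independent:
  fixes w :: "'a \<Rightarrow> label \<Rightarrow> 'a xword" and ln :: "'a \<Rightarrow> label \<Rightarrow> nat option"
    and th :: "'a \<Rightarrow> label \<Rightarrow> int" and N :: "'a \<Rightarrow> nat option \<Rightarrow> int"
    and y :: "'a \<Rightarrow> nat option \<Rightarrow> 'a xword"
    and rep :: "label \<Rightarrow> label" and \<kappa> :: "label \<Rightarrow> 'a xword"
  assumes w: "\<And>t z. w t z \<in> carrier Q" and y: "\<And>t l. y t l \<in> carrier Q"
    and \<kappa>: "\<And>z. \<kappa> z \<in> carrier Q"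
    and th: "\<And>t z. th t z mod N t (ln t z) = th t z"
    and rep: "\<And>t z. ln t (rep z) = ln t z" "\<And>t z. th t (rep z) = th t z"
      "\<And>t z. w t z = \<kappa> z \<odot> w t (rep z)"
    and injr: "\<And>t. inj_on (\<lambda>z. (ln t z, th t z)) (range rep)"
    and ln: "\<And>i. ln a (X i) = ln a B" "\<And>i. ln b (X i) = ln b (W i)"
      "\<And>i. ln a (W i) = ln a (Z i)" "\<And>i. ln b (Z i) = ln b B"
    and mods: "\<And>i. (th a B + p i) mod N a (ln a B) = th a (X i)"
      "\<And>i. (th b (X i) + q i) mod N b (ln b (X i)) = th b (W i)"
      "\<And>i. (th a (W i) + r i) mod N a (ln a (W i)) = th a (Z i)"
      "\<And>i. (th b (Z i) + s i) mod N b (ln b (Z i)) = th b B"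
    and ws: "\<And>i. w a B \<odot> y a (ln a B) [^]\<^bsub>Q\<^esub> ((th a B + p i) div N a (ln a B)) = w a (X i)"
      "\<And>i. w b (X i) \<odot> y b (ln b (X i)) [^]\<^bsub>Q\<^esub> ((th b (X i) + q i) div N b (ln b (X i))) = w b (W i)"
      "\<And>i. w a (W i) \<odot> y a (ln a (W i)) [^]\<^bsub>Q\<^esub> ((th a (W i) + r i) div N a (ln a (W i))) = w a (Z i)"
      "\<And>i. w b (Z i) \<odot> y b (ln b (Z i)) [^]\<^bsub>Q\<^esub> ((th b (Z i) + s i) div N b (ln b (Z i))) =
        emb (A i) \<odot> w b B"
    and goal: "(\<exists>t\<in>{a, b}. h = gen t \<and> z = z' \<and> (th t z + 1) mod N t (ln t z) = th t z \<and>
        w t z \<odot> y t (ln t z) [^]\<^bsub>Q\<^esub> ((th t z + 1) div N t (ln t z)) = var \<odot> w t z) \<or>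
      (h = \<one> \<and> rep z = rep z' \<and> \<kappa> z = var \<odot> \<kappa> z')"
  shows "\<not> depends_on G (generate G (A ` I)) (elt z \<otimes> h \<otimes> inv (elt z'))"
proof -
  obtain \<pi> \<iota> where rn: "runs \<pi> \<iota> Q w ln th N y rep \<kappa>"
    using automaton[where M = Q and w = w and ln = ln and th = th and N = N and y = y and rep = rep and \<kappa> = \<kappa>,
        OF group_Q w y \<kappa> th rep injr] by blast
  note move = runs_move[OF rn]
  show ?thesis
  proof (rule path_independent[where \<pi> = \<pi> and \<iota> = \<iota>])
    show "u = \<one>\<^bsub>Q\<^esub>" if "u \<in> carrier Q" "\<iota> (u, B) = \<iota> (\<one>\<^bsub>Q\<^esub>, B)" for u
      using that \<kappa>[of B] runs_eq[OF rn, of u "\<one>\<^bsub>Q\<^esub>" B B] by simp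
    show "h \<in> carrier G" using goal by auto
    show "act \<pi> h (\<iota> (u, z)) = \<iota> (u \<odot> var, z')" if u: "u \<in> carrier Q" for u
      using goal
    proof (elim disjE bexE conjE)
      fix t assume t: "t \<in> {a, b}" "h = gen t" "z = z'" "(th t z + 1) mod N t (ln t z) = th t z"
        "w t z \<odot> y t (ln t z) [^]\<^bsub>Q\<^esub> ((th t z + 1) div N t (ln t z)) = var \<odot> w t z"
      have "act \<pi> (gen t [^] (1::int)) (\<iota> (u, z)) = \<iota> (u \<odot> var, z')"
        using t u w[of t z] y[of t "ln t z"] by (intro move) (auto simp: Q.m_assoc)
      then show ?thesis using t gen_closed[OF t(1)] by simp
    next
      assume t: "h = \<one>" "rep z = rep z'" "\<kappa> z = var \<odot> \<kappa> z'"
      then show ?thesis using runs_eq[OF rn, of u "u \<odot> var" z z'] u \<kappa>[of z'] by (simp add: Q.m_assoc)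
    qed
  qed (use w y in \<open>auto intro!: move simp: runs_bij[OF rn] ln mods[unfolded ln] ws[unfolded ln] Q.m_assoc\<close>)
qed

text \<open>If \<open>a\<close> fixes \<open>B\<close> with factor \<open>x\<close>, the
  \<open>a\<close>-line of \<open>B\<close> collapses: each \<open>X i\<close> becomes
  \<open>B\<close> with factor \<open>x^(p i)\<close>. All \<open>b\<close>-lines of the
  \<open>X i\<close> thereby join that of \<open>B\<close>, where the places 0, \<open>q i\<close>
  and \<open>- s i\<close> are distinct.\<close>

lemma independent_a: "\<not> depends_on G (generate G (A ` I)) (elt B \<otimes> gen a \<otimes> inv (elt B))"
proof (rule automaton_independent)
  let ?w = "\<lambda>t z. if t = a then (case z of X i \<Rightarrow> vp (p i) | _ \<Rightarrow> \<one>\<^bsub>Q\<^esub>)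
    else (case z of B \<Rightarrow> \<one>\<^bsub>Q\<^esub> | X i \<Rightarrow> vp (p i) | W i \<Rightarrow> vp (p i) | Z i \<Rightarrow> emb (A i))"
  let ?ln = "\<lambda>t z. if t = a then (case z of W i \<Rightarrow> Some i | Z i \<Rightarrow> Some i | _ \<Rightarrow> None) else None"
  let ?th = "\<lambda>t z. if t = a then (case z of Z i \<Rightarrow> r i | _ \<Rightarrow> 0)
    else (case z of W i \<Rightarrow> q i | Z i \<Rightarrow> - s i | _ \<Rightarrow> 0)"
  let ?N = "\<lambda>t l. if t = a \<and> l = None then 1 else 0 :: int"
  let ?y = "\<lambda>t l. if t = a \<and> l = None then var else \<one>\<^bsub>Q\<^esub>"
  let ?rep = "\<lambda>z. case z of X i \<Rightarrow> B | _ \<Rightarrow> z"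
  let ?\<kappa> = "\<lambda>z. case z of X i \<Rightarrow> vp (p i) | _ \<Rightarrow> \<one>\<^bsub>Q\<^esub>"
  show "?w t z \<in> carrier Q" "?y t l \<in> carrier Q" "?\<kappa> z \<in> carrier Q" "?th t z mod ?N t (?ln t z) = ?th t z"
    "?ln t (?rep z) = ?ln t z" "?th t (?rep z) = ?th t z" "?w t z = ?\<kappa> z \<odot> ?w t (?rep z)" for t l z
    by (auto split: label.split)
  show "inj_on (\<lambda>z. (?ln t z, ?th t z)) (range ?rep)" for t
    using pos inj by (auto simp: inj_on_def split: label.splits) (smt (verit) pos)+
  show "?w b (Z i) \<odot> ?y b (?ln b (Z i)) [^]\<^bsub>Q\<^esub> ((?th b (Z i) + s i) div ?N b (?ln b (Z i))) =
        emb (A i) \<odot> ?w b B" for i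
    using ab by auto
qed (use ab in auto)

text \<open>Now the \<open>a\<close>-line of \<open>W j\<close> and \<open>Z j\<close> collapses.
  Thus \<open>W j\<close> takes the place \<open>- s j\<close> of \<open>Z j\<close> on the
  \<open>b\<close>-line of \<open>B\<close> and drags \<open>X j\<close> along to
  \<open>- s j - q j\<close>; this is no \<open>- s i\<close>, by \<open>qs\<close>.\<close>

lemma independent_Wa: "\<not> depends_on G (generate G (A ` I)) (elt (W j) \<otimes> gen a \<otimes> inv (elt (W j)))"
proof (rule automaton_independent)
  let ?v = "vp (- r j) \<odot> emb (A j)"
  let ?w = "\<lambda>t z. if t = a then (if z = Z j then vp (r j) else \<one>\<^bsub>Q\<^esub>)
    else (if z = W j \<or> z = X j then ?v else case z of Z i \<Rightarrow> emb (A i) | _ \<Rightarrow> \<one>\<^bsub>Q\<^esub>)"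
  let ?ln = "\<lambda>t z. if t = a then (case z of W i \<Rightarrow> Some i | Z i \<Rightarrow> Some i | _ \<Rightarrow> None)
    else if z = W j \<or> z = X j then None else (case z of X i \<Rightarrow> Some i | W i \<Rightarrow> Some i | _ \<Rightarrow> None)"
  let ?th = "\<lambda>t z. if t = a then (if z = Z j then 0 else case z of X i \<Rightarrow> p i | Z i \<Rightarrow> r i | _ \<Rightarrow> 0)
    else (if z = X j then - s j - q j else if z = W j then - s j else
      case z of W i \<Rightarrow> q i | Z i \<Rightarrow> - s i | _ \<Rightarrow> 0)"
  let ?N = "\<lambda>t l. if t = a \<and> l = Some j then 1 else 0 :: int"
  let ?y = "\<lambda>t l. if t = a \<and> l = Some j then var else \<one>\<^bsub>Q\<^esub>"
  let ?rep = "\<lambda>z. if z = Z j then W j else z"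
  let ?\<kappa> = "\<lambda>z. if z = Z j then vp (r j) else \<one>\<^bsub>Q\<^esub>"
  show "?w t z \<in> carrier Q" "?y t l \<in> carrier Q" "?\<kappa> z \<in> carrier Q" "?th t z mod ?N t (?ln t z) = ?th t z"
    "?ln t (?rep z) = ?ln t z" "?th t (?rep z) = ?th t z" "?w t z = ?\<kappa> z \<odot> ?w t (?rep z)" for t l z
    by (auto simp: Q.int_pow_neg split: label.split)
  show "inj_on (\<lambda>z. (?ln t z, ?th t z)) (range ?rep)" for t
    using inj by (auto simp: inj_on_def split: label.splits if_splits) (smt (verit) pos qs)+
  show "?w b (Z i) \<odot> ?y b (?ln b (Z i)) [^]\<^bsub>Q\<^esub> ((?th b (Z i) + s i) div ?N b (?ln b (Z i))) =
        emb (A i) \<odot> ?w b B" for i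
    using ab by auto
qed (use ab in auto)

text \<open>Mirror image of \<open>independent_a\<close>: every \<open>Z i\<close> becomes
  \<open>B\<close>, and \<open>W i\<close> lands at \<open>- r i\<close> on the
  \<open>a\<close>-line of \<open>B\<close>.\<close>

lemma independent_b: "\<not> depends_on G (generate G (A ` I)) (elt B \<otimes> gen b \<otimes> inv (elt B))"
proof (rule automaton_independent)
  let ?v = "\<lambda>i. emb (A i) \<odot> vp (- s i)"
  let ?w = "\<lambda>t z. if t = a then (case z of W i \<Rightarrow> ?v i | Z i \<Rightarrow> ?v i | _ \<Rightarrow> \<one>\<^bsub>Q\<^esub>)
    else (case z of Z i \<Rightarrow> ?v i | _ \<Rightarrow> \<one>\<^bsub>Q\<^esub>)"
  let ?ln = "\<lambda>t z. if t = a then None else (case z of X i \<Rightarrow> Some i | W i \<Rightarrow> Some i | _ \<Rightarrow> None)"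
  let ?th = "\<lambda>t z. if t = a then (case z of X i \<Rightarrow> p i | W i \<Rightarrow> - r i | _ \<Rightarrow> 0)
    else (case z of W i \<Rightarrow> q i | _ \<Rightarrow> 0)"
  let ?N = "\<lambda>t l. if t \<noteq> a \<and> l = None then 1 else 0 :: int"
  let ?y = "\<lambda>t l. if t \<noteq> a \<and> l = None then var else \<one>\<^bsub>Q\<^esub>"
  let ?rep = "\<lambda>z. case z of Z i \<Rightarrow> B | _ \<Rightarrow> z"
  let ?\<kappa> = "\<lambda>z. case z of Z i \<Rightarrow> ?v i | _ \<Rightarrow> \<one>\<^bsub>Q\<^esub>"
  show "?w t z \<in> carrier Q" "?y t l \<in> carrier Q" "?\<kappa> z \<in> carrier Q" "?th t z mod ?N t (?ln t z) = ?th t z"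
    "?ln t (?rep z) = ?ln t z" "?th t (?rep z) = ?th t z" "?w t z = ?\<kappa> z \<odot> ?w t (?rep z)" for t l z
    by (auto split: label.split)
  show "inj_on (\<lambda>z. (?ln t z, ?th t z)) (range ?rep)" for t
    using inj by (auto simp: inj_on_def split: label.splits) (smt (verit) pos)+
  show "?w b (Z i) \<odot> ?y b (?ln b (Z i)) [^]\<^bsub>Q\<^esub> ((?th b (Z i) + s i) div ?N b (?ln b (Z i))) =
        emb (A i) \<odot> ?w b B" for i
    using ab by (auto simp: Q.m_assoc Q.int_pow_neg)
qed (use ab in auto)

text \<open>Mirror image of \<open>independent_Wa\<close>: \<open>W j\<close> becomes
  \<open>X j\<close>, and \<open>Z j\<close> lands at \<open>p j + r j\<close> on the
  \<open>a\<close>-line of \<open>B\<close>; this is no \<open>p i\<close>, by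
  \<open>pr\<close>.\<close>

lemma independent_Xb: "\<not> depends_on G (generate G (A ` I)) (elt (X j) \<otimes> gen b \<otimes> inv (elt (X j)))"
proof (rule automaton_independent)
  let ?w = "\<lambda>t z. if t = a then (if z = W j \<or> z = Z j then vp (q j) else \<one>\<^bsub>Q\<^esub>)
    else (if z = W j then vp (q j) else case z of Z i \<Rightarrow> emb (A i) | _ \<Rightarrow> \<one>\<^bsub>Q\<^esub>)"
  let ?ln = "\<lambda>t z. if t = a then (if z = W j \<or> z = Z j then None else case z of W i \<Rightarrow> Some i | Z i \<Rightarrow> Some i | _ \<Rightarrow> None)
    else (case z of X i \<Rightarrow> Some i | W i \<Rightarrow> Some i | _ \<Rightarrow> None)"
  let ?th = "\<lambda>t z. if t = a then (if z = W j then p j else if z = Z j then p j + r j else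
      case z of X i \<Rightarrow> p i | Z i \<Rightarrow> r i | _ \<Rightarrow> 0)
    else (if z = W j then 0 else case z of W i \<Rightarrow> q i | Z i \<Rightarrow> - s i | _ \<Rightarrow> 0)"
  let ?N = "\<lambda>t l. if t \<noteq> a \<and> l = Some j then 1 else 0 :: int"
  let ?y = "\<lambda>t l. if t \<noteq> a \<and> l = Some j then var else \<one>\<^bsub>Q\<^esub>"
  let ?rep = "\<lambda>z. if z = W j then X j else z"
  let ?\<kappa> = "\<lambda>z. if z = W j then vp (q j) else \<one>\<^bsub>Q\<^esub>"
  show "?w t z \<in> carrier Q" "?y t l \<in> carrier Q" "?\<kappa> z \<in> carrier Q" "?th t z mod ?N t (?ln t z) = ?th t z"
    "?ln t (?rep z) = ?ln t z" "?th t (?rep z) = ?th t z" "?w t z = ?\<kappa> z \<odot> ?w t (?rep z)" for t l z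
    by (auto split: label.split)
  show "inj_on (\<lambda>z. (?ln t z, ?th t z)) (range ?rep)" for t
    using inj by (auto simp: inj_on_def split: label.splits if_splits) (smt (verit) pos pr)+
  show "?w b (Z i) \<odot> ?y b (?ln b (Z i)) [^]\<^bsub>Q\<^esub> ((?th b (Z i) + s i) div ?N b (?ln b (Z i))) =
        emb (A i) \<odot> ?w b B" for i
    using ab by auto
qed (use ab in auto)

end

section \<open>The graph of the subgroup generated by the words \<open>A i\<close>\<close>

context syllable_words
begin

definition line :: "'a \<Rightarrow> label \<Rightarrow> nat option" where
  "line t z = (if t = a then (case z of W i \<Rightarrow> Some i | Z i \<Rightarrow> Some i | _ \<Rightarrow> None)
    else (case z of X i \<Rightarrow> Some i | W i \<Rightarrow> Some i | _ \<Rightarrow> None))"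

definition pos_on :: "'a \<Rightarrow> label \<Rightarrow> int" where
  "pos_on t z = (if t = a then (case z of X i \<Rightarrow> p i | Z i \<Rightarrow> r i | _ \<Rightarrow> 0)
    else (case z of W i \<Rightarrow> q i | Z i \<Rightarrow> - s i | _ \<Rightarrow> 0))"

text \<open>Only the last edge of a circle carries a weight, since \<open>elt (Z i)\<close> times
  \<open>b^(s i)\<close> is \<open>A i\<close> and not 1.\<close>

definition weight :: "'a \<Rightarrow> label \<Rightarrow> 'a xword" where
  "weight t z = (if t = a then \<one>\<^bsub>Q\<^esub> else (case z of Z i \<Rightarrow> emb (A i) | _ \<Rightarrow> \<one>\<^bsub>Q\<^esub>))"

lemma weight_closed [simp]: "weight t z \<in> carrier Q"
  by (simp add: weight_def split: label.split)

lemma same_point: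
  assumes "line t z = line t z'" "pos_on t z = pos_on t z'"
  shows "z = z'"
  using assms pos inj
  by (cases z; cases z') (auto simp: line_def pos_on_def split: if_splits, (smt (verit) pos)+)

text \<open>Putting \<open>c'\<close> onto \<open>c\<close> superposes the lines through them; this
  says that no second pair of points meets. Non-zero distances on two different lines never agree,
  by \<open>inj\<close>, \<open>pr\<close> and \<open>qs\<close>.\<close>

lemma same_difference:
  assumes ln: "line t z = line t c'" "line t z' = line t c" "line t c \<noteq> line t c'"
    and eq: "pos_on t z - pos_on t c' = pos_on t z' - pos_on t c"
  shows "z = c'"
proof (rule same_point[OF ln(1)])
  define d where "d = pos_on t z - pos_on t c'"
  \<comment> \<open>On the \<open>b\<close>-line of \<open>B\<close> the labels sit at
    \<open>- s i\<close>, on its \<open>a\<close>-line at \<open>p i\<close>; the sign allows one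
    argument for both.\<close>
  define sgn where "sgn = (if t = a then 1 else - 1 :: int)"
  define P where "P i = (if t = a then p i else s i)" for i
  define R where "R i = (if t = a then r i else q i)" for i
  have PR: "P i > 0" "R i > 0" "P i = P j \<longleftrightarrow> i = j" "R i = R j \<longleftrightarrow> i = j" "R i \<noteq> P j" "P i + R j \<noteq> P k" for i j k
    using pos inj pr qs by (auto simp: P_def R_def)
  have None: "pos_on t y = 0 \<or> (\<exists>i. pos_on t y = sgn * P i)" if "line t y = None" for y
    using that by (cases y) (auto simp: line_def pos_on_def sgn_def P_def split: if_splits)
  have Some: "pos_on t y = 0 \<or> pos_on t y = R i" if "line t y = Some i" for y i
    using that by (cases y) (auto simp: line_def pos_on_def R_def split: if_splits)
  have sg: "sgn = 1 \<or> sgn = -1" by (simp add: sgn_def)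
  have one: False if "d \<noteq> 0" "line t y1 = None" "line t y2 = None" "line t y3 = Some i" "line t y4 = Some i"
    "pos_on t y1 - pos_on t y2 = d" "pos_on t y3 - pos_on t y4 = d \<or> pos_on t y4 - pos_on t y3 = d" for y1 y2 y3 y4 i
    using None[OF that(2)] None[OF that(3)] Some[OF that(4)] Some[OF that(5)] that(1,6,7) sg PR
    by (elim disjE exE) (simp_all, (smt (verit) PR)+)
  have two: False if "d \<noteq> 0" "line t y1 = Some j" "line t y2 = Some j" "line t y3 = Some i" "line t y4 = Some i" "i \<noteq> j"
    "pos_on t y1 - pos_on t y2 = d" "pos_on t y3 - pos_on t y4 = d" for y1 y2 y3 y4 i j
    using Some[OF that(2)] Some[OF that(3)] Some[OF that(4)] Some[OF that(5)] that(1,6,7,8) PR(2)[of i] PR(2)[of j] PR(4)[of i j]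
    by linarith
  have "d = 0"
  proof (rule ccontr)
    assume d: "d \<noteq> 0"
    have d': "pos_on t z' - pos_on t c = d" using eq d_def by simp
    show False
    proof (cases "line t c'"; cases "line t c")
      fix i assume *: "line t c' = None" "line t c = Some i"
      show False by (rule one[OF d, of z c' z' i c]) (use * ln d' in \<open>auto simp: d_def\<close>)
    next
      fix i assume *: "line t c' = Some i" "line t c = None"
      show False by (rule one[OF d, of z' c z i c']) (use * ln d' in \<open>auto simp: d_def\<close>)
    next
      fix i j assume *: "line t c' = Some i" "line t c = Some j"
      show False by (rule two[OF d, of z i c' z' j c]) (use * ln d' in \<open>auto simp: d_def\<close>)
    qed (use ln in auto)
  qed
  then show "pos_on t z = pos_on t c'" by (simp add: d_def)
qed

text \<open>\<open>c'\<close> becomes the point \<open>c\<close> with factor \<open>x^(-1)\<close>,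
  and for both generators the line of \<open>c'\<close> is laid over that of
  \<open>c\<close>.\<close>

lemma independent_points:
  assumes ne: "line a c \<noteq> line a c'" "line b c \<noteq> line b c'"
  shows "\<not> depends_on G (generate G (A ` I)) (elt c \<otimes> \<one> \<otimes> inv (elt c'))"
proof (rule automaton_independent)
  have ne': "line t c \<noteq> line t c'" for t using ne ab by (cases "t = a") (auto simp: line_def)
  then have cc: "c \<noteq> c'" by auto
  let ?on = "\<lambda>t z. line t z = line t c'"
  let ?w = "\<lambda>t z. if ?on t z then weight t z \<odot> (inv\<^bsub>Q\<^esub> weight t c' \<odot> (inv\<^bsub>Q\<^esub> var \<odot> weight t c))
    else weight t z"
  let ?ln = "\<lambda>t z. if ?on t z then line t c else line t z"
  let ?th = "\<lambda>t z. if ?on t z then pos_on t z - pos_on t c' + pos_on t c else pos_on t z"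
  let ?N = "\<lambda>(t::'a) (l::nat option). 0 :: int"
  let ?y = "\<lambda>(t::'a) (l::nat option). \<one>\<^bsub>Q\<^esub>"
  let ?rep = "\<lambda>z. if z = c' then c else z"
  let ?\<kappa> = "\<lambda>z. if z = c' then inv\<^bsub>Q\<^esub> var else \<one>\<^bsub>Q\<^esub>"
  show "?w t z \<in> carrier Q" "?y t l \<in> carrier Q" "?\<kappa> z \<in> carrier Q" "?th t z mod ?N t (?ln t z) = ?th t z" for t l z
    by auto
  show "?ln t (?rep z) = ?ln t z" "?th t (?rep z) = ?th t z" "?w t z = ?\<kappa> z \<odot> ?w t (?rep z)" for t z
    using ne'[of t] by auto
  show "inj_on (\<lambda>z. (?ln t z, ?th t z)) (range ?rep)" for t
  proof (rule inj_onI)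
    fix z z' assume z: "z \<in> range ?rep" "z' \<in> range ?rep" and eq: "(?ln t z, ?th t z) = (?ln t z', ?th t z')"
    have zc: "z \<noteq> c'" "z' \<noteq> c'" using z cc by auto
    show "z = z'"
    proof (cases "?on t z"; cases "?on t z'")
      assume "?on t z" "\<not> ?on t z'"
      then show ?thesis using same_difference[of t z c' z' c] eq ne'[of t] zc by simp
    next
      assume "\<not> ?on t z" "?on t z'"
      then show ?thesis using same_difference[of t z' c' z c] eq ne'[of t] zc by simp
    qed (use eq same_point[of t z z'] in auto)
  qed
  show "?ln a (X i) = ?ln a B" "?ln b (X i) = ?ln b (W i)" "?ln a (W i) = ?ln a (Z i)" "?ln b (Z i) = ?ln b B" for i
    using ab by (auto simp: line_def)
  show "(?th a B + p i) mod 0 = ?th a (X i)" "(?th b (X i) + q i) mod 0 = ?th b (W i)"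
    "(?th a (W i) + r i) mod 0 = ?th a (Z i)" "(?th b (Z i) + s i) mod 0 = ?th b B" for i
    using ab by (auto simp: line_def pos_on_def)
  show "?w a B \<odot> \<one>\<^bsub>Q\<^esub> [^]\<^bsub>Q\<^esub> ((?th a B + p i) div 0) = ?w a (X i)"
    "?w b (X i) \<odot> \<one>\<^bsub>Q\<^esub> [^]\<^bsub>Q\<^esub> ((?th b (X i) + q i) div 0) = ?w b (W i)"
    "?w a (W i) \<odot> \<one>\<^bsub>Q\<^esub> [^]\<^bsub>Q\<^esub> ((?th a (W i) + r i) div 0) = ?w a (Z i)" for i
  proof -
    have "line a (X i) = line a B" "line b (W i) = line b (X i)" "line a (Z i) = line a (W i)"
      "weight a (X i) = weight a B" "weight b (W i) = weight b (X i)" "weight a (Z i) = weight a (W i)"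
      using ab by (auto simp: line_def weight_def)
    then show "?w a B \<odot> \<one>\<^bsub>Q\<^esub> [^]\<^bsub>Q\<^esub> ((?th a B + p i) div 0) = ?w a (X i)"
      "?w b (X i) \<odot> \<one>\<^bsub>Q\<^esub> [^]\<^bsub>Q\<^esub> ((?th b (X i) + q i) div 0) = ?w b (W i)"
      "?w a (W i) \<odot> \<one>\<^bsub>Q\<^esub> [^]\<^bsub>Q\<^esub> ((?th a (W i) + r i) div 0) = ?w a (Z i)"
      by simp_all
  qed
  show "?w b (Z i) \<odot> \<one>\<^bsub>Q\<^esub> [^]\<^bsub>Q\<^esub> ((?th b (Z i) + s i) div 0) = emb (A i) \<odot> ?w b B" for i
  proof -
    have "line b (Z i) = line b B" "weight b (Z i) = emb (A i)" "weight b B = \<one>\<^bsub>Q\<^esub>"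
      using ab by (auto simp: line_def weight_def)
    then show ?thesis by simp
  qed
  show "(\<exists>t\<in>{a, b}. \<one> = gen t \<and> c = c' \<and> (?th t c + 1) mod 0 = ?th t c \<and>
        ?w t c \<odot> \<one>\<^bsub>Q\<^esub> [^]\<^bsub>Q\<^esub> ((?th t c + 1) div 0) = var \<odot> ?w t c) \<or>
      (\<one> = \<one> \<and> ?rep c = ?rep c' \<and> ?\<kappa> c = var \<odot> ?\<kappa> c')"
    using cc by simp
qed

text \<open>One point on each line of each generator. Powers of a generator commute with it, so up
  to \<open>L\<close> its conjugate does not vary along a line, and the four automata above cover
  all of them.\<close>

definition anchor :: "'a \<Rightarrow> nat option \<Rightarrow> label" where
  "anchor t l = (case l of None \<Rightarrow> B | Some i \<Rightarrow> if t = a then W i else X i)"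

fun idx :: "label \<Rightarrow> nat set" where
  "idx B = {}" | "idx (X i) = {i}" | "idx (W i) = {i}" | "idx (Z i) = {i}"

lemma independent_anchor:
  assumes "t \<in> {a, b}"
  shows "\<not> depends_on G (generate G (A ` I)) (elt (anchor t l) \<otimes> gen t \<otimes> inv (elt (anchor t l)))"
  using assms independent_a[of I] independent_b[of I] independent_Wa[of I] independent_Xb[of I] ab
  by (cases l) (auto simp: anchor_def simp del: elt.simps)

lemma elt_anchor:
  assumes t: "t \<in> {a, b}" and z: "idx z \<subseteq> I"
  shows "\<exists>l\<in>generate G (A ` I). elt z = l \<otimes> elt (anchor t (line t z)) \<otimes> gen t [^] pos_on t z"
proof (cases "t = b \<and> (\<exists>i. z = Z i)")
  case True
  then obtain i where i: "t = b" "z = Z i" by blast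
  have "elt z = A i \<otimes> elt (anchor t (line t z)) \<otimes> gen t [^] pos_on t z"
    using i ab by (simp add: A_def anchor_def line_def pos_on_def m_assoc int_pow_neg)
  moreover have "A i \<in> generate G (A ` I)" using z i by (intro generate.incl) auto
  ultimately show ?thesis by blast
next
  case False
  then have "elt z = \<one> \<otimes> elt (anchor t (line t z)) \<otimes> gen t [^] pos_on t z"
    using t ab by (cases z) (auto simp: anchor_def line_def pos_on_def)
  then show ?thesis using generate.one by blast
qed

text \<open>Here \<open>N\<close> is \<open>L\<close> itself. Two prefixes on a common line differ,
  up to \<open>L\<close>, by a conjugate of a power of a generator, which is independent unless the
  power is trivial; otherwise \<open>independent_points\<close> applies.\<close>

theorem dependent_mem_generate:
  assumes g: "g \<in> carrier G" and dep: "depends_on G (generate G (A ` I)) g"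
  shows "g \<in> generate G (A ` I)"
proof -
  define L where "L = generate G (A ` I)"
  have L: "subgroup L G" unfolding L_def by (rule generate_is_subgroup) auto
  interpret coset_words G "{a, b}" L
    by (intro coset_words.intro coset_words_axioms.intro free_words_axioms L)
  note L_m = subgroup.m_closed[OF L] and L_inv = subgroup.m_inv_closed[OF L]
  define T where "T = {l \<otimes> elt z | l z. l \<in> L \<and> idx z \<subseteq> I}"
  have TI: "l \<otimes> elt z \<in> T" if "l \<in> L" "idx z \<subseteq> I" for l z using that by (auto simp: T_def)
  have TL: "l \<in> T" if "l \<in> L" for l using TI[of l B] that by simp
  have TG: "T \<subseteq> carrier G" by (auto simp: T_def)
  have conj: "\<not> depends_on G L (t \<otimes> gen s \<otimes> inv t)"
    if tT: "t \<in> T" and s: "s \<in> {a, b}" for t s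
  proof
    assume d: "depends_on G L (t \<otimes> gen s \<otimes> inv t)"
    note gs = gen_closed[OF s]
    obtain l z where lz: "l \<in> L" "idx z \<subseteq> I" "t = l \<otimes> elt z" using tT by (auto simp: T_def)
    let ?e = "elt (anchor s (line s z))"
    obtain l' where l': "l' \<in> L" "elt z = l' \<otimes> ?e \<otimes> gen s [^] pos_on s z"
      using elt_anchor[OF s lz(2)] by (auto simp: L_def)
    have "gen s [^] pos_on s z \<otimes> gen s \<otimes> inv (gen s [^] pos_on s z) = gen s"
    proof -
      have "gen s [^] pos_on s z \<otimes> gen s = gen s \<otimes> gen s [^] pos_on s z"
        using gs int_pow_mult[of "gen s" "pos_on s z" 1] int_pow_mult[of "gen s" 1 "pos_on s z"]
        by (simp add: add.commute)
      then show ?thesis using gs by (simp add: m_assoc)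
    qed
    then have "gen s [^] pos_on s z \<otimes> (gen s \<otimes> (inv (gen s [^] pos_on s z) \<otimes> x)) = gen s \<otimes> x" if "x \<in> carrier G" for x
      using that gs by (simp flip: m_assoc)
    then have "t \<otimes> gen s \<otimes> inv t = (l \<otimes> l') \<otimes> (?e \<otimes> gen s \<otimes> inv ?e \<otimes> inv (l \<otimes> l'))"
      using lz l' gs by (simp add: m_assoc inv_mult_group)
    then have "depends_on G L (?e \<otimes> gen s \<otimes> inv ?e)"
      using L.depends_on_mult_left[of "?e \<otimes> gen s \<otimes> inv ?e \<otimes> inv (l \<otimes> l')" "l \<otimes> l'"]
        L.depends_on_mult_right[of "?e \<otimes> gen s \<otimes> inv ?e" "inv (l \<otimes> l')"] d gs lz l'
      by (simp add: L_m L_inv)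
    then show False using independent_anchor[OF s] by (simp add: L_def)
  qed
  have points: "elt z \<otimes> inv (elt z') \<in> L"
    if d: "depends_on G L (elt z \<otimes> inv (elt z'))" and z: "idx z \<subseteq> I" "idx z' \<subseteq> I" for z z'
  proof (rule ccontr)
    assume not: "elt z \<otimes> inv (elt z') \<notin> L"
    have "line a z = line a z' \<or> line b z = line b z'"
      using independent_points[of z z' I] d by (auto simp: L_def)
    then obtain t where t: "t \<in> {a, b}" "line t z = line t z'" by auto
    note gt = gen_closed[OF t(1)]
    let ?e = "elt (anchor t (line t z))"
    obtain l l' where l: "l \<in> L" "elt z = l \<otimes> ?e \<otimes> gen t [^] pos_on t z"
      and l': "l' \<in> L" "elt z' = l' \<otimes> ?e \<otimes> gen t [^] pos_on t z'"
      using elt_anchor[OF t(1) z(1)] elt_anchor[OF t(1) z(2)] t(2) by (auto simp: L_def)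
    let ?d = "pos_on t z - pos_on t z'"
    have eq: "elt z \<otimes> inv (elt z') = l \<otimes> (?e \<otimes> gen t [^] ?d \<otimes> inv ?e \<otimes> inv l')"
      using l l' gt by (simp add: m_assoc inv_mult_group int_pow_diff)
    have "?d \<noteq> 0"
    proof
      assume "?d = 0"
      then have "elt z \<otimes> inv (elt z') = l \<otimes> inv l'"
        using l(1) l'(1) unfolding eq by (simp add: m_assoc)
      then show False using not l l' by (simp add: L_m L_inv)
    qed
    have "depends_on G L (?e \<otimes> gen t [^] ?d \<otimes> inv ?e)"
      using d[unfolded eq] L.depends_on_mult_left[of "?e \<otimes> gen t [^] ?d \<otimes> inv ?e \<otimes> inv l'" l]
        L.depends_on_mult_right[of "?e \<otimes> gen t [^] ?d \<otimes> inv ?e" "inv l'"] gt l(1) l'(1)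
      by (simp add: L_inv)
    then have "depends_on G L (?e \<otimes> gen t \<otimes> inv ?e)"
      using L.depends_on_root[of "?e \<otimes> gen t \<otimes> inv ?e" ?d] \<open>?d \<noteq> 0\<close> gt
      by (simp add: int_pow_conjugate)
    then show False using independent_anchor[OF t(1)] by (simp add: L_def)
  qed
  have reach_elt: "k \<otimes> elt z \<in> reach T" if k: "k \<in> L" "k \<in> reach T" and z: "idx z \<subseteq> I" for k z
  proof -
    note st = reach.step[where U = T]
    have "k \<otimes> elt (X i) \<in> reach T" if "i \<in> I" for i
      using st[OF k(2), of a "p i"] TI[of k "X i"] k that by simp
    moreover from this have "k \<otimes> elt (W i) \<in> reach T" if "i \<in> I" for i
      using st[of "k \<otimes> elt (X i)" b "q i"] TI[of k "W i"] k that by (simp add: m_assoc)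
    moreover from this have "k \<otimes> elt (Z i) \<in> reach T" if "i \<in> I" for i
      using st[of "k \<otimes> elt (W i)" a "r i"] TI[of k "Z i"] k that by (simp add: m_assoc)
    ultimately show ?thesis using k z by (cases z) (auto simp del: elt.simps(2-4))
  qed
  have reach_A: "k \<otimes> A i \<in> reach T \<and> k \<otimes> inv (A i) \<in> reach T" if k: "k \<in> L" "k \<in> reach T" and i: "i \<in> I" for k i
  proof
    have Ai: "A i \<in> L" using i by (auto simp: L_def intro: generate.incl)
    have "k \<otimes> elt (Z i) \<otimes> xb (s i) = k \<otimes> A i" using k by (simp add: A_def m_assoc)
    then show "k \<otimes> A i \<in> reach T"
      using reach.step[OF reach_elt[OF k, of "Z i"], of b "s i"] i TL[OF L_m[OF k(1) Ai]] by simp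
    \<comment> \<open>For the inverse, the circle of \<open>A i\<close> is run backwards, starting
      from its end.\<close>
    define k' where "k' = k \<otimes> inv (A i)"
    have k': "k' \<in> L" using k Ai by (simp add: k'_def L_m L_inv)
    have kk: "k = k' \<otimes> A i" using k by (simp add: k'_def m_assoc)
    have 1: "k' \<otimes> elt (Z i) = k \<otimes> xb (- s i)" using k' by (simp add: kk A_def m_assoc int_pow_neg)
    have 2: "k' \<otimes> elt (W i) = k' \<otimes> elt (Z i) \<otimes> xa (- r i)" using k' by (simp add: m_assoc int_pow_neg)
    have 3: "k' \<otimes> elt (X i) = k' \<otimes> elt (W i) \<otimes> xb (- q i)" using k' by (simp add: m_assoc int_pow_neg)
    have 4: "k' = k' \<otimes> elt (X i) \<otimes> xa (- p i)" using k' by (simp add: m_assoc int_pow_neg)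
    have "k' \<otimes> elt (Z i) \<in> reach T"
      using reach.step[OF k(2), of b "- s i"] TI[OF k', of "Z i"] i 1 by simp
    then have "k' \<otimes> elt (W i) \<in> reach T"
      using reach.step[of "k' \<otimes> elt (Z i)" T a "- r i"] TI[OF k', of "W i"] i 2 by simp
    then have "k' \<otimes> elt (X i) \<in> reach T"
      using reach.step[of "k' \<otimes> elt (W i)" T b "- q i"] TI[OF k', of "X i"] i 3 by simp
    then have "k' \<in> reach T"
      using reach.step[of "k' \<otimes> elt (X i)" T a "- p i"] TL[OF k'] 4 by simp
    then show "k \<otimes> inv (A i) \<in> reach T" by (simp add: k'_def)
  qed
  have LR: "l \<in> reach T" if "l \<in> L" for l
  proof -
    have "\<forall>k\<in>L. k \<in> reach T \<longrightarrow> k \<otimes> l \<in> reach T"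
      using that unfolding L_def
    proof (induction l rule: generate.induct)
      case (eng h1 h2)
      then have h: "h1 \<in> L" "h2 \<in> L" by (auto simp: L_def)
      show ?case
      proof (intro ballI impI)
        fix k assume k: "k \<in> generate G (A ` I)" "k \<in> reach T"
        then have "(k \<otimes> h1) \<otimes> h2 \<in> reach T"
          using eng.IH h L_m[of k h1] by (simp add: L_def)
        then show "k \<otimes> (h1 \<otimes> h2) \<in> reach T" using k h by (simp add: m_assoc flip: L_def)
      qed
    qed (use reach_A in \<open>auto simp flip: L_def\<close>)
    from this[rule_format, OF L_one reach.one] show ?thesis using that by simp
  qed
  have "g \<in> L"
  proof (rule dependent_mem[OF L order_refl TG])
    show "\<one> \<in> T" using TL by simp
    show "l \<otimes> t \<in> T" if "l \<in> L" "t \<in> T" for l t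
    proof -
      obtain l' z where "l' \<in> L" "idx z \<subseteq> I" "t = l' \<otimes> elt z" using \<open>t \<in> T\<close> by (auto simp: T_def)
      then show ?thesis using TI[OF L_m[OF that(1), of l'], of z] that by (simp add: m_assoc)
    qed
    show "T \<subseteq> reach T"
      using reach_elt LR by (auto simp: T_def)
    show "t1 \<otimes> inv t2 \<in> L" if t12: "t1 \<in> T" "t2 \<in> T" "depends_on G L (t1 \<otimes> inv t2)" for t1 t2
    proof -
      obtain l z l' z' where l: "l \<in> L" "idx z \<subseteq> I" "t1 = l \<otimes> elt z" "l' \<in> L" "idx z' \<subseteq> I" "t2 = l' \<otimes> elt z'"
        using t12(1,2) by (auto simp: T_def)
      have eq: "t1 \<otimes> inv t2 = l \<otimes> (elt z \<otimes> inv (elt z') \<otimes> inv l')"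
        using l by (simp add: m_assoc inv_mult_group)
      then have "depends_on G L (elt z \<otimes> inv (elt z'))"
        using t12(3) L.depends_on_mult_left[of "elt z \<otimes> inv (elt z') \<otimes> inv l'" l]
          L.depends_on_mult_right[of "elt z \<otimes> inv (elt z')" "inv l'"] l by (simp add: L_inv)
      then show ?thesis using points[of z z'] l eq by (simp add: L_m L_inv)
    qed
    show "(\<forall>t1\<in>T. \<forall>t2\<in>T. \<forall>i::int. t1 \<otimes> gen s [^] i \<otimes> inv t2 \<in> L) \<or>
      (\<forall>t\<in>T. \<not> depends_on G L (t \<otimes> gen s \<otimes> inv t))" if "s \<in> {a, b}" for s
      using conj that by blast
  qed (use g dep in \<open>auto simp: L_def\<close>)
  then show ?thesis by (simp add: L_def)
qed

end

section \<open>Adjoining a fifth power\<close>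

text \<open>
  The corners stand for the elements \<open>1\<close>, \<open>d\<close>, \<open>d e\<close>, \<open>d e c\<^sup>5\<close> and \<open>d\<^sup>4\<close>; the last two are joined
  by \<open>e\<close>, up to left multiplication by an element of the subgroup generated by \<open>d\<^sup>5\<close> and
  \<open>d e c\<^sup>5 e d\<close>.
\<close>

datatype corner = C0 | C1 | C2 | C3 | C4

locale fifth_power = free_words G S for G :: "'a letter list monoid" (structure) and S +
  fixes c d e :: 'a
  assumes S: "c \<in> S" "d \<in> S" "e \<in> S" and ne: "c \<noteq> d" "c \<noteq> e" "d \<noteq> e"
begin

definition h :: "'a letter list" where
  "h = gen d \<otimes> gen e \<otimes> gen c [^] (5::int) \<otimes> gen e \<otimes> gen d"

definition K :: "'a letter list set" where
  "K = generate G (gen ` (S - {c, d}) \<union> {gen d [^] (5::int), h})"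

definition N :: "'a letter list set" where
  "N = generate G (gen ` (S - {c}) \<union> {gen c [^] (5::int)})"

fun elt :: "corner \<Rightarrow> 'a letter list" where
  "elt C0 = \<one>" | "elt C1 = gen d" | "elt C2 = gen d \<otimes> gen e"
| "elt C3 = gen d \<otimes> gen e \<otimes> gen c [^] (5::int)" | "elt C4 = gen d [^] (4::int)"

lemma cde_closed [simp]: "gen c \<in> carrier G" "gen d \<in> carrier G" "gen e \<in> carrier G"
  using S by auto

lemma h_closed [simp]: "h \<in> carrier G" by (simp add: h_def)

lemma elt_closed [simp]: "elt z \<in> carrier G" by (cases z) auto

lemma K_subgroup: "subgroup K G"
  unfolding K_def by (rule generate_is_subgroup) auto

lemma N_subgroup: "subgroup N G"
  unfolding N_def using S by (intro generate_is_subgroup) auto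

abbreviation d5 :: "'a letter list" where "d5 \<equiv> gen d [^] (5::int)"

text \<open>The weights at \<open>C4\<close> balance the two circles: \<open>h d^(-5)\<close> on
  entering by \<open>e\<close> and \<open>d^5\<close> on leaving by \<open>d\<close> give
  \<open>h\<close> in total, while \<open>d^4\<close> without weight followed by the same exit gives
  \<open>d^5\<close>.\<close>

lemma path_independent:
  assumes bij: "\<And>t. bij (\<pi> t)"
    and inj: "\<And>u. u \<in> carrier Q \<Longrightarrow> \<iota> (u, C0) = \<iota> (\<one>\<^bsub>Q\<^esub>, C0) \<Longrightarrow> u = \<one>\<^bsub>Q\<^esub>"
    and loop: "\<And>t u. t \<in> S - {c, d} \<Longrightarrow> u \<in> carrier Q \<Longrightarrow>
        act \<pi> (gen t [^] (1::int)) (\<iota> (u, C0)) = \<iota> (u \<odot> emb (gen t), C0)"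
      "\<And>u. u \<in> carrier Q \<Longrightarrow> act \<pi> d5 (\<iota> (u, C0)) = \<iota> (u \<odot> emb d5, C0)"
    and path: "\<And>u. u \<in> carrier Q \<Longrightarrow> act \<pi> (gen d [^] (1::int)) (\<iota> (u, C0)) = \<iota> (u, C1)"
      "\<And>u. u \<in> carrier Q \<Longrightarrow> act \<pi> (gen e [^] (1::int)) (\<iota> (u, C1)) = \<iota> (u, C2)"
      "\<And>u. u \<in> carrier Q \<Longrightarrow> act \<pi> (gen c [^] (5::int)) (\<iota> (u, C2)) = \<iota> (u, C3)"
      "\<And>u. u \<in> carrier Q \<Longrightarrow> act \<pi> (gen e [^] (1::int)) (\<iota> (u, C3)) = \<iota> (u \<odot> emb h \<odot> inv\<^bsub>Q\<^esub> emb d5, C4)"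
      "\<And>u. u \<in> carrier Q \<Longrightarrow> act \<pi> (gen d [^] (1::int)) (\<iota> (u, C4)) = \<iota> (u \<odot> emb d5, C0)"
      "\<And>u. u \<in> carrier Q \<Longrightarrow> act \<pi> (gen d [^] (4::int)) (\<iota> (u, C0)) = \<iota> (u, C4)"
    and z: "\<And>u. u \<in> carrier Q \<Longrightarrow> act \<pi> (gen c [^] (1::int)) (\<iota> (u, z)) = \<iota> (u \<odot> var, z)"
  shows "\<not> depends_on G K (elt z \<otimes> gen c \<otimes> inv (elt z))"
proof (rule independentI[where \<pi> = \<pi> and \<iota> = "\<lambda>u. \<iota> (u, C0)", OF bij K_subgroup])
  note mult = act_mult[where \<pi> = \<pi>, OF bij]
  fix u assume u: "u \<in> carrier Q"
  note path1 = path(1,2,4,5)[unfolded int_pow_1[OF cde_closed(1)] int_pow_1[OF cde_closed(2)] int_pow_1[OF cde_closed(3)]]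
  have elt: "act \<pi> (elt z) (\<iota> (u, C0)) = \<iota> (u, z)" if "u \<in> carrier Q" for z u
    using that path1 path(3,6) by (cases z) (simp_all add: mult)
  show "act \<pi> l (\<iota> (u, C0)) = \<iota> (u \<odot> emb l, C0)" if "l \<in> K" for l
  proof (rule act_generate[where \<iota> = "\<lambda>u. \<iota> (u, C0)", OF bij _ _ _ u])
    show "l \<in> generate G (gen ` (S - {c, d}) \<union> {gen d [^] (5::int), h})" using that by (simp add: K_def)
    fix l u assume l: "l \<in> gen ` (S - {c, d}) \<union> {gen d [^] (5::int), h}" and u: "u \<in> carrier Q"
    have "act \<pi> h (\<iota> (u, C0)) = \<iota> (u \<odot> emb h, C0)"
      unfolding h_def mult using u path1 path(3) by (simp add: Q.m_assoc flip: h_def)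
    then show "act \<pi> l (\<iota> (u, C0)) = \<iota> (u \<odot> emb l, C0)"
      using l by (elim UnE imageE insertE) (use u loop(1)[of _ u] loop(2)[of u] in auto)
  qed auto
  show "act \<pi> (elt z \<otimes> gen c \<otimes> inv (elt z)) (\<iota> (u, C0)) = \<iota> (u \<odot> var, C0)"
    using u elt[of u z] z[OF u] act_m_inv[OF bij elt_closed elt[of "u \<odot> var" z]] by (simp add: mult)
qed (use inj in auto)

text \<open>Each tuple is generator, start, exponent, factor, end. The last one is the loop of
  \<open>c\<close> that carries \<open>x\<close>, the others are the graph of
  \<open>K\<close>.\<close>

definition moves :: "corner \<Rightarrow> ('a \<times> corner \<times> int \<times> 'a xword \<times> corner) set" where
  "moves z0 = (\<lambda>t. (t, C0, 1, emb (gen t), C0)) ` (S - {c, d}) \<union>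
        {(d, C0, 5, emb d5, C0), (d, C0, 1, \<one>\<^bsub>Q\<^esub>, C1), (e, C1, 1, \<one>\<^bsub>Q\<^esub>, C2), (c, C2, 5, \<one>\<^bsub>Q\<^esub>, C3),
         (e, C3, 1, emb h \<odot> inv\<^bsub>Q\<^esub> emb d5, C4), (d, C4, 1, emb d5, C0), (d, C0, 4, \<one>\<^bsub>Q\<^esub>, C4),
         (c, z0, 1, var, z0)}"

lemma automaton_independent:
  fixes w :: "'a \<Rightarrow> corner \<Rightarrow> 'a xword" and ln :: "'a \<Rightarrow> corner \<Rightarrow> corner"
    and th :: "'a \<Rightarrow> corner \<Rightarrow> int" and M :: "'a \<Rightarrow> corner \<Rightarrow> int"
    and y :: "'a \<Rightarrow> corner \<Rightarrow> 'a xword"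
    and rep :: "corner \<Rightarrow> corner" and \<kappa> :: "corner \<Rightarrow> 'a xword"
  assumes w: "\<And>t z. w t z \<in> carrier Q" and y: "\<And>t l. y t l \<in> carrier Q"
    and \<kappa>: "\<And>z. \<kappa> z \<in> carrier Q"
    and th: "\<And>t z. th t z mod M t (ln t z) = th t z"
    and rep: "\<And>t z. ln t (rep z) = ln t z" "\<And>t z. th t (rep z) = th t z"
      "\<And>t z. w t z = \<kappa> z \<odot> w t (rep z)"
    and injr: "\<And>t. inj_on (\<lambda>z. (ln t z, th t z)) (range rep)"
    and mvs: "\<And>t z k v z'. (t, z, k, v, z') \<in> moves z0 \<Longrightarrow>
        ln t z = ln t z' \<and> (th t z + k) mod M t (ln t z) = th t z' \<and>
        w t z \<odot> y t (ln t z) [^]\<^bsub>Q\<^esub> ((th t z + k) div M t (ln t z)) = v \<odot> w t z'"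
  shows "\<not> depends_on G K (elt z0 \<otimes> gen c \<otimes> inv (elt z0))"
proof -
  obtain \<pi> \<iota> where rn: "runs \<pi> \<iota> Q w ln th M y rep \<kappa>"
    using automaton[where M = Q and w = w and ln = ln and th = th and N = M and y = y and rep = rep and \<kappa> = \<kappa>,
        OF group_Q w y \<kappa> th rep injr] by blast
  have move: "act \<pi> (gen t [^] k) (\<iota> (u, z)) = \<iota> (u \<odot> v, z')"
    if "t \<in> S" "u \<in> carrier Q" "v \<in> carrier Q" and m: "ln t z = ln t z' \<and> (th t z + k) mod M t (ln t z) = th t z' \<and>
        w t z \<odot> y t (ln t z) [^]\<^bsub>Q\<^esub> ((th t z + k) div M t (ln t z)) = v \<odot> w t z'"
    for t u v z z' and k :: int
  proof (rule runs_move[OF rn])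
    have "u \<odot> w t z \<odot> y t (ln t z) [^]\<^bsub>Q\<^esub> ((th t z + k) div M t (ln t z)) =
        u \<odot> (w t z \<odot> y t (ln t z) [^]\<^bsub>Q\<^esub> ((th t z + k) div M t (ln t z)))"
      using that(2) w y by (intro Q.m_assoc) auto
    also have "\<dots> = u \<odot> (v \<odot> w t z')"
      by (simp only: m[THEN conjunct2, THEN conjunct2])
    finally show "u \<odot> w t z \<odot> y t (ln t z) [^]\<^bsub>Q\<^esub> ((th t z + k) div M t (ln t z)) = u \<odot> v \<odot> w t z'"
      using that(2,3) w by (simp only: Q.m_assoc)
  qed (use that in auto)
  note mvs = mvs[unfolded moves_def]
  show ?thesis
  proof (rule path_independent[where \<pi> = \<pi> and \<iota> = \<iota>])
    show "u = \<one>\<^bsub>Q\<^esub>" if "u \<in> carrier Q" "\<iota> (u, C0) = \<iota> (\<one>\<^bsub>Q\<^esub>, C0)" for u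
      using that \<kappa>[of C0] runs_eq[OF rn, of u "\<one>\<^bsub>Q\<^esub>" C0 C0] by simp
    fix u assume u: "u \<in> carrier Q"
    show "act \<pi> (gen t [^] (1::int)) (\<iota> (u, C0)) = \<iota> (u \<odot> emb (gen t), C0)" if "t \<in> S - {c, d}" for t
      by (rule move[OF _ u _ mvs]) (use that in auto)
    show "act \<pi> d5 (\<iota> (u, C0)) = \<iota> (u \<odot> emb d5, C0)"
      by (rule move[OF S(2) u _ mvs]) auto
    show "act \<pi> (gen d [^] (1::int)) (\<iota> (u, C0)) = \<iota> (u, C1)"
      using move[OF S(2) u Q.one_closed mvs[of d C0 1 "\<one>\<^bsub>Q\<^esub>" C1]] u by simp
    show "act \<pi> (gen e [^] (1::int)) (\<iota> (u, C1)) = \<iota> (u, C2)"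
      using move[OF S(3) u Q.one_closed mvs[of e C1 1 "\<one>\<^bsub>Q\<^esub>" C2]] u by simp
    show "act \<pi> (gen c [^] (5::int)) (\<iota> (u, C2)) = \<iota> (u, C3)"
      using move[OF S(1) u Q.one_closed mvs[of c C2 5 "\<one>\<^bsub>Q\<^esub>" C3]] u by simp
    show "act \<pi> (gen e [^] (1::int)) (\<iota> (u, C3)) = \<iota> (u \<odot> emb h \<odot> inv\<^bsub>Q\<^esub> emb d5, C4)"
      using move[OF S(3) u _ mvs[of e C3 1 "emb h \<odot> inv\<^bsub>Q\<^esub> emb d5" C4]] u by (simp add: Q.m_assoc)
    show "act \<pi> (gen d [^] (1::int)) (\<iota> (u, C4)) = \<iota> (u \<odot> emb d5, C0)"
      by (rule move[OF S(2) u _ mvs]) auto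
    show "act \<pi> (gen d [^] (4::int)) (\<iota> (u, C0)) = \<iota> (u, C4)"
      using move[OF S(2) u Q.one_closed mvs[of d C0 4 "\<one>\<^bsub>Q\<^esub>" C4]] u by simp
    show "act \<pi> (gen c [^] (1::int)) (\<iota> (u, z0)) = \<iota> (u \<odot> var, z0)"
      by (rule move[OF S(1) u _ mvs]) auto
  qed (simp add: runs_bij[OF rn])
qed

text \<open>No other corner lies on the \<open>c\<close>-line of \<open>z0\<close>, so the loop with
  factor \<open>x\<close> is added without any identification.\<close>

lemma independent_corner:
  assumes z0: "z0 \<in> {C0, C1, C4}"
  shows "\<not> depends_on G K (elt z0 \<otimes> gen c \<otimes> inv (elt z0))"
proof (rule automaton_independent)
  let ?w = "\<lambda>t z. if t = e \<and> z = C4 then emb d5 \<odot> inv\<^bsub>Q\<^esub> emb h else \<one>\<^bsub>Q\<^esub>"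
  let ?ln = "\<lambda>t z. if t = d \<and> (z = C1 \<or> z = C4) then C0 else if t = e \<and> z = C2 then C1
    else if t = e \<and> z = C4 then C3 else if t = c \<and> z = C3 then C2 else z"
  let ?th = "\<lambda>t z. if t = d \<and> z = C1 then 1 else if t = d \<and> z = C4 then 4
    else if t = e \<and> (z = C2 \<or> z = C4) then 1 else if t = c \<and> z = C3 then 5 else 0 :: int"
  let ?M = "\<lambda>t l. if t = d \<and> l = C0 then 5 else if t \<in> S - {c, d} \<and> l = C0 then 1
    else if t = c \<and> l = z0 then 1 else 0 :: int"
  let ?y = "\<lambda>t l. if t = d \<and> l = C0 then emb d5 else if t \<in> S - {c, d} \<and> l = C0 then emb (gen t)
    else if t = c \<and> l = z0 then var else \<one>\<^bsub>Q\<^esub>"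
  let ?rep = "\<lambda>z :: corner. z"
  let ?\<kappa> = "\<lambda>z :: corner. \<one>\<^bsub>Q\<^esub>"
  show "?w t z \<in> carrier Q" "?y t l \<in> carrier Q" "?\<kappa> z \<in> carrier Q" "?th t z mod ?M t (?ln t z) = ?th t z"
    "?ln t (?rep z) = ?ln t z" "?th t (?rep z) = ?th t z" "?w t z = ?\<kappa> z \<odot> ?w t (?rep z)" for t l z
    using ne z0 by auto
  show "inj_on (\<lambda>z. (?ln t z, ?th t z)) (range ?rep)" for t
    using ne by (auto simp: inj_on_def split: if_splits)
  show "?ln t z = ?ln t z' \<and> (?th t z + k) mod ?M t (?ln t z) = ?th t z' \<and>
        ?w t z \<odot> ?y t (?ln t z) [^]\<^bsub>Q\<^esub> ((?th t z + k) div ?M t (?ln t z)) = v \<odot> ?w t z'"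
    if "(t, z, k, v, z') \<in> moves z0" for t z k v z'
    using that[unfolded moves_def] ne z0 S by (elim UnE insertE imageE) (auto simp: Q.m_assoc)
qed

text \<open>The loop swallows the edge \<open>c^5\<close>, so \<open>C3\<close> becomes
  \<open>C2\<close> with factor \<open>x^5\<close>. The two \<open>e\<close>-edges then form a
  single line with \<open>C1\<close>, \<open>C2\<close>, \<open>C4\<close> at 0, 1, 2, where nothing
  else meets.\<close>

lemma independent_C2: "\<not> depends_on G K (elt C2 \<otimes> gen c \<otimes> inv (elt C2))"
proof (rule automaton_independent)
  let ?x5 = "var [^]\<^bsub>Q\<^esub> (5::int)"
  let ?w = "\<lambda>t z. if t = e \<and> z = C4 then emb d5 \<odot> inv\<^bsub>Q\<^esub> emb h \<odot> ?x5 else if z = C3 then ?x5 else \<one>\<^bsub>Q\<^esub>"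
  let ?ln = "\<lambda>t z. if t = d \<and> (z = C1 \<or> z = C4) then C0
    else if t = e \<and> (z = C2 \<or> z = C3 \<or> z = C4) then C1 else if z = C3 then C2 else z"
  let ?th = "\<lambda>t z. if t = d \<and> z = C1 then 1 else if t = d \<and> z = C4 then 4
    else if t = e \<and> (z = C2 \<or> z = C3) then 1 else if t = e \<and> z = C4 then 2 else 0 :: int"
  let ?M = "\<lambda>t l. if t = d \<and> l = C0 then 5 else if t \<in> S - {c, d} \<and> l = C0 then 1
    else if t = c \<and> l = C2 then 1 else 0 :: int"
  let ?y = "\<lambda>t l. if t = d \<and> l = C0 then emb d5 else if t \<in> S - {c, d} \<and> l = C0 then emb (gen t)
    else if t = c \<and> l = C2 then var else \<one>\<^bsub>Q\<^esub>"
  let ?rep = "\<lambda>z. if z = C3 then C2 else z"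
  let ?\<kappa> = "\<lambda>z. if z = C3 then ?x5 else \<one>\<^bsub>Q\<^esub>"
  show "?w t z \<in> carrier Q" "?y t l \<in> carrier Q" "?\<kappa> z \<in> carrier Q" "?th t z mod ?M t (?ln t z) = ?th t z"
    "?ln t (?rep z) = ?ln t z" "?th t (?rep z) = ?th t z" "?w t z = ?\<kappa> z \<odot> ?w t (?rep z)" for t l z
    using ne by auto
  show "inj_on (\<lambda>z. (?ln t z, ?th t z)) (range ?rep)" for t
    using ne by (auto simp: inj_on_def split: if_splits)
  show "?ln t z = ?ln t z' \<and> (?th t z + k) mod ?M t (?ln t z) = ?th t z' \<and>
        ?w t z \<odot> ?y t (?ln t z) [^]\<^bsub>Q\<^esub> ((?th t z + k) div ?M t (?ln t z)) = v \<odot> ?w t z'"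
    if "(t, z, k, v, z') \<in> moves C2" for t z k v z'
    using that[unfolded moves_def] ne S by (elim UnE insertE imageE) (auto simp: Q.m_assoc)
qed

lemma generators_K [simp]: "t \<in> S \<Longrightarrow> t \<noteq> c \<Longrightarrow> t \<noteq> d \<Longrightarrow> gen t \<in> K" "d5 \<in> K" "h \<in> K"
  unfolding K_def by (auto intro!: generate.incl)

lemma generators_N [simp]: "t \<in> S \<Longrightarrow> t \<noteq> c \<Longrightarrow> gen t \<in> N" "gen c [^] (5::int) \<in> N"
  unfolding N_def by (auto intro!: generate.incl)

lemmas N_m = subgroup.m_closed[OF N_subgroup]

lemma pow_N [simp]: "x \<in> N \<Longrightarrow> x [^] (k::int) \<in> N"
  using subgroup_int_pow_closed[OF N_subgroup] .

lemma K_subset_N: "K \<subseteq> N"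
proof -
  have "h \<in> N" using S ne by (auto simp: h_def intro!: N_m)
  then show ?thesis
    unfolding K_def using S ne by (intro generate_subgroup_incl[OF _ N_subgroup]) auto
qed

lemma elt_N: "elt z \<in> N"
  using S ne subgroup.one_closed[OF N_subgroup] by (cases z) (auto intro!: N_m)

text \<open>All corners and all basis elements but \<open>c\<close> lie in \<open>N\<close>, so near
  the core only steps along \<open>c\<close> can leave \<open>N\<close>; for these the conjugates of
  \<open>c\<close> are independent of \<open>K\<close>.\<close>

theorem dependent_mem_N:
  assumes g: "g \<in> carrier G" and dep: "depends_on G K g"
  shows "g \<in> N"
proof -
  interpret coset_words G S K
    by (intro coset_words.intro coset_words_axioms.intro free_words_axioms K_subgroup)
  note L_m = subgroup.m_closed[OF K_subgroup] and L_inv = subgroup.m_inv_closed[OF K_subgroup]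
  define T where "T = {l \<otimes> elt z | l z. l \<in> K}"
  have TI: "l \<otimes> elt z \<in> T" if "l \<in> K" for l z using that by (auto simp: T_def)
  have TL: "l \<in> T" if "l \<in> K" for l using TI[of l C0] that by simp
  have TG: "T \<subseteq> carrier G" by (auto simp: T_def)
  have TN: "t \<in> N" if "t \<in> T" for t
    using that K_subset_N elt_N by (auto simp: T_def intro!: N_m)
  have corner: "\<not> depends_on G K (elt z \<otimes> gen c \<otimes> inv (elt z))" for z
  proof (cases "z = C3")
    case True
    \<comment> \<open>\<open>C2\<close> and \<open>C3\<close> are on the same \<open>c\<close>-line,
      hence give the same conjugate of \<open>c\<close>.\<close>
    have "gen c [^] (5::int) \<otimes> gen c \<otimes> inv (gen c [^] (5::int)) = gen c"
      using int_pow_mult[of "gen c" 5 1] int_pow_mult[of "gen c" 1 5] by (simp add: m_assoc)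
    then have "gen c [^] (5::int) \<otimes> (gen c \<otimes> (inv (gen c [^] (5::int)) \<otimes> x)) = gen c \<otimes> x" if "x \<in> carrier G" for x
      using that by (simp flip: m_assoc)
    then have "elt z \<otimes> gen c \<otimes> inv (elt z) = elt C2 \<otimes> gen c \<otimes> inv (elt C2)"
      using True by (simp add: inv_mult_group m_assoc)
    then show ?thesis using independent_C2 by simp
  next
    case False
    then show ?thesis using independent_corner[of z] independent_C2 by (cases z) auto
  qed
  have reach_elt: "k \<otimes> elt z \<in> reach T" if k: "k \<in> K" "k \<in> reach T" for k z
  proof -
    note st = reach.step[where U = T]
    have 1: "k \<otimes> elt C1 \<in> reach T"
      using st[OF k(2) S(2), of 1] TI[OF k(1), of C1] by simp
    then have 2: "k \<otimes> elt C2 \<in> reach T"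
      using st[OF 1 S(3), of 1] TI[OF k(1), of C2] k by (simp add: m_assoc)
    then have "k \<otimes> elt C3 \<in> reach T"
      using st[OF 2 S(1), of 5] TI[OF k(1), of C3] k by (simp add: m_assoc)
    moreover have "k \<otimes> elt C4 \<in> reach T"
      using st[OF k(2) S(2), of 4] TI[OF k(1), of C4] by simp
    ultimately show ?thesis using 1 2 k by (cases z) (auto simp del: elt.simps(2-5))
  qed
  have reach_pow: "k \<otimes> gen t [^] i \<in> reach T"
    if "k \<in> K" "k \<in> reach T" "t \<in> S" "gen t [^] i \<in> K" for k t and i :: int
    using reach.step[OF that(2,3), of i] TL[OF L_m[OF that(1,4)]] by simp
  have d45: "gen d [^] (4::int) \<otimes> gen d = d5" using int_pow_mult[of "gen d" 4 1] by simp
  then have "inv d5 \<otimes> gen d [^] (4::int) = inv (gen d)"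
    by (simp add: inv_mult_group m_assoc flip: d45)
  \<comment> \<open>Stepping back by \<open>d\<close> is \<open>d^(-5)\<close> followed by
    \<open>d^4\<close>, whence the factor \<open>h d^(-5)\<close>, an element of
    \<open>K\<close>.\<close>
  then have h_C3: "elt C3 \<otimes> gen e = h \<otimes> inv d5 \<otimes> elt C4"
    by (simp add: m_assoc) (simp add: h_def m_assoc)
  from d45 have h_C4: "h = h \<otimes> inv d5 \<otimes> elt C4 \<otimes> gen d" by (simp add: m_assoc)
  have reach_h: "k \<otimes> h \<in> reach T" if k: "k \<in> K" "k \<in> reach T" for k
  proof -
    have hd: "k \<otimes> (h \<otimes> inv d5) \<in> K" using k by (simp add: L_m L_inv)
    have "k \<otimes> elt C3 \<otimes> gen e = k \<otimes> (h \<otimes> inv d5) \<otimes> elt C4"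
      using h_C3 k by (simp add: m_assoc del: elt.simps)
    then have 1: "k \<otimes> (h \<otimes> inv d5) \<otimes> elt C4 \<in> reach T"
      using reach.step[OF reach_elt[OF k, of C3] S(3), of 1] TI[OF hd, of C4] by (simp del: elt.simps)
    have "k \<otimes> (h \<otimes> inv d5) \<otimes> elt C4 \<otimes> gen d = k \<otimes> h"
      using h_C4 k by (simp add: m_assoc del: elt.simps)
    then show ?thesis
      using reach.step[OF 1 S(2), of 1] TL[OF L_m[OF k(1), of h]] by (simp del: elt.simps)
  qed
  have reach_inv_h: "k \<otimes> inv h \<in> reach T" if k: "k \<in> K" "k \<in> reach T" for k
  proof -
    define k' where "k' = k \<otimes> inv h"
    have k': "k' \<in> K" using k by (simp add: k'_def L_m L_inv)
    have kk: "k = k' \<otimes> h" using k by (simp add: k'_def m_assoc)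
    have hd: "k' \<otimes> (h \<otimes> inv d5) \<in> K" using k' by (simp add: L_m L_inv)
    have 4: "k \<otimes> gen d [^] (-1::int) = k' \<otimes> (h \<otimes> inv d5) \<otimes> elt C4"
    proof -
      have "k = k' \<otimes> (h \<otimes> inv d5) \<otimes> elt C4 \<otimes> gen d"
        using h_C4 k' by (simp add: kk m_assoc del: elt.simps)
      then show ?thesis
        using k' int_pow_neg[of "gen d" 1] by (simp add: m_assoc del: elt.simps)
    qed
    have 3: "k' \<otimes> (h \<otimes> inv d5) \<otimes> elt C4 \<otimes> gen e [^] (-1::int) = k' \<otimes> elt C3"
      using h_C3 k' int_pow_neg[of "gen e" 1] by (simp add: m_assoc flip: h_C3 del: elt.simps)
    have 2: "k' \<otimes> elt C3 \<otimes> gen c [^] (-5::int) = k' \<otimes> elt C2"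
      using k' int_pow_neg[of "gen c" 5] by (simp add: m_assoc)
    have 1: "k' \<otimes> elt C2 \<otimes> gen e [^] (-1::int) = k' \<otimes> elt C1"
      using k' int_pow_neg[of "gen e" 1] by (simp add: m_assoc)
    have 0: "k' \<otimes> elt C1 \<otimes> gen d [^] (-1::int) = k'"
      using k' int_pow_neg[of "gen d" 1] by (simp add: m_assoc)
    have "k' \<otimes> (h \<otimes> inv d5) \<otimes> elt C4 \<in> reach T"
      using reach.step[OF k(2) S(2), of "-1"] TI[OF hd, of C4] unfolding 4 by simp
    from reach.step[OF this S(3), of "-1"] have "k' \<otimes> elt C3 \<in> reach T"
      using TI[OF k', of C3] unfolding 3 by simp
    from reach.step[OF this S(1), of "-5"] have "k' \<otimes> elt C2 \<in> reach T"
      using TI[OF k', of C2] unfolding 2 by simp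
    from reach.step[OF this S(3), of "-1"] have "k' \<otimes> elt C1 \<in> reach T"
      using TI[OF k', of C1] unfolding 1 by simp
    from reach.step[OF this S(2), of "-1"] have "k' \<in> reach T"
      using TL[OF k'] unfolding 0 by simp
    then show ?thesis by (simp add: k'_def)
  qed
  have LR: "l \<in> reach T" if "l \<in> K" for l
  proof -
    have "\<forall>k\<in>K. k \<in> reach T \<longrightarrow> k \<otimes> l \<in> reach T"
      using that[unfolded K_def]
    proof (induction l rule: generate.induct)
      case one
      then show ?case by simp
    next
      case (incl x)
      have "k \<otimes> x \<in> reach T" if k: "k \<in> K" "k \<in> reach T" for k
        using incl
      proof (elim UnE imageE insertE emptyE)
        fix t assume "x = gen t" "t \<in> S - {c, d}"
        then show ?thesis using reach_pow[OF k, of t 1] by simp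
      next
        assume "x = d5"
        then show ?thesis using reach_pow[OF k S(2), of 5] by simp
      qed (use reach_h[OF k] in simp)
      then show ?case by blast
    next
      case (inv x)
      have "k \<otimes> inv x \<in> reach T" if k: "k \<in> K" "k \<in> reach T" for k
        using inv
      proof (elim UnE imageE insertE emptyE)
        fix t assume "x = gen t" "t \<in> S - {c, d}"
        then show ?thesis using reach_pow[OF k, of t "-1"] int_pow_neg[of "gen t" 1] by (simp add: L_inv)
      next
        assume "x = d5"
        then show ?thesis using reach_pow[OF k S(2), of "-5"] int_pow_neg[of "gen d" 5] by (simp add: L_inv)
      qed (use reach_inv_h[OF k] in simp)
      then show ?case by blast
    next
      case (eng h1 h2)
      then have h: "h1 \<in> K" "h2 \<in> K" by (auto simp: K_def)
      show ?case
      proof (intro ballI impI)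
        fix k assume k: "k \<in> K" "k \<in> reach T"
        then have "(k \<otimes> h1) \<otimes> h2 \<in> reach T"
          using eng.IH h L_m[of k h1] by simp
        then show "k \<otimes> (h1 \<otimes> h2) \<in> reach T" using k h by (simp add: m_assoc)
      qed
    qed
    from this[rule_format, OF L_one reach.one] show ?thesis using that by simp
  qed
  show "g \<in> N"
  proof (rule dependent_mem[OF N_subgroup K_subset_N TG])
    show "\<one> \<in> T" using TL by simp
    show "l \<otimes> t \<in> T" if "l \<in> K" "t \<in> T" for l t
    proof -
      obtain l' z where "l' \<in> K" "t = l' \<otimes> elt z" using \<open>t \<in> T\<close> by (auto simp: T_def)
      then show ?thesis using TI[OF L_m[OF that(1), of l'], of z] that by (simp add: m_assoc)
    qed
    show "T \<subseteq> reach T"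
      using reach_elt LR by (auto simp: T_def)
    show "t1 \<otimes> inv t2 \<in> N" if "t1 \<in> T" "t2 \<in> T" for t1 t2
      using TN that subgroup.m_inv_closed[OF N_subgroup] by (intro N_m) auto
    show "(\<forall>t1\<in>T. \<forall>t2\<in>T. \<forall>i::int. t1 \<otimes> gen s [^] i \<otimes> inv t2 \<in> N) \<or>
      (\<forall>t\<in>T. \<not> depends_on G K (t \<otimes> gen s \<otimes> inv t))" if s: "s \<in> S" for s
    proof (cases "s = c")
      case False
      then show ?thesis
        using TN s subgroup.m_inv_closed[OF N_subgroup] by (intro disjI1 ballI allI N_m) auto
    next
      case True
      have "\<not> depends_on G K (t \<otimes> gen c \<otimes> inv t)" if "t \<in> T" for t
      proof
        assume d: "depends_on G K (t \<otimes> gen c \<otimes> inv t)"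
        obtain l z where l: "l \<in> K" "t = l \<otimes> elt z" using \<open>t \<in> T\<close> by (auto simp: T_def)
        have "t \<otimes> gen c \<otimes> inv t = l \<otimes> (elt z \<otimes> gen c \<otimes> inv (elt z) \<otimes> inv l)"
          using l by (simp add: m_assoc inv_mult_group del: elt.simps)
        then have "depends_on G K (elt z \<otimes> gen c \<otimes> inv (elt z))"
          using d L.depends_on_mult_left[of "elt z \<otimes> gen c \<otimes> inv (elt z) \<otimes> inv l" l]
            L.depends_on_mult_right[of "elt z \<otimes> gen c \<otimes> inv (elt z)" "inv l"] l
          by (simp add: L_inv del: elt.simps)
        then show False using corner by simp
      qed
      then show ?thesis using True by simp
    qed
  qed (use g dep in auto)
qed

end

section \<open>Homomorphisms of free groups\<close>

definition fg_ext :: "('b, 'm) monoid_scheme \<Rightarrow> ('s \<Rightarrow> 'b) \<Rightarrow> 's letter list \<Rightarrow> 'b" where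
  "fg_ext M v w = foldr (\<lambda>l acc. (if fst l then inv\<^bsub>M\<^esub> v (snd l) else v (snd l)) \<otimes>\<^bsub>M\<^esub> acc) w \<one>\<^bsub>M\<^esub>"

lemma fg_ext_hom:
  assumes M: "group M" and v: "v ` S \<subseteq> carrier M"
  shows "fg_ext M v \<in> hom (free_group S) M"
proof -
  interpret M: group M by (rule M)
  define val where "val l = (if fst l then inv\<^bsub>M\<^esub> v (snd l) else v (snd l))" for l
  have Cons: "fg_ext M v (l # w) = val l \<otimes>\<^bsub>M\<^esub> fg_ext M v w" and Nil: "fg_ext M v [] = \<one>\<^bsub>M\<^esub>" for l w
    by (simp_all add: fg_ext_def val_def)
  have val: "val l \<in> carrier M" if "snd l \<in> S" for l
    using that v by (auto simp: val_def)
  have closed: "fg_ext M v w \<in> carrier M" if "snd ` set w \<subseteq> S" for w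
    using that by (induction w) (auto simp: Cons Nil val)
  have val_inv: "val l \<otimes>\<^bsub>M\<^esub> val (inv_letter l) = \<one>\<^bsub>M\<^esub>" if "snd l \<in> S" for l
    using that v by (cases l) (auto simp: val_def inv_letter_def)
  have cc: "fg_ext M v (cancel_cons l w) = val l \<otimes>\<^bsub>M\<^esub> fg_ext M v w"
    if "snd l \<in> S" "snd ` set w \<subseteq> S" for l w
  proof (cases w)
    case (Cons t w')
    then show ?thesis
      using that closed[of w'] val[of l] val[of t] val_inv[of l]
      by (auto simp: \<open>\<And>l w. fg_ext M v (l # w) = _\<close> simp flip: M.m_assoc)
  qed (simp add: \<open>\<And>l w. fg_ext M v (l # w) = _\<close>)
  have "fg_ext M v (foldr cancel_cons u w) = fg_ext M v u \<otimes>\<^bsub>M\<^esub> fg_ext M v w"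
    if "snd ` set u \<subseteq> S" "snd ` set w \<subseteq> S" for u w
    using that(1)
  proof (induction u)
    case (Cons l u)
    have "snd ` set (foldr cancel_cons u w) \<subseteq> S"
      using Cons.prems that(2) by (intro order_trans[OF set_foldr_cancel_cons]) auto
    then show ?case
      using Cons closed[of u] closed[of w] val[of l] that(2)
      by (simp add: cc \<open>\<And>l w. fg_ext M v (l # w) = _\<close> M.m_assoc)
  qed (use closed that in \<open>simp add: Nil\<close>)
  then show ?thesis
    using closed by (auto simp: hom_def free_group_def)
qed

lemma fg_ext_gen [simp]:
  assumes "group M" "v s \<in> carrier M"
  shows "fg_ext M v (gen s) = v s"
  using assms by (simp add: fg_ext_def gen_def monoid.r_one group.is_monoid)

lemma group_hom_fg_ext:
  "group M \<Longrightarrow> v ` S \<subseteq> carrier M \<Longrightarrow> group_hom (free_group S) M (fg_ext M v)"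
  by (simp add: group_hom_def group_hom_axioms_def fg_ext_hom group_free_group)

text \<open>The same principle as for independence: a word can be recovered from the point to which
  its image moves the point of 1.\<close>

lemma fg_ext_inj:
  fixes v :: "'j \<Rightarrow> 's letter list"
  assumes v: "v ` J \<subseteq> carrier (free_group S)" and bij: "\<And>s. bij (\<pi> s)"
    and inj: "\<And>u. u \<in> carrier (free_group J) \<Longrightarrow> \<iota> u = \<iota> \<one>\<^bsub>free_group J\<^esub> \<Longrightarrow> u = \<one>\<^bsub>free_group J\<^esub>"
    and act: "\<And>j u. j \<in> J \<Longrightarrow> u \<in> carrier (free_group J) \<Longrightarrow>
      act \<pi> (v j) (\<iota> u) = \<iota> (u \<otimes>\<^bsub>free_group J\<^esub> gen j)"
  shows "inj_on (fg_ext (free_group S) v) (carrier (free_group J))"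
proof -
  interpret J: group "free_group J" by (rule group_free_group)
  interpret S: group "free_group S" by (rule group_free_group)
  interpret \<phi>: group_hom "free_group J" "free_group S" "fg_ext (free_group S) v"
    using v by (rule group_hom_fg_ext[OF group_free_group])
  have "act \<pi> (fg_ext (free_group S) v w) (\<iota> u) = \<iota> (u \<otimes>\<^bsub>free_group J\<^esub> w)"
    if "w \<in> carrier (free_group J)" "u \<in> carrier (free_group J)" for w u
    using that
  proof (induction w arbitrary: u rule: free_group_induct)
    case one
    then show ?case by (simp add: \<phi>.hom_one) (simp add: free_group_one[of S])
  next
    case (gen j k w)
    have g: "gen j \<in> carrier (free_group J)" using gen by (simp add: gen_in_free_group)
    have vj: "v j \<in> carrier (free_group S)" using gen v by auto
    define orb where "orb i = \<iota> (u \<otimes>\<^bsub>free_group J\<^esub> gen j [^]\<^bsub>free_group J\<^esub> (i::int))" for i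
    have "act \<pi> (v j) (orb i) = orb (i + 1)" for i
      using gen g J.int_pow_mult[of "gen j" i 1] by (simp add: orb_def act J.m_assoc)
    then have "act \<pi> (v j [^]\<^bsub>free_group S\<^esub> k) (\<iota> u) = \<iota> (u \<otimes>\<^bsub>free_group J\<^esub> gen j [^]\<^bsub>free_group J\<^esub> k)"
      using act_int_pow[where \<pi> = \<pi> and orb = orb and k = k and i = 0, OF bij vj] gen.prems by (simp add: orb_def)
    moreover have "fg_ext (free_group S) v (gen j [^]\<^bsub>free_group J\<^esub> k) = v j [^]\<^bsub>free_group S\<^esub> k"
      using \<phi>.hom_int_pow[OF g] vj by (simp add: fg_ext_gen[OF group_free_group])
    ultimately show ?case
      using gen g by (simp add: act_mult[OF bij] J.m_assoc)
  qed
  from this[where u = "\<one>\<^bsub>free_group J\<^esub>"] have *: "act \<pi> (fg_ext (free_group S) v w) (\<iota> \<one>\<^bsub>free_group J\<^esub>) = \<iota> w"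
    if "w \<in> carrier (free_group J)" for w
    using that by simp
  show ?thesis
  proof (rule \<phi>.inj_on_one_iff[THEN iffD2], intro allI impI)
    fix w assume w: "w \<in> carrier (free_group J)" "fg_ext (free_group S) v w = \<one>\<^bsub>free_group S\<^esub>"
    then show "w = \<one>\<^bsub>free_group J\<^esub>"
      using *[OF w(1)] inj[OF w(1)] by (simp add: free_group_one[of S])
  qed
qed

text \<open>A normal form over the image of \<open>K\<close> is pulled back letter by letter;
  injectivity then pulls back the equation.\<close>

lemma depends_on_inj_hom:
  assumes \<phi>: "group_hom G G' \<phi>" and inj: "inj_on \<phi> (carrier G)" and K: "subgroup K G"
    and g: "g \<in> carrier G" and dep: "depends_on G' (\<phi> ` K) (\<phi> g)"
  shows "depends_on G K g"
proof -
  interpret \<phi>: group_hom G G' \<phi> by (rule \<phi>)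
  interpret K: adjoin G K
    by (intro adjoin.intro adjoin_axioms.intro \<phi>.G.is_group K)
  interpret K': adjoin G' "\<phi> ` K"
    by (intro adjoin.intro adjoin_axioms.intro \<phi>.H.is_group \<phi>.subgroup_img_is_subgroup K)
  obtain w where w: "w \<in> carrier (adjoin_free G' (\<phi> ` K))" "w \<noteq> []" "K'.ext G' id (\<phi> g) w = \<one>\<^bsub>G'\<^esub>"
    using dep K'.depends_on_iff by blast
  define \<rho> where "\<rho> = map (map_sum (inv_into K \<phi>) (id :: int \<Rightarrow> int))"
  have KG: "K \<subseteq> carrier G" using K by (rule subgroup.subset)
  have letter: "letter_in (G\<lparr>carrier := K\<rparr>) integer_group (map_sum (inv_into K \<phi>) id s)"
    if "letter_in (G'\<lparr>carrier := \<phi> ` K\<rparr>) integer_group s" for s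
  proof (cases s)
    case (Inl x)
    then have x: "x \<in> \<phi> ` K" "x \<noteq> \<one>\<^bsub>G'\<^esub>" using that by auto
    then have "\<phi> (inv_into K \<phi> x) = x" by (simp add: f_inv_into_f)
    then show ?thesis using Inl x inv_into_into[OF x(1)] by auto
  qed (use that in auto)
  have isl: "isl (map_sum (inv_into K \<phi>) (id :: int \<Rightarrow> int) s) = isl s" for s by (cases s) auto
  have "\<rho> w \<in> carrier (adjoin_free G K)"
    using w(1) letter by (auto simp: \<rho>_def K.carrier_Q K'.carrier_Q normal_form_def successively_map isl list_all_iff)
  moreover have "\<phi> (K.ext G id g (\<rho> w)) = K'.ext G' id (\<phi> g) w \<and> K.ext G id g (\<rho> w) \<in> carrier G"
    if "list_all (letter_in (G'\<lparr>carrier := \<phi> ` K\<rparr>) integer_group) w" for w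
    using that
  proof (induction w)
    case (Cons s w)
    let ?x = "case map_sum (inv_into K \<phi>) id s of Inl h \<Rightarrow> h | Inr k \<Rightarrow> g [^]\<^bsub>G\<^esub> (k::int)"
    have "?x \<in> carrier G \<and> \<phi> ?x = (case s of Inl h \<Rightarrow> h | Inr k \<Rightarrow> \<phi> g [^]\<^bsub>G'\<^esub> k)"
      using Cons.prems g KG inv_into_into[of _ \<phi> K]
      by (cases s) (auto simp: f_inv_into_f \<phi>.hom_int_pow)
    then show ?case using Cons by (simp add: \<rho>_def K.ext_def K'.ext_def)
  qed (simp add: \<rho>_def K.ext_def K'.ext_def)
  then have "\<phi> (K.ext G id g (\<rho> w)) = \<one>\<^bsub>G'\<^esub>" "K.ext G id g (\<rho> w) \<in> carrier G"
    using w(1,3) by (auto simp: K'.carrier_Q normal_form_def)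
  then have "K.ext G id g (\<rho> w) = \<one>\<^bsub>G\<^esub>"
    using inj \<phi>.inj_on_one_iff by blast
  moreover have "\<rho> w \<noteq> []" using w(2) by (simp add: \<rho>_def)
  ultimately show ?thesis using K.depends_on_iff by blast
qed

text \<open>The graph of circles is reused with weights in the free group on \<open>J\<close>: the
  circle of \<open>A j\<close> collects \<open>gen j\<close>.\<close>

lemma (in syllable_words) fg_ext_A_inj: "inj_on (fg_ext G A) (carrier (free_group J))"
proof -
  interpret J: group "free_group J" by (rule group_free_group)
  let ?Y = "carrier (free_group J)" and ?o = "\<one>\<^bsub>free_group J\<^esub>"
  define wt where "wt t z = (if t = a then ?o else (case z of Z i \<Rightarrow> if i \<in> J then gen i else ?o | _ \<Rightarrow> ?o))" for t z
  have w: "wt t z \<in> ?Y" for t z by (auto simp: wt_def gen_in_free_group split: label.split)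
  obtain \<pi> \<iota> where rn: "runs \<pi> \<iota> (free_group J) wt line pos_on (\<lambda>_ _. 0) (\<lambda>_ _. ?o) (\<lambda>z. z) (\<lambda>_. ?o)"
  proof -
    have inj': "inj_on (\<lambda>z. (line t z, pos_on t z)) (range (\<lambda>z. z))" for t
      using same_point by (auto simp: inj_on_def)
    show thesis
      using automaton[where w = wt and ln = line and th = pos_on and N = "\<lambda>_ _. 0" and y = "\<lambda>_ _. ?o"
            and rep = "\<lambda>z. z" and \<kappa> = "\<lambda>_. ?o", OF group_free_group w J.one_closed J.one_closed mod_by_0 refl refl J.l_one[OF w, symmetric] inj'] that
      by blast
  qed
  have move: "act \<pi> (gen t [^] k) (\<iota> (u, z)) = \<iota> (u', z')"
    if "t \<in> {a, b}" "u \<in> ?Y" "u' \<in> ?Y" "line t z = line t z'" "pos_on t z + k = pos_on t z'"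
      "u \<otimes>\<^bsub>free_group J\<^esub> wt t z = u' \<otimes>\<^bsub>free_group J\<^esub> wt t z'" for t u u' z z' and k :: int
    by (rule runs_move[OF rn]) (use that w[of t z] w[of t z'] in simp_all)
  show ?thesis
  proof (rule fg_ext_inj[where S = "{a, b}", folded G_eq, where \<pi> = \<pi> and \<iota> = "\<lambda>u. \<iota> (u, B)"])
    show "A ` J \<subseteq> carrier G" by auto
    show "bij (\<pi> t)" for t by (rule runs_bij[OF rn])
    show "u = ?o" if "u \<in> ?Y" "\<iota> (u, B) = \<iota> (?o, B)" for u
      using that runs_eq[OF rn, of u ?o B B] by simp
    fix j u assume j: "j \<in> J" and u: "u \<in> ?Y"
    note bij = runs_bij[OF rn]
    note wd = line_def pos_on_def wt_def
    have "act \<pi> (xa (p j)) (\<iota> (u, B)) = \<iota> (u, X j)"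
      using u by (intro move) (auto simp: wd)
    moreover have "act \<pi> (xb (q j)) (\<iota> (u, X j)) = \<iota> (u, W j)"
      using u ab by (intro move) (auto simp: wd)
    moreover have "act \<pi> (xa (r j)) (\<iota> (u, W j)) = \<iota> (u, Z j)"
      using u by (intro move) (auto simp: wd)
    moreover have "act \<pi> (xb (s j)) (\<iota> (u, Z j)) = \<iota> (u \<otimes>\<^bsub>free_group J\<^esub> gen j, B)"
      using u j ab by (intro move) (auto simp: wd gen_in_free_group)
    ultimately show "act \<pi> (A j) (\<iota> (u, B)) = \<iota> (u \<otimes>\<^bsub>free_group J\<^esub> gen j, B)"
      by (simp add: A_def act_mult[where \<pi> = \<pi>, OF bij])
  qed
qed

text \<open>A single label suffices: \<open>c\<close> runs through a cycle of length 5, whose factor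
  is adjusted so that \<open>h\<close> multiplies weights by \<open>gen c\<close>.\<close>

lemma (in fifth_power) fg_ext_h_inj: "inj_on (fg_ext G (gen(c := h))) (carrier G)"
proof -
  \<comment> \<open>The solution \<open>y\<close> of \<open>d e y e d = c\<close>.\<close>
  let ?cyc = "inv (gen d \<otimes> gen e) \<otimes> gen c \<otimes> inv (gen e \<otimes> gen d)"
  let ?y = "\<lambda>t (l::unit). if t = c then ?cyc else if t \<in> S then gen t else \<one>"
  let ?M = "\<lambda>t (l::unit). if t = c then 5 else 1 :: int"
  have y: "?y t l \<in> carrier G" for t l by auto
  have inj: "inj_on (\<lambda>z::unit. ((), 0 :: int)) (range (\<lambda>z. z))" for t :: 'a by (auto simp: inj_on_def)
  obtain \<pi> \<iota> where rn: "runs \<pi> \<iota> G (\<lambda>_ _. \<one>) (\<lambda>_ _. ()) (\<lambda>_ _. 0) ?M ?y (\<lambda>z::unit. z) (\<lambda>_. \<one>)"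
    using automaton[where w = "\<lambda>_ _. \<one>" and ln = "\<lambda>_ _. ()" and th = "\<lambda>_ _. 0" and rep = "\<lambda>z::unit. z" and N = ?M and y = ?y and \<kappa> = "\<lambda>_. \<one>",
        OF is_group one_closed y one_closed mod_0 refl refl r_one[OF one_closed, symmetric] inj] by blast
  note bij = runs_bij[OF rn]
  have move: "act \<pi> (gen t) (\<iota> (u, ())) = \<iota> (u \<otimes> gen t, ())" if "t \<in> S" "t \<noteq> c" "u \<in> carrier G" for t u
    using runs_move[OF rn, of t u "u \<otimes> gen t" 1] that by simp
  have movec: "act \<pi> (gen c [^] (5::int)) (\<iota> (u, ())) = \<iota> (u \<otimes> ?cyc, ())" if "u \<in> carrier G" for u
    using runs_move[OF rn, of c u "u \<otimes> ?cyc" 5] that S by simp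
  show ?thesis
  proof (rule fg_ext_inj[where S = S and J = S, folded G_eq, where \<pi> = \<pi> and \<iota> = "\<lambda>u. \<iota> (u, ())"])
    show "(gen(c := h)) ` S \<subseteq> carrier G" by auto
    show "bij (\<pi> t)" for t using bij .
    show "u = \<one>" if "u \<in> carrier G" "\<iota> (u, ()) = \<iota> (\<one>, ())" for u
      using that runs_eq[OF rn, of u "\<one>" "()" "()"] by simp
    fix j u assume j: "j \<in> S" and u: "u \<in> carrier G"
    have "act \<pi> h (\<iota> (u, ())) = \<iota> (u \<otimes> gen c, ())"
      unfolding h_def act_mult[where \<pi> = \<pi>, OF bij] using u S ne
      by (simp add: move movec del: act_gen) (simp add: inv_mult_group m_assoc)
    then show "act \<pi> ((gen(c := h)) j) (\<iota> (u, ())) = \<iota> (u \<otimes> gen j, ())"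
      using move[of j u] j u by (simp del: act_gen)
  qed
qed

section \<open>The descending chain\<close>

lemma free_words_free_group: "free_words (free_group S) S"
proof -
  interpret G: group "free_group S" by (rule group_free_group)
  show ?thesis
    by (intro free_words.intro adjoin.intro adjoin_axioms.intro free_words_axioms.intro G.is_group G.subgroup_self refl)
qed

lemma free_group_hom_eqI:
  assumes p: "group_hom (free_group J) M p" and q: "group_hom (free_group J) M q"
    and eq: "\<And>j. j \<in> J \<Longrightarrow> p (gen j) = q (gen j)" and w: "w \<in> carrier (free_group J)"
  shows "p w = q w"
proof -
  interpret p: group_hom "free_group J" M p by (rule p)
  interpret q: group_hom "free_group J" M q by (rule q)
  show ?thesis
    using w
    by (induction w rule: free_group_induct)
       (auto simp: p.hom_one q.hom_one p.hom_int_pow q.hom_int_pow gen_in_free_group eq)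
qed

text \<open>The exponent sum of \<open>c\<close> modulo 5 is the invariant. It is read off from the
  action on the integers in which \<open>c\<close> is translation by 1 and the other generators are
  trivial.\<close>

lemma gen_notin_generate:
  fixes c :: 's
  assumes c: "c \<in> S"
  shows "gen c \<notin> generate (free_group S) (gen ` (S - {c}) \<union> {gen c [^]\<^bsub>free_group S\<^esub> (5::int)})"
    (is "_ \<notin> generate ?P ?X")
proof
  interpret P: group ?P by (rule group_free_group)
  have sub: "?X \<subseteq> carrier ?P" using c by (auto simp: gen_in_free_group)
  define \<pi> where "\<pi> i = (if i = c then (\<lambda>x. x + 1) else (\<lambda>x. x :: int))" for i
  have bij: "bij (\<pi> i)" for i
    by (intro o_bij[of "\<lambda>x. if i = c then x - 1 else x"]) (auto simp: \<pi>_def fun_eq_iff)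
  have gens: "(5::int) dvd act \<pi> x y - y" if "x \<in> ?X" for x y
  proof -
    have "act \<pi> (gen c [^]\<^bsub>?P\<^esub> (5::int)) y = y + 5"
      using act_gen_pow[where \<pi> = \<pi> and s = c and S = S and orb = "\<lambda>i. i" and k = 5 and i = y] bij c
      by (simp add: \<pi>_def)
    then show ?thesis
      using that by (elim UnE imageE DiffE insertE emptyE) (simp_all add: \<pi>_def)
  qed
  have "\<forall>y. (5::int) dvd act \<pi> w y - y" if "w \<in> generate ?P ?X" for w
    using that
  proof (induction w rule: generate.induct)
    case one
    then show ?case by (simp add: free_group_one)
  next
    case (incl x)
    then show ?case using gens by blast
  next
    case (inv x)
    then have x: "x \<in> carrier ?P" using sub by blast
    show ?case
    proof
      fix y
      have "y = act \<pi> x (act \<pi> (inv\<^bsub>?P\<^esub> x) y)"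
        using act_m_inv[where \<pi> = \<pi> and S = S and w = "inv\<^bsub>?P\<^esub> x" and y = y, OF bij _ refl] x by simp
      then show "5 dvd act \<pi> (inv\<^bsub>?P\<^esub> x) y - y"
        using gens[OF inv, of "act \<pi> (inv\<^bsub>?P\<^esub> x) y"] by (simp add: dvd_diff_commute)
    qed
  next
    case (eng h1 h2)
    have "act \<pi> (h1 \<otimes>\<^bsub>?P\<^esub> h2) x - x = (act \<pi> h2 (act \<pi> h1 x) - act \<pi> h1 x) + (act \<pi> h1 x - x)" for x
      by (simp add: act_mult[where \<pi> = \<pi>, OF bij])
    then show ?case using eng by (metis dvd_add)
  qed
  moreover assume "gen c \<in> generate ?P ?X"
  ultimately have "5 dvd act \<pi> (gen c) 0 - 0" by blast
  then show False by (simp add: \<pi>_def)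
qed

context group
begin

lemma Dep_incl:
  assumes "subgroup H G"
  shows "H \<subseteq> Dep G H"
proof
  interpret adjoin G H by (intro adjoin.intro adjoin_axioms.intro is_group assms)
  fix h assume "h \<in> H"
  then show "h \<in> Dep G H"
    using depends_on_mem[of h] H_carrier unfolding Dep_def by (intro generate.incl) auto
qed

lemma Dep_subgroup: "subgroup (Dep G H) G"
  unfolding Dep_def by (rule generate_is_subgroup) auto

lemma Dep_root:
  assumes "subgroup H G" "g \<in> carrier G" "k \<noteq> (0::int)" "g [^] k \<in> H"
  shows "g \<in> Dep G H"
proof -
  interpret adjoin G H by (intro adjoin.intro adjoin_axioms.intro is_group assms)
  have "depends_on G H g"
    using depends_on_root[OF assms(2,3)] depends_on_mem[OF assms(4)] by blast
  then show ?thesis unfolding Dep_def using assms(2) by (intro generate.incl) auto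
qed

lemma Dep_leI:
  assumes "subgroup U G" "\<And>g. g \<in> carrier G \<Longrightarrow> depends_on G H g \<Longrightarrow> g \<in> U"
  shows "Dep G H \<subseteq> U"
  unfolding Dep_def using assms by (intro generate_subgroup_incl) auto

end

section \<open>The groups between \<open>H_m\<close> and its dependence closure\<close>

context syllable_words
begin

definition hh :: "nat \<Rightarrow> 'a letter list" where
  "hh i = A (Suc i) \<otimes> A (Suc (Suc i)) \<otimes> A i [^] (5::int) \<otimes> A (Suc (Suc i)) \<otimes> A (Suc i)"

lemma hh_closed [simp]: "hh i \<in> carrier G" by (simp add: hh_def)

text \<open>
  Indices start at 0: \<open>A i\<close> and \<open>hh i\<close> are the elements \<open>A\<^bsub>i+1\<^esub>\<close> and \<open>h\<^bsub>i+1\<^esub>\<close> of the statement, and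
  \<open>KK m j\<close> is the group \<open>K\<^sub>j\<close> above for \<open>n = m + 1\<close>.
\<close>

fun KK :: "nat \<Rightarrow> nat \<Rightarrow> 'a letter list set" where
  "KK m 0 = generate G (A ` {..m})"
| "KK m (Suc j) = generate G (hh ` {..<j} \<union> {A j [^] (5::int)} \<union> A ` {j<..m})"

text \<open>Images of the free generators under which \<open>KK m t\<close>, for
  \<open>t < m\<close>, is viewed inside the free group on \<open>{..m}\<close>; there the fifth
  power construction applies with \<open>c\<close>, \<open>d\<close>, \<open>e\<close> at
  \<open>t\<close>, \<open>t + 1\<close>, \<open>t + 2\<close>.\<close>

definition mix :: "nat \<Rightarrow> nat \<Rightarrow> 'a letter list" where
  "mix t i = (if i < t then hh i else A i)"

lemma mix_closed [simp]: "mix t i \<in> carrier G" by (simp add: mix_def)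

lemma mix_image: "mix t ` J \<subseteq> carrier G" by auto

lemma KK_subgroup: "subgroup (KK m j) G"
  by (cases j) (auto intro!: generate_is_subgroup)

lemmas KK_m = subgroup.m_closed[OF KK_subgroup] and KK_inv = subgroup.m_inv_closed[OF KK_subgroup]

lemma KK_I:
  "i \<le> m \<Longrightarrow> A i \<in> KK m 0"
  "i < j \<Longrightarrow> hh i \<in> KK m (Suc j)"
  "A j [^] (5::int) \<in> KK m (Suc j)"
  "j < i \<Longrightarrow> i \<le> m \<Longrightarrow> A i \<in> KK m (Suc j)"
  by (auto intro!: generate.incl)

lemma KK_Suc_subset:
  assumes "Suc j \<le> m"
  shows "KK m (Suc j) \<subseteq> KK m j"
proof (cases j)
  case 0
  have "A 0 [^] (5::int) \<in> KK m 0"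
    using subgroup_int_pow_closed[OF KK_subgroup KK_I(1)] by simp
  then show ?thesis
    using 0 KK_I(1) assms by (simp del: KK.simps(1)) (intro generate_subgroup_incl[OF _ KK_subgroup], auto)
next
  case (Suc i)
  have pow: "A j [^] (5::int) \<in> KK m (Suc i)"
    using assms Suc by (intro subgroup_int_pow_closed[OF KK_subgroup] KK_I(4)) auto
  have "hh i \<in> KK m (Suc i)"
    unfolding hh_def using assms Suc by (intro KK_m KK_I(3,4)) auto
  then have "hh ` {..<j} \<union> {A j [^] (5::int)} \<union> A ` {j<..m} \<subseteq> KK m (Suc i)"
    using pow Suc KK_I(2,4)[where j = i and m = m] by (auto simp: less_Suc_eq simp del: KK.simps)
  then have "generate G (hh ` {..<j} \<union> {A j [^] (5::int)} \<union> A ` {j<..m}) \<subseteq> KK m (Suc i)"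
    by (rule generate_subgroup_incl[OF _ KK_subgroup])
  then show ?thesis using Suc by simp
qed

lemma fifth_power_nat: "Suc (Suc t) \<le> m \<Longrightarrow> fifth_power (free_group {..m}) {..m} t (Suc t) (Suc (Suc t))"
  using free_words_free_group[of "{..m}"] by (simp add: fifth_power_def fifth_power_axioms_def)

lemma mix_hom: "group_hom (free_group {..m}) G (fg_ext G (mix t))"
  by (rule group_hom_fg_ext[OF is_group mix_image])

lemma mix_gen [simp]: "fg_ext G (mix t) (gen i) = mix t i"
  by (rule fg_ext_gen[of G "mix t" i, OF is_group mix_closed])

lemma mix_fifth_power_h:
  assumes "Suc (Suc t) \<le> m"
  shows "fg_ext G (mix t) (fifth_power.h (free_group {..m}) t (Suc t) (Suc (Suc t))) = hh t"
proof -
  interpret P: fifth_power "free_group {..m}" "{..m}" t "Suc t" "Suc (Suc t)"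
    using assms by (rule fifth_power_nat)
  interpret \<phi>: group_hom "free_group {..m}" G "fg_ext G (mix t)" by (rule mix_hom)
  show ?thesis
    using P.cde_closed by (simp add: P.h_def hh_def \<phi>.hom_int_pow) (simp add: mix_def)
qed

text \<open>Passing from \<open>t\<close> to \<open>t + 1\<close> composes with the endomorphism of
  \<open>fg_ext_h_inj\<close>. The bound makes room for the indices of \<open>d\<close> and
  \<open>e\<close>.\<close>

lemma mix_inj: "t + 1 \<le> m \<or> t = 0 \<Longrightarrow> inj_on (fg_ext G (mix t)) (carrier (free_group {..m}))"
proof (induction t)
  case 0
  have "mix 0 = A" by (auto simp: mix_def)
  then show ?case using fg_ext_A_inj by simp
next
  case (Suc t)
  then have t: "Suc (Suc t) \<le> m" by simp
  interpret P: fifth_power "free_group {..m}" "{..m}" t "Suc t" "Suc (Suc t)"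
    using t by (rule fifth_power_nat)
  let ?\<psi> = "fg_ext (free_group {..m}) (gen(t := P.h))"
  have \<psi>: "group_hom (free_group {..m}) (free_group {..m}) ?\<psi>"
    by (rule group_hom_fg_ext[OF group_free_group]) (auto simp: gen_in_free_group)
  interpret \<psi>: group_hom "free_group {..m}" "free_group {..m}" ?\<psi> by (rule \<psi>)
  interpret \<phi>: group_hom "free_group {..m}" G "fg_ext G (mix t)" by (rule mix_hom)
  have comp: "fg_ext G (mix (Suc t)) w = (fg_ext G (mix t) \<circ> ?\<psi>) w" if w: "w \<in> carrier (free_group {..m})" for w
  proof (rule free_group_hom_eqI[OF mix_hom _ _ w])
    show "group_hom (free_group {..m}) G (fg_ext G (mix t) \<circ> ?\<psi>)"
      by (intro group_hom.intro group_hom_axioms.intro group_free_group is_group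
          Group.hom_compose[OF \<psi>.homh \<phi>.homh])
    fix i assume "i \<in> {..m}"
    then have "?\<psi> (gen i) = (gen(t := P.h)) i"
      by (intro fg_ext_gen[OF group_free_group]) (auto simp: gen_in_free_group)
    then show "fg_ext G (mix (Suc t)) (gen i) = (fg_ext G (mix t) \<circ> ?\<psi>) (gen i)"
      using mix_fifth_power_h[OF t] by (auto simp: mix_def)
  qed
  have "inj_on (fg_ext G (mix t) \<circ> ?\<psi>) (carrier (free_group {..m}))"
  proof (rule comp_inj_on[OF P.fg_ext_h_inj])
    have "?\<psi> ` carrier (free_group {..m}) \<subseteq> carrier (free_group {..m})"
      using \<psi>.hom_closed by (rule image_subsetI)
    moreover have "inj_on (fg_ext G (mix t)) (carrier (free_group {..m}))"
      using Suc.IH t by simp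
    ultimately show "inj_on (fg_ext G (mix t)) (?\<psi> ` carrier (free_group {..m}))"
      by (rule inj_on_subset[rotated])
  qed
  moreover have "inj_on (fg_ext G (mix (Suc t))) (carrier (free_group {..m})) \<longleftrightarrow>
      inj_on (fg_ext G (mix t) \<circ> ?\<psi>) (carrier (free_group {..m}))"
    by (rule inj_on_cong) (rule comp)
  ultimately show ?case by (rule iffD2[rotated])
qed

lemma mix_generate:
  assumes "Y \<subseteq> carrier (free_group {..m})"
  shows "fg_ext G (mix t) ` generate (free_group {..m}) Y = generate G (fg_ext G (mix t) ` Y)"
  using group_hom.generate_img[OF mix_hom assms] by simp

lemma KK_mix:
  assumes "j + 1 \<le> m \<or> j = 0"
  shows "KK m j \<subseteq> fg_ext G (mix j) ` carrier (free_group {..m})"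
proof -
  interpret \<phi>: group_hom "free_group {..m}" G "fg_ext G (mix j)" by (rule mix_hom)
  have sub: "subgroup (fg_ext G (mix j) ` carrier (free_group {..m})) G"
    using \<phi>.img_is_subgroup .
  have im: "mix j i \<in> fg_ext G (mix j) ` carrier (free_group {..m})" if "i \<le> m" for i
    using that by (intro image_eqI[of _ _ "gen i"]) (auto simp: gen_in_free_group)
  show ?thesis
  proof (cases j)
    case 0
    have "A ` {..m} \<subseteq> fg_ext G (mix j) ` carrier (free_group {..m})"
    proof (rule image_subsetI)
      fix i assume "i \<in> {..m}"
      then show "A i \<in> fg_ext G (mix j) ` carrier (free_group {..m})"
        using im[of i] 0 by (simp add: mix_def)
    qed
    from generate_subgroup_incl[OF this sub] show ?thesis using 0 by simp
  next
    case (Suc i)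
    let ?R = "fg_ext G (mix j) ` carrier (free_group {..m})"
    note R_m = subgroup.m_closed[OF sub] and R_inv = subgroup.m_inv_closed[OF sub]
    have hR: "hh k \<in> ?R" if "k < j" for k using im[of k] that assms Suc by (simp add: mix_def)
    have AR: "A k \<in> ?R" if "j \<le> k" "k \<le> m" for k using im[of k] that by (simp add: mix_def)
    \<comment> \<open>The definition of \<open>hh i\<close> solved for its fifth power: one
      generator can be traded for the other.\<close>
    have "A i [^] (5::int) = inv (A (Suc i) \<otimes> A (Suc (Suc i))) \<otimes> hh i \<otimes> inv (A (Suc (Suc i)) \<otimes> A (Suc i))"
      by (simp add: hh_def inv_mult_group m_assoc)
    also have "\<dots> \<in> ?R"
      using assms Suc hR[of i] AR by (intro R_m R_inv) auto
    finally have "hh ` {..<i} \<union> {A i [^] (5::int)} \<union> A ` {i<..m} \<subseteq> ?R"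
      using hR AR Suc by auto
    from generate_subgroup_incl[OF this sub] show ?thesis using Suc by simp
  qed
qed

text \<open>For \<open>j = 0\<close> the truncated difference makes this the closedness of
  \<open>KK m 0\<close>, which starts the induction.\<close>

theorem dependent_KK:
  assumes "j \<le> m" "g \<in> carrier G" "depends_on G (KK m j) g"
  shows "g \<in> KK m (j - 1)"
  using assms
proof (induction j arbitrary: g)
  case 0
  then show ?case using dependent_mem_generate[of g "{..m}"] by simp
next
  case (Suc j)
  have dep: "depends_on G (KK m j) g"
    using depends_on_mono[OF KK_Suc_subset] Suc.prems by blast
  show ?case
  proof (cases j)
    case 0
    then show ?thesis using Suc.IH Suc.prems dep by simp
  next
    case (Suc t)
    have t: "Suc (Suc t) \<le> m" using Suc Suc.prems by simp
    interpret P: fifth_power "free_group {..m}" "{..m}" t "Suc t" "Suc (Suc t)"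
      using t by (rule fifth_power_nat)
    interpret \<phi>: group_hom "free_group {..m}" G "fg_ext G (mix t)" by (rule mix_hom)
    \<comment> \<open>Only now can \<open>g\<close> be written in the free generators of
      \<open>mix t\<close>, where \<open>KK m (Suc j)\<close> and \<open>KK m j\<close> correspond
      to \<open>K\<close> and \<open>N\<close>.\<close>
    have "g \<in> KK m t" using Suc.IH[OF _ Suc.prems(2) dep] Suc Suc.prems by simp
    then obtain w where w: "w \<in> carrier (free_group {..m})" "g = fg_ext G (mix t) w"
      using KK_mix[of t m] t by auto
    have d: "t + 1 \<le> m" using t by simp
    have "fg_ext G (mix t) ` P.K = KK m (Suc j)"
    proof -
      have "{..m} - {t, Suc t} = {..<t} \<union> {Suc t<..m}" using t by auto
      then have "fg_ext G (mix t) ` (gen ` ({..m} - {t, Suc t}) \<union> {P.d5, P.h}) =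
          hh ` {..<t} \<union> A ` {Suc t<..m} \<union> {A (Suc t) [^] (5::int), hh t}"
        using mix_fifth_power_h[OF t] P.cde_closed
        by (simp add: image_Un image_image \<phi>.hom_int_pow) (simp add: mix_def)
      also have "\<dots> = hh ` {..<j} \<union> {A j [^] (5::int)} \<union> A ` {j<..m}"
        using Suc by (auto simp: lessThan_Suc)
      finally show ?thesis
        unfolding P.K_def by (subst mix_generate) (auto simp: gen_in_free_group)
    qed
    then have "depends_on G (fg_ext G (mix t) ` P.K) (fg_ext G (mix t) w)"
      using Suc.prems(3) w(2) by (simp del: KK.simps)
    then have "depends_on (free_group {..m}) P.K w"
      using mix_inj[of t m] t by (intro depends_on_inj_hom[OF mix_hom _ P.K_subgroup w(1)]) simp_all
    then have "w \<in> P.N" by (rule P.dependent_mem_N[OF w(1)])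
    moreover have "fg_ext G (mix t) ` P.N = KK m j"
    proof -
      have "{..m} - {t} = {..<t} \<union> {t<..m}" using t by auto
      then have "fg_ext G (mix t) ` (gen ` ({..m} - {t}) \<union> {gen t [^]\<^bsub>free_group {..m}\<^esub> (5::int)}) =
          hh ` {..<t} \<union> A ` {t<..m} \<union> {A t [^] (5::int)}"
        using P.cde_closed by (simp add: image_Un image_image \<phi>.hom_int_pow) (simp add: mix_def)
      also have "\<dots> = hh ` {..<t} \<union> {A t [^] (5::int)} \<union> A ` {t<..m}" by auto
      finally show ?thesis
        unfolding P.N_def using Suc t by (subst mix_generate) (auto simp: gen_in_free_group)
    qed
    ultimately show ?thesis using w(2) by auto
  qed
qed

text \<open>The inclusion from right to left is explicit: a root yields \<open>A i\<close>, after
  which \<open>hh t\<close> with \<open>Suc t = i\<close> can be solved for the fifth power of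
  \<open>A t\<close>.\<close>

lemma Dep_KK:
  assumes "j \<le> m"
  shows "Dep G (KK m j) = KK m (j - 1)"
proof
  show "Dep G (KK m j) \<subseteq> KK m (j - 1)"
    using dependent_KK[OF assms] by (intro Dep_leI KK_subgroup)
  show "KK m (j - 1) \<subseteq> Dep G (KK m j)"
  proof (cases j)
    case 0
    then show ?thesis using Dep_incl[OF KK_subgroup] by (simp del: KK.simps)
  next
    case (Suc i)
    note D_m = subgroup.m_closed[OF Dep_subgroup] and D_inv = subgroup.m_inv_closed[OF Dep_subgroup]
    have mem: "x \<in> Dep G (KK m j)" if "x \<in> KK m (Suc i)" for x
      using that Dep_incl[OF KK_subgroup] Suc by blast
    have root: "A i \<in> Dep G (KK m j)"
      unfolding Suc by (rule Dep_root[OF KK_subgroup A_closed _ KK_I(3)]) simp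
    have AD: "A k \<in> Dep G (KK m j)" if "i \<le> k" "k \<le> m" for k
      using that root mem[OF KK_I(4)] by (cases "k = i") auto
    show ?thesis
    proof (cases i)
      case 0
      then have "A ` {..m} \<subseteq> Dep G (KK m j)" using AD by (auto simp del: KK.simps)
      from generate_subgroup_incl[OF this Dep_subgroup] show ?thesis using Suc 0 by simp
    next
      case (Suc t)
      have "A t [^] (5::int) = inv (A (Suc t) \<otimes> A (Suc (Suc t))) \<otimes> hh t \<otimes> inv (A (Suc (Suc t)) \<otimes> A (Suc t))"
        by (simp add: hh_def inv_mult_group m_assoc)
      also have "\<dots> \<in> Dep G (KK m j)"
        using assms Suc \<open>j = Suc i\<close> mem[OF KK_I(2), of t] AD by (intro D_m D_inv) auto
      finally have "hh ` {..<t} \<union> {A t [^] (5::int)} \<union> A ` {t<..m} \<subseteq> Dep G (KK m j)"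
        using AD mem[OF KK_I(2)] Suc by (auto simp del: KK.simps)
      from generate_subgroup_incl[OF this Dep_subgroup] show ?thesis using Suc \<open>j = Suc i\<close> by simp
    qed
  qed
qed

lemma A_0_notin: "A 0 \<notin> KK m 1"
proof
  interpret \<phi>: group_hom "free_group {..m}" G "fg_ext G (mix 0)" by (rule mix_hom)
  let ?P = "free_group {..m}"
  have g: "gen i \<in> carrier ?P" if "i \<le> m" for i using that by (simp add: gen_in_free_group)
  let ?X = "gen ` ({..m} - {0}) \<union> {gen 0 [^]\<^bsub>?P\<^esub> (5::int)}"
  have sub: "?X \<subseteq> carrier ?P" using g by auto
  have "{..m} - {0} = {0<..m}" by auto
  then have "fg_ext G (mix 0) ` ?X = {A 0 [^] (5::int)} \<union> A ` {0<..m}"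
    using g by (simp add: image_Un image_image \<phi>.hom_int_pow) (simp add: mix_def)
  then have "fg_ext G (mix 0) ` generate ?P ?X = KK m 1"
    using mix_generate[OF sub, of 0] by simp
  moreover assume "A 0 \<in> KK m 1"
  ultimately have "A 0 \<in> fg_ext G (mix 0) ` generate ?P ?X" by (simp only:)
  then obtain w where w: "w \<in> generate ?P ?X" "A 0 = fg_ext G (mix 0) w" by (rule imageE)
  then have eq: "fg_ext G (mix 0) w = fg_ext G (mix 0) (gen 0)" by (simp add: mix_def)
  have "w = gen 0"
    using inj_onD[OF mix_inj[of 0 m] eq] \<phi>.G.generate_in_carrier[OF sub w(1)] g[of 0] by simp
  then show False using gen_notin_generate[of 0 "{..m}"] w(1) by simp
qed

text \<open>\<open>Dep\<close> lowers the second index by one. If the sequence were constant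
  earlier, the chain of inclusions would put \<open>KK m 0\<close> inside \<open>KK m 1\<close>,
  against \<open>A_0_notin\<close>.\<close>

theorem depl_KK:
  assumes "1 \<le> m"
  shows "depl G (KK m m) = enat m"
proof -
  have iter: "Dep_iter G (KK m m) i = KK m (m - i)" for i
    by (induction i) (simp_all add: Dep_iter_def Dep_KK)
  have sub: "KK m (m - i) \<subseteq> KK m 0" for i
  proof -
    have "KK m j \<subseteq> KK m 0" if "j \<le> m" for j
      using that by (induction j) (use KK_Suc_subset in \<open>auto simp del: KK.simps\<close>)
    then show ?thesis by simp
  qed
  have closure: "Dep_closure G (KK m m) = KK m 0"
    unfolding Dep_closure_def iter using sub[THEN subsetD] by (auto intro!: exI[of _ m] simp del: KK.simps)
  have stable: "Dep_iter G (KK m m) i = Dep_closure G (KK m m) \<longleftrightarrow> m \<le> i" for i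
  proof
    assume "Dep_iter G (KK m m) i = Dep_closure G (KK m m)"
    then have eq: "KK m (m - i) = KK m 0" by (simp only: iter closure)
    show "m \<le> i"
    proof (rule ccontr)
      assume "\<not> m \<le> i"
      have "KK m j \<subseteq> KK m 1" if "1 \<le> j" "j \<le> m" for j
        using that by (induction j rule: dec_induct) (use KK_Suc_subset in \<open>auto simp del: KK.simps\<close>)
      then have "KK m 0 \<subseteq> KK m 1" using eq \<open>\<not> m \<le> i\<close> by (metis diff_le_self le_add1 not_le plus_1_eq_Suc zero_less_diff Suc_leI One_nat_def)
      then show False using A_0_notin KK_I(1)[of 0 m] by blast
    qed
  qed (simp add: iter closure del: KK.simps)
  then show ?thesis
    unfolding depl_def stable by (auto intro: Least_equality)
qed

end

section \<open>The prime exponents\<close>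

abbreviation prime_at :: "nat \<Rightarrow> nat" where
  "prime_at \<equiv> enumerate {p. prime p}"

lemma prime_at_prime: "prime (prime_at k)"
  using enumerate_in_set[OF primes_infinite, of k] by simp

lemma prime_at_less: "prime_at k < prime_at l \<longleftrightarrow> k < l"
  using enumerate_mono_iff[OF primes_infinite] by simp

lemma prime_at_eq: "prime_at k = prime_at l \<longleftrightarrow> k = l"
  by (metis less_irrefl linorder_neqE_nat prime_at_less)

lemma prime_at_odd: "0 < k \<Longrightarrow> odd (prime_at k)"
  using prime_at_less[of 0 k] prime_ge_2_nat[OF prime_at_prime, of 0]
  by (metis prime_at_prime prime_odd_nat le_less_trans)

lemma prime_at_even: "even (prime_at k) \<Longrightarrow> k = 0"
  using prime_at_odd by blast

lemma prime_at_0: "prime_at 0 = 2"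
proof -
  obtain k where "prime_at k = 2"
    using enumerate_Ex[OF primes_infinite, of 2] two_is_prime_nat by auto
  then show ?thesis using prime_at_even[of k] by fastforce
qed

text \<open>The only number between two odd primes at distance 2 is even.\<close>

lemma prime_at_twin: "prime_at l = prime_at k + 2 \<Longrightarrow> 0 < k \<Longrightarrow> l = Suc k"
proof (rule ccontr)
  assume eq: "prime_at l = prime_at k + 2" and k: "0 < k" and ne: "l \<noteq> Suc k"
  then have "Suc k < l" using prime_at_less[of k l] by simp
  then have "prime_at (Suc k) < prime_at l" "prime_at k < prime_at (Suc k)"
    by (simp_all add: prime_at_less)
  then have "prime_at (Suc k) = prime_at k + 1" using eq by simp
  then show False using prime_at_odd[of k] prime_at_odd[of "Suc k"] k by simp
qed

lemma syllable_words_primes: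
  assumes "a \<noteq> b"
  shows "syllable_words (free_group {a, b}) a b (\<lambda>i. int (prime_at (4 * i))) (\<lambda>i. int (prime_at (4 * i + 1)))
    (\<lambda>i. int (prime_at (4 * i + 2))) (\<lambda>i. int (prime_at (4 * i + 3)))"
proof (intro syllable_words.intro syllable_words_axioms.intro free_words_free_group assms)
  fix i j k :: nat
  show "0 < int (prime_at (4 * i))" "0 < int (prime_at (4 * i + 1))" "0 < int (prime_at (4 * i + 2))"
    "0 < int (prime_at (4 * i + 3))"
    using prime_gt_0_nat[OF prime_at_prime] by simp_all
  show "int (prime_at (4 * i)) = int (prime_at (4 * j)) \<longleftrightarrow> i = j"
    "int (prime_at (4 * i + 1)) = int (prime_at (4 * j + 1)) \<longleftrightarrow> i = j"
    "int (prime_at (4 * i + 2)) = int (prime_at (4 * j + 2)) \<longleftrightarrow> i = j"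
    "int (prime_at (4 * i + 3)) = int (prime_at (4 * j + 3)) \<longleftrightarrow> i = j"
    by (simp_all only: of_nat_eq_iff prime_at_eq) simp_all
  show "int (prime_at (4 * i + 2)) \<noteq> int (prime_at (4 * j))"
    unfolding of_nat_eq_iff prime_at_eq by presburger
  show "int (prime_at (4 * i + 1)) \<noteq> int (prime_at (4 * j + 3))"
    unfolding of_nat_eq_iff prime_at_eq by presburger
  show "int (prime_at (4 * i)) + int (prime_at (4 * j + 2)) \<noteq> int (prime_at (4 * k))"
  proof
    assume "int (prime_at (4 * i)) + int (prime_at (4 * j + 2)) = int (prime_at (4 * k))"
    then have eq: "prime_at (4 * k) = prime_at (4 * i) + prime_at (4 * j + 2)" by linarith
    show False
    \<comment> \<open>For \<open>i = 0\<close> the first summand is 2 and the other two primes are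
      consecutive, but their indices are 2 and 0 modulo 4. Otherwise two odd primes have an even sum
      greater than 2.\<close>
    proof (cases "i = 0")
      case True
      then have "4 * k = Suc (4 * j + 2)"
        using eq by (intro prime_at_twin) (auto simp: prime_at_0)
      then show False by presburger
    next
      case False
      then have "even (prime_at (4 * k))" using eq prime_at_odd[of "4 * i"] prime_at_odd[of "4 * j + 2"] by simp
      then have "k = 0" using prime_at_even[of "4 * k"] by simp
      then show False using eq prime_at_0 prime_ge_2_nat[OF prime_at_prime, of "4 * i"]
          prime_ge_2_nat[OF prime_at_prime, of "4 * j + 2"] by simp
    qed
  qed
  show "int (prime_at (4 * i + 3)) + int (prime_at (4 * j + 1)) \<noteq> int (prime_at (4 * k + 3))"
  proof
    assume "int (prime_at (4 * i + 3)) + int (prime_at (4 * j + 1)) = int (prime_at (4 * k + 3))"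
    \<comment> \<open>None of the three indices is 0, so all three primes are odd and parity
      decides.\<close>
    then have "prime_at (4 * i + 3) + prime_at (4 * j + 1) = prime_at (4 * k + 3)" by linarith
    then have "even (prime_at (4 * k + 3))"
      using prime_at_odd[of "4 * i + 3"] prime_at_odd[of "4 * j + 1"] by (metis add_gr_0 odd_even_add zero_less_numeral zero_less_one)
    then show False using prime_at_even by fastforce
  qed
qed

theorem proposition7p2:
  fixes a b :: 'a and m :: nat
  assumes "a \<noteq> b" and "m \<ge> 1"
  shows "depl (free_group {a, b}) (H_subgp a b m) = enat m"
proof -
  define p where "p i = int (prime_at (4 * i))" for i
  define q where "q i = int (prime_at (4 * i + 1))" for i
  define r where "r i = int (prime_at (4 * i + 2))" for i
  define s where "s i = int (prime_at (4 * i + 3))" for i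
  interpret syllable_words "free_group {a, b}" a b p q r s
    using syllable_words_primes[OF assms(1)] unfolding p_def q_def r_def s_def .
  have idx: "4 * Suc i - 3 - 1 = 4 * i" "4 * Suc i - 2 - 1 = 4 * i + 1" "4 * Suc i - 1 - 1 = 4 * i + 2"
    "4 * i + 3 - 1 = 4 * i + 2" "4 * Suc i - 1 = 4 * i + 3" for i by simp_all
  have A_eq: "A_elt a b (Suc i) = A i" for i
    unfolding A_elt_def Let_def nth_prime_def A_def p_def q_def r_def s_def int_pow_int idx by (rule refl)
  have h_eq: "h_elt a b (Suc i) = hh i" for i
    unfolding h_elt_def Let_def hh_def by (simp add: A_eq flip: int_pow_int)
  obtain j where j: "m = Suc j" using assms(2) by (cases m) auto
  have "h_elt a b ` {1..<m} = hh ` {..<j}"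
  proof -
    have "{1..<m} = Suc ` {..<j}" using j by (auto simp: image_iff Bex_def) (metis Suc_le_D Suc_less_eq)
    then show ?thesis by (simp add: image_image h_eq)
  qed
  moreover have "A_elt a b (m + 1) = A m" "A_elt a b m = A j" using A_eq[of m] A_eq[of j] j by simp_all
  \<comment> \<open>Indices up to \<open>m\<close> count \<open>m + 1\<close> words, so a single
    word remains beyond the fifth power.\<close>
  moreover have "{j<..m} = {m}" using j by auto
  ultimately have "H_subgp a b m = KK m m"
    using int_pow_int[of "free_group {a, b}" "A j" 5]
    by (simp add: H_subgp_def Let_def j insert_commute)
  then show ?thesis using depl_KK[OF assms(2)] by simp
qed

end
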